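(* Let $n$ be odd and let $(M^n,g^0)$ be an unobstructed asymptotically Poincaré–Einstein metric. Let $g(t)$ be the solution of the normalized Ricci flow $\partial_t g=-2(\mathrm{Rc}(g)+(n-1)g)$, $g(0)=g^0$, on an interval $[0,T_0)$ on which $g(t)$ is asymptotically Poincaré–Einstein. Then the conformal anomaly of $g(t)$ is constant in $t$ along the flow.
   Context: $M^n$ is the (connected) interior of a compact manifold with boundary $\overline M$. A boundary defining function is a smooth $x\ge 0$ on $\overline M$, positive on $M$, vanishing exactly on $\partial M$, with $dx\ne 0$ on $\partial M$. A metric $g$ on $M$ is conformally compact if $\overline g=x^2g$ extends to a smooth metric on $\overline M$; the conformal class $\mathfrak c(g)$ of $\overline g|_{T\partial M}$ is its conformal infinity. $g$ is asymptotically hyperbolic (AH) if in addition $|dx|^2_{\overline g}=1$ on $\partial M$. With $E(g)=\mathrm{Rc}(g)+(n-1)g$, an AH metric is asymptotically Poincaré–Einstein (APE) if $|E(g)|_g=\mathcal O(x^n)$ at $\partial M$. Unobstructed ($n$ odd): for a metric $g_0$ on $\partial M$ there are even-order tensors $g_2,\dots,g_{n-3}$ and a trace-free tensor $\tilde g_{n-1}$ (the ambient obstruction tensor) on $\partial M$, uniquely determined by $g_0$ through universal differential expressions, such that for some $g_{n-1}$ the metric $x^{-2}\big(dx^2+g_0+x^2g_2+\dots+x^{n-3}g_{n-3}+x^{n-1}(g_{n-1}+\tilde g_{n-1}\log x)\big)$ has coordinate components $E_{ij}=o(x^{n-3})$. An APE metric is unobstructed if $\tilde g_{n-1}=0$ for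 representatives $g_0$ of its conformal infinity. Solutions of the normalized Ricci flow are understood to remain AH (smoothly conformally compact) with fixed conformal infinity $\mathfrak c(g(t))=\mathfrak c(g^0)$; it is known that the solution starting at an unobstructed APE metric remains APE on some interval $[0,T_0)$, $T_0>0$. Conformal anomaly: given an APE metric $g$ and a representative $g_0\in\mathfrak c(g)$, there is a special boundary defining function $x$, unique near $\partial M$, with $g=x^{-2}(dx^2+\hat g_x)$ near $\partial M$, $\hat g_x$ a smooth family of metrics on $\partial M$ with $\hat g_0=g_0$. Write $$dV_g=\left(\frac{\det \hat g_x}{\det g_0}\right)^{1/2}\frac{dV_{g_0}\,dx}{x^n}=\left(1+v_{2}x^2+\dots+v_{n-1}x^{n-1}+\cdots\right)\frac{dV_{g_0}\,dx}{x^n},$$ with $v_j$ functions on $\partial M$. The conformal anomaly of $g$ is $\int_{\partial M}v_{n-1}\,dV_{g_0}$ (the coefficient of $\log(1/\varepsilon)$ in the expansion of $\mathrm{Vol}_g(\{x>\varepsilon\})$ as $\varepsilon\to0$). It is known to be independent of the choice of representative $g_0$. For the flow $g(t)$ it is computed with the special boundary defining function $x_t$ associated to $g(t)$ and a fixed $g_0\in\mathfrak c(g^0)$. *)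

theory Defs
  imports "HOL-Analysis.Analysis" "HOL-Library.Landau_Symbols"
begin

section \<open>Smooth functions on subsets of normed spaces\<close>

primrec Ck_on :: "nat \<Rightarrow> 'a::real_normed_vector set \<Rightarrow> ('a \<Rightarrow> 'b::real_normed_vector) \<Rightarrow> bool" where
  "Ck_on 0 S f \<longleftrightarrow> continuous_on S f"
| "Ck_on (Suc k) S f \<longleftrightarrow>
     (\<forall>z\<in>S. f differentiable at z) \<and> (\<forall>v. Ck_on k S (\<lambda>z. frechet_derivative f (at z) v))"

text \<open>\<^const>\<open>Ck_on\<close> is meant for open sets. On an arbitrary set (a half space, a space-time region
  with an initial time) smoothness means local extendability to a smooth function on an open set.\<close>

definition smooth_on :: "'a::real_normed_vector set \<Rightarrow> ('a \<Rightarrow> 'b::real_normed_vector) \<Rightarrow> bool" where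
  "smooth_on S f \<longleftrightarrow>
     (\<forall>z\<in>S. \<exists>W F. open W \<and> z \<in> W \<and> (\<forall>k. Ck_on k W F) \<and> (\<forall>w\<in>W \<inter> S. F w = f w))"

definition partial :: "'k::finite \<Rightarrow> (real^'k \<Rightarrow> real) \<Rightarrow> real^'k \<Rightarrow> real" where
  "partial i f z = frechet_derivative f (at z) (axis i 1)"


section \<open>Smooth compact manifolds with boundary\<close>

text \<open>A chart is a pair of its domain and its coordinate map. For a manifold with boundary of
  dimension \<open>n = CARD('b option) = CARD('b) + 1\<close> the coordinates are indexed by
  \<^typ>\<open>'b option\<close>: the index \<^const>\<open>None\<close> is the coordinate that is nonnegative on the half space
  (transversal to the boundary), the indices \<open>Some i\<close> are the tangential ones. The boundary itself
  has charts with values in \<open>real^'b\<close>.\<close>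

type_synonym ('m, 'k) chart = "'m set \<times> ('m \<Rightarrow> real^'k)"

abbreviation chart_inv :: "('m, 'k::finite) chart \<Rightarrow> real^'k \<Rightarrow> 'm" where
  "chart_inv c \<equiv> inv_into (fst c) (snd c)"

definition half_space :: "(real^('b::finite option)) set" where
  "half_space = {z. 0 \<le> z $ None}"

definition tangential :: "real^('b::finite option) \<Rightarrow> real^'b" where
  "tangential z = (\<chi> i. z $ Some i)"

definition is_chart :: "('m::topological_space, 'b::finite option) chart \<Rightarrow> bool" where
  "is_chart c \<longleftrightarrow> open (fst c) \<and> openin (top_of_set half_space) (snd c ` fst c) \<and>
     (\<exists>\<psi>. homeomorphism (fst c) (snd c ` fst c) (snd c) \<psi>)"

definition compatible :: "('m, 'k::finite) chart \<Rightarrow> ('m, 'k) chart \<Rightarrow> bool" where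
  "compatible c d \<longleftrightarrow>
     smooth_on (snd c ` (fst c \<inter> fst d)) (snd d \<circ> chart_inv c) \<and>
     smooth_on (snd d ` (fst c \<inter> fst d)) (snd c \<circ> chart_inv d)"

text \<open>A smooth structure is a maximal atlas. In particular every coordinate system that is smoothly
  compatible with the structure is one of the charts on which tensor fields are evaluated.\<close>

definition smooth_structure :: "('m::topological_space, 'b::finite option) chart set \<Rightarrow> bool" where
  "smooth_structure A \<longleftrightarrow>
     (\<forall>c\<in>A. is_chart c) \<and> \<Union> (fst ` A) = UNIV \<and> (\<forall>c\<in>A. \<forall>d\<in>A. compatible c d) \<and>
     (\<forall>c. is_chart c \<and> (\<forall>d\<in>A. compatible c d) \<longrightarrow> c \<in> A)"

definition bdry :: "('m, 'b::finite option) chart set \<Rightarrow> 'm set" where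
  "bdry A = {p. \<exists>c\<in>A. p \<in> fst c \<and> snd c p $ None = 0}"

abbreviation bulk :: "('m, 'b::finite option) chart set \<Rightarrow> 'm set" where
  "bulk A \<equiv> - bdry A"

text \<open>The manifold with boundary is the whole type \<open>'m\<close>; its interior is required to be connected.
  Second countability is implied by compactness.\<close>

definition compact_manifold_with_boundary ::
    "('m::t2_space, 'b::finite option) chart set \<Rightarrow> bool" where
  "compact_manifold_with_boundary A \<longleftrightarrow>
     compact (UNIV :: 'm set) \<and> smooth_structure A \<and> connected (bulk A)"

definition bdry_chart :: "('m, 'b::finite option) chart set \<Rightarrow> ('m, 'b option) chart \<Rightarrow> ('m, 'b) chart" where
  "bdry_chart A c = (fst c \<inter> bdry A, tangential \<circ> snd c)"

definition bdry_atlas :: "('m, 'b::finite option) chart set \<Rightarrow> ('m, 'b) chart set" where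
  "bdry_atlas A = bdry_chart A ` A"

definition smooth_fun :: "('m, 'k::finite) chart set \<Rightarrow> 'm set \<Rightarrow> ('m \<Rightarrow> real) \<Rightarrow> bool" where
  "smooth_fun A S f \<longleftrightarrow> (\<forall>c\<in>A. smooth_on (snd c ` (fst c \<inter> S)) (f \<circ> chart_inv c))"


section \<open>Symmetric tensors and Riemannian metrics\<close>

text \<open>A covariant 2-tensor field assigns to each chart and each point of its domain the matrix of
  components with respect to the coordinate frame, subject to the tensorial transformation law.
  Values at points outside the chart domain are irrelevant.\<close>

type_synonym ('m, 'k) tensor2 = "('m, 'k) chart \<Rightarrow> 'm \<Rightarrow> real^'k^'k"

definition transition_jacobian ::
    "('m, 'k::finite) chart \<Rightarrow> ('m, 'k) chart \<Rightarrow> 'm \<Rightarrow> real^'k^'k" where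
  "transition_jacobian c d p =
     jacobian (snd c \<circ> chart_inv d) (at (snd d p) within snd d ` (fst c \<inter> fst d))"

definition smooth_sym_tensor ::
    "('m, 'k::finite) chart set \<Rightarrow> 'm set \<Rightarrow> ('m, 'k) tensor2 \<Rightarrow> bool" where
  "smooth_sym_tensor A S T \<longleftrightarrow>
     (\<forall>c\<in>A. \<forall>d\<in>A. \<forall>p\<in>fst c \<inter> fst d \<inter> S.
        T d p = transpose (transition_jacobian c d p) ** T c p ** transition_jacobian c d p) \<and>
     (\<forall>c\<in>A. \<forall>p\<in>fst c \<inter> S. transpose (T c p) = T c p) \<and>
     (\<forall>c\<in>A. smooth_on (snd c ` (fst c \<inter> S)) (\<lambda>z. T c (chart_inv c z)))"

definition riemannian_metric ::
    "('m, 'k::finite) chart set \<Rightarrow> 'm set \<Rightarrow> ('m, 'k) tensor2 \<Rightarrow> bool" where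
  "riemannian_metric A S g \<longleftrightarrow> smooth_sym_tensor A S g \<and>
     (\<forall>c\<in>A. \<forall>p\<in>fst c \<inter> S. \<forall>v. v \<noteq> 0 \<longrightarrow> v \<bullet> (g c p *v v) > 0)"


section \<open>Ricci curvature in coordinates\<close>

definition christoffel :: "(real^'k \<Rightarrow> real^'k^'k) \<Rightarrow> 'k::finite \<Rightarrow> 'k \<Rightarrow> 'k \<Rightarrow> real^'k \<Rightarrow> real" where
  "christoffel G k i j z = (1/2) * (\<Sum>l\<in>UNIV. matrix_inv (G z) $ k $ l *
     (partial i (\<lambda>w. G w $ j $ l) z + partial j (\<lambda>w. G w $ i $ l) z - partial l (\<lambda>w. G w $ i $ j) z))"

definition ricci :: "(real^'k \<Rightarrow> real^'k^'k) \<Rightarrow> real^'k \<Rightarrow> real^'k^'k::finite" where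
  "ricci G z = (\<chi> i j.
     (\<Sum>k\<in>UNIV. partial k (christoffel G k i j) z - partial j (christoffel G k i k) z) +
     (\<Sum>k\<in>UNIV. \<Sum>l\<in>UNIV. christoffel G k k l z * christoffel G l i j z
                        - christoffel G k j l z * christoffel G l i k z))"

text \<open>\<open>E(g) = Rc(g) + (n - 1) g\<close>, first for a metric given in coordinates.\<close>

definition einstein_defect_coord :: "(real^'k \<Rightarrow> real^'k^'k) \<Rightarrow> real^'k \<Rightarrow> real^'k^'k::finite" where
  "einstein_defect_coord G z = ricci G z + (real CARD('k) - 1) *\<^sub>R G z"

definition einstein_defect :: "('m, 'k::finite) tensor2 \<Rightarrow> ('m, 'k) tensor2" where
  "einstein_defect g c p = einstein_defect_coord (\<lambda>z. g c (chart_inv c z)) (snd c p)"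

text \<open>Pointwise norm of a covariant 2-tensor with components \<open>T\<close> with respect to the inner product
  with components \<open>G\<close>.\<close>

definition tensor_norm :: "real^'k^'k \<Rightarrow> real^'k^'k \<Rightarrow> real" where
  "tensor_norm G T = sqrt (\<Sum>i\<in>UNIV. \<Sum>j\<in>UNIV. \<Sum>k\<in>UNIV. \<Sum>l\<in>UNIV.
     matrix_inv G $ i $ k * matrix_inv G $ j $ l * T $ i $ j * T $ k $ l)"


section \<open>Conformally compact, asymptotically hyperbolic and APE metrics\<close>

definition differential :: "('m \<Rightarrow> real) \<Rightarrow> ('m, 'k::finite) chart \<Rightarrow> 'm \<Rightarrow> real^'k" where
  "differential f c p =
     (\<chi> i. frechet_derivative (f \<circ> chart_inv c) (at (snd c p) within snd c ` fst c) (axis i 1))"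

definition boundary_defining :: "('m, 'b::finite option) chart set \<Rightarrow> ('m \<Rightarrow> real) \<Rightarrow> bool" where
  "boundary_defining A x \<longleftrightarrow> smooth_fun A UNIV x \<and>
     (\<forall>p\<in>bulk A. 0 < x p) \<and> (\<forall>p\<in>bdry A. x p = 0) \<and>
     (\<forall>c\<in>A. \<forall>p\<in>fst c \<inter> bdry A. differential x c p \<noteq> 0)"

text \<open>\<open>gbar\<close> is a smooth metric on the whole compact manifold that extends \<open>x\<^sup>2 g\<close>.\<close>

definition compactification ::
    "('m, 'b::finite option) chart set \<Rightarrow> ('m, 'b option) tensor2 \<Rightarrow> ('m \<Rightarrow> real)
      \<Rightarrow> ('m, 'b option) tensor2 \<Rightarrow> bool" where
  "compactification A g x gbar \<longleftrightarrow>
     boundary_defining A x \<and> riemannian_metric A UNIV gbar \<and>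
     (\<forall>c\<in>A. \<forall>p\<in>fst c \<inter> bulk A. gbar c p = (x p)\<^sup>2 *\<^sub>R g c p)"

text \<open>The conformal class of \<open>gbar\<close> restricted to the tangent bundle of the boundary, as the set of
  its representatives.\<close>

definition tangential_block :: "real^('b::finite option)^('b option) \<Rightarrow> real^'b^'b" where
  "tangential_block B = (\<chi> i j. B $ Some i $ Some j)"

definition conformal_infinity ::
    "('m, 'b::finite option) chart set \<Rightarrow> ('m, 'b option) tensor2 \<Rightarrow> ('m, 'b) tensor2 set" where
  "conformal_infinity A g = {h. riemannian_metric (bdry_atlas A) (bdry A) h \<and>
     (\<exists>x gbar u. compactification A g x gbar \<and>
        smooth_fun (bdry_atlas A) (bdry A) u \<and> (\<forall>p\<in>bdry A. 0 < u p) \<and>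
        (\<forall>c\<in>A. \<forall>p\<in>fst c \<inter> bdry A. h (bdry_chart A c) p = u p *\<^sub>R tangential_block (gbar c p)))}"

definition asymptotically_hyperbolic ::
    "('m, 'b::finite option) chart set \<Rightarrow> ('m, 'b option) tensor2 \<Rightarrow> bool" where
  "asymptotically_hyperbolic A g \<longleftrightarrow> riemannian_metric A (bulk A) g \<and>
     (\<exists>x gbar. compactification A g x gbar \<and>
        (\<forall>c\<in>A. \<forall>p\<in>fst c \<inter> bdry A.
           differential x c p \<bullet> (matrix_inv (gbar c p) *v differential x c p) = 1))"

text \<open>\<open>|E(g)|\<^sub>g = O(x\<^sup>n)\<close> locally uniformly at each boundary point, hence uniformly by compactness;
  the condition does not depend on the boundary defining function.\<close>

definition APE ::
    "('m::topological_space, 'b::finite option) chart set \<Rightarrow> ('m, 'b option) tensor2 \<Rightarrow> bool" where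
  "APE A g \<longleftrightarrow> asymptotically_hyperbolic A g \<and>
     (\<exists>x. boundary_defining A x \<and>
        (\<forall>c\<in>A. \<forall>q\<in>fst c \<inter> bdry A.
           (\<lambda>p. tensor_norm (g c p) (einstein_defect g c p))
             \<in> O[at q within bulk A](\<lambda>p. x p ^ CARD('b option))))"


section \<open>The ambient obstruction tensor\<close>

text \<open>Matrix of \<open>s\<^sup>-\<^sup>2 (dx\<^sup>2 + B)\<close> in coordinates adapted to a collar of the boundary.\<close>

definition collar_matrix :: "real \<Rightarrow> real^'b^'b \<Rightarrow> real^('b::finite option)^('b option)" where
  "collar_matrix s B = (1 / s\<^sup>2) *\<^sub>R (\<chi> i j.
     case i of
       None \<Rightarrow> (case j of None \<Rightarrow> 1 | Some _ \<Rightarrow> 0)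
     | Some i' \<Rightarrow> (case j of None \<Rightarrow> 0 | Some j' \<Rightarrow> B $ i' $ j'))"

text \<open>With \<open>n = CARD('b option)\<close> odd, the components, over a boundary chart \<open>c\<close>, of
  \<open>x\<^sup>-\<^sup>2 (dx\<^sup>2 + \<gamma>\<^sub>0 + x\<^sup>2 \<gamma>\<^sub>2 + \<dots> + x\<^bsup>n-3\<^esup> \<gamma>\<^bsub>n-3\<^esub> + x\<^bsup>n-1\<^esup> (\<gamma>\<^bsub>n-1\<^esub> + T log x))\<close>
  at \<open>z = (x, y)\<close>.\<close>

definition formal_metric ::
    "(nat \<Rightarrow> ('m, 'b) tensor2) \<Rightarrow> ('m, 'b) tensor2 \<Rightarrow> ('m, 'b::finite) chart
      \<Rightarrow> real^('b option) \<Rightarrow> real^('b option)^('b option)" where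
  "formal_metric \<gamma> T c z =
     (let n = CARD('b option); s = z $ None; p = chart_inv c (tangential z) in
      collar_matrix s ((\<Sum>k | even k \<and> k \<le> n - 1. s ^ k *\<^sub>R \<gamma> k c p) + (s ^ (n - 1) * ln s) *\<^sub>R T c p))"

text \<open>\<open>T\<close> is the log coefficient, uniquely determined by \<open>h\<close>, of a formal solution with leading term
  \<open>h\<close>. The remainder estimate for all coordinate components is locally uniform in the boundary
  variables.\<close>

definition is_obstruction_tensor ::
    "('m, 'b::finite option) chart set \<Rightarrow> ('m, 'b) tensor2 \<Rightarrow> ('m, 'b) tensor2 \<Rightarrow> bool" where
  "is_obstruction_tensor A h T \<longleftrightarrow>
     smooth_sym_tensor (bdry_atlas A) (bdry A) T \<and>
     (\<forall>c\<in>bdry_atlas A. \<forall>p\<in>fst c. trace (matrix_inv (h c p) ** T c p) = 0) \<and>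
     (\<exists>\<gamma>. (\<forall>k. smooth_sym_tensor (bdry_atlas A) (bdry A) (\<gamma> k)) \<and>
        (\<forall>c\<in>bdry_atlas A. \<forall>p\<in>fst c. \<gamma> 0 c p = h c p) \<and>
        (\<forall>c\<in>bdry_atlas A. \<forall>z0. z0 $ None = 0 \<and> tangential z0 \<in> snd c ` fst c \<longrightarrow>
           (\<forall>i j. (\<lambda>z. einstein_defect_coord (formal_metric \<gamma> T c) z $ i $ j)
                    \<in> o[at z0 within {z. 0 < z $ None}](\<lambda>z. (z $ None) ^ (CARD('b option) - 3)))))"

definition unobstructed ::
    "('m, 'b::finite option) chart set \<Rightarrow> ('m, 'b option) tensor2 \<Rightarrow> bool" where
  "unobstructed A g \<longleftrightarrow> (\<forall>h\<in>conformal_infinity A g. is_obstruction_tensor A h (\<lambda>c p. 0))"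


section \<open>Normalized Ricci flow\<close>

text \<open>A smooth family of metrics on the interior, with a one-sided time derivative at \<open>t = 0\<close>.\<close>

definition normalized_ricci_flow ::
    "('m, 'b::finite option) chart set \<Rightarrow> real \<Rightarrow> (real \<Rightarrow> ('m, 'b option) tensor2) \<Rightarrow> bool" where
  "normalized_ricci_flow A T0 g \<longleftrightarrow>
     (\<forall>t\<in>{0..<T0}. riemannian_metric A (bulk A) (g t)) \<and>
     (\<forall>c\<in>A. smooth_on ({0..<T0} \<times> snd c ` (fst c \<inter> bulk A)) (\<lambda>(t, z). g t c (chart_inv c z))) \<and>
     (\<forall>c\<in>A. \<forall>p\<in>fst c \<inter> bulk A. \<forall>t\<in>{0..<T0}.
        ((\<lambda>s. g s c p) has_vector_derivative (- 2) *\<^sub>R einstein_defect (g t) c p)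
          (at t within {0..<T0}))"


section \<open>Normal form and conformal anomaly\<close>

text \<open>A collar \<open>{x < \<epsilon>} \<cong> [0, \<epsilon>) \<times> \<partial>M\<close> is given by \<open>p \<mapsto> (x p, \<pi> p)\<close>. A boundary chart induces the
  following coordinate system on it.\<close>

definition collar_chart ::
    "('m \<Rightarrow> real) \<Rightarrow> real \<Rightarrow> ('m \<Rightarrow> 'm) \<Rightarrow> ('m, 'b) chart \<Rightarrow> ('m, 'b::finite option) chart" where
  "collar_chart x \<epsilon> \<pi> c =
     ({p. x p < \<epsilon> \<and> \<pi> p \<in> fst c}, \<lambda>p. \<chi> k. case k of None \<Rightarrow> x p | Some i \<Rightarrow> snd c (\<pi> p) $ i)"

text \<open>Membership of the induced coordinate systems in the maximal atlas, together with bijectivity,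
  says that the collar map is a diffeomorphism.\<close>

definition collar ::
    "('m, 'b::finite option) chart set \<Rightarrow> ('m \<Rightarrow> real) \<Rightarrow> real \<Rightarrow> ('m \<Rightarrow> 'm) \<Rightarrow> bool" where
  "collar A x \<epsilon> \<pi> \<longleftrightarrow> 0 < \<epsilon> \<and>
     bij_betw (\<lambda>p. (x p, \<pi> p)) {p. x p < \<epsilon>} ({0..<\<epsilon>} \<times> bdry A) \<and>
     (\<forall>q\<in>bdry A. \<pi> q = q) \<and>
     (\<forall>c\<in>bdry_atlas A. collar_chart x \<epsilon> \<pi> c \<in> A)"

text \<open>\<open>g = x\<^sup>-\<^sup>2 (dx\<^sup>2 + ghat\<^sub>x)\<close> on the collar, for a smooth family of boundary metrics \<open>ghat\<close> with
  \<open>ghat\<^sub>0 = h\<close>.\<close>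

definition normal_form ::
    "('m, 'b::finite option) chart set \<Rightarrow> ('m, 'b option) tensor2 \<Rightarrow> ('m, 'b) tensor2
      \<Rightarrow> ('m \<Rightarrow> real) \<Rightarrow> real \<Rightarrow> ('m \<Rightarrow> 'm) \<Rightarrow> (real \<Rightarrow> ('m, 'b) tensor2) \<Rightarrow> bool" where
  "normal_form A g h x \<epsilon> \<pi> ghat \<longleftrightarrow> collar A x \<epsilon> \<pi> \<and>
     (\<forall>s\<in>{0..<\<epsilon>}. riemannian_metric (bdry_atlas A) (bdry A) (ghat s)) \<and>
     (\<forall>c\<in>bdry_atlas A. smooth_on ({0..<\<epsilon>} \<times> snd c ` fst c) (\<lambda>(s, y). ghat s c (chart_inv c y))) \<and>
     (\<forall>c\<in>bdry_atlas A. \<forall>q\<in>fst c. ghat 0 c q = h c q) \<and>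
     (\<forall>c\<in>bdry_atlas A. \<forall>p\<in>fst (collar_chart x \<epsilon> \<pi> c) \<inter> bulk A.
        g (collar_chart x \<epsilon> \<pi> c) p = collar_matrix (x p) (ghat (x p) c (\<pi> p)))"

definition special_boundary_defining ::
    "('m, 'b::finite option) chart set \<Rightarrow> ('m, 'b option) tensor2 \<Rightarrow> ('m, 'b) tensor2
      \<Rightarrow> ('m \<Rightarrow> real) \<Rightarrow> bool" where
  "special_boundary_defining A g h x \<longleftrightarrow>
     boundary_defining A x \<and> (\<exists>\<epsilon> \<pi> ghat. normal_form A g h x \<epsilon> \<pi> ghat)"

text \<open>\<open>(det ghat\<^sub>x / det h)\<^bsup>1/2\<^esup> = v\<^sub>0 + v\<^sub>1 x + \<dots> + v\<^bsub>n-1\<^esub> x\<^bsup>n-1\<^esup> + o(x\<^bsup>n-1\<^esup>)\<close>. That \<open>v\<^sub>0 = 1\<close> and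
  that the odd coefficients vanish for APE metrics need not be built in.\<close>

definition volume_expansion ::
    "('m, 'b::finite option) chart set \<Rightarrow> ('m, 'b) tensor2 \<Rightarrow> (real \<Rightarrow> ('m, 'b) tensor2)
      \<Rightarrow> (nat \<Rightarrow> 'm \<Rightarrow> real) \<Rightarrow> bool" where
  "volume_expansion A h ghat v \<longleftrightarrow> (\<forall>c\<in>bdry_atlas A. \<forall>q\<in>fst c.
     (\<lambda>s. sqrt (det (ghat s c q) / det (h c q)) - (\<Sum>j\<le>CARD('b option) - 1. v j q * s ^ j))
       \<in> o[at_right 0](\<lambda>s. s ^ (CARD('b option) - 1)))"

text \<open>The volume measure of the boundary metric \<open>h\<close>: the Borel measure with density
  \<open>(det h)\<^bsup>1/2\<^esup>\<close> with respect to Lebesgue measure in each chart.\<close>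

definition bdry_volume ::
    "('m::topological_space, 'b::finite option) chart set \<Rightarrow> ('m, 'b) tensor2 \<Rightarrow> 'm measure" where
  "bdry_volume A h = (THE \<mu>. sets \<mu> = sets (restrict_space borel (bdry A)) \<and>
     (\<forall>c\<in>bdry_atlas A. \<forall>B\<in>sets \<mu>. B \<subseteq> fst c \<longrightarrow>
        emeasure \<mu> B =
          (\<integral>\<^sup>+y. ennreal (sqrt (det (h c (chart_inv c y)))) * indicator (snd c ` B) y \<partial>lborel)))"

text \<open>The integral of \<open>v\<^bsub>n-1\<^esub>\<close> over the boundary, for the special boundary defining function \<open>x\<close> of
  \<open>g\<close> associated to the representative \<open>h\<close>.\<close>

definition has_conformal_anomaly ::
    "('m::topological_space, 'b::finite option) chart set \<Rightarrow> ('m, 'b option) tensor2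
      \<Rightarrow> ('m, 'b) tensor2 \<Rightarrow> ('m \<Rightarrow> real) \<Rightarrow> real \<Rightarrow> bool" where
  "has_conformal_anomaly A g h x a \<longleftrightarrow> (\<exists>\<epsilon> \<pi> ghat v.
     normal_form A g h x \<epsilon> \<pi> ghat \<and> volume_expansion A h ghat v \<and>
     a = (\<integral>q. v (CARD('b option) - 1) q \<partial>bdry_volume A h))"

definition conformal_anomaly ::
    "('m::topological_space, 'b::finite option) chart set \<Rightarrow> ('m, 'b option) tensor2
      \<Rightarrow> ('m, 'b) tensor2 \<Rightarrow> ('m \<Rightarrow> real) \<Rightarrow> real" where
  "conformal_anomaly A g h x = (THE a. has_conformal_anomaly A g h x a)"

end

theory Submission
  imports Defs
begin

text \<open>The coefficient \<open>v\<^bsub>n-1\<^esub>\<close> is determined pointwise by the representative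
  \<open>h\<close> of the conformal infinity among all APE metrics. Write two such metrics in normal form with
  boundary families \<open>F\<close> and \<open>H\<close>, \<open>F = H = h\<close> at \<open>s = 0\<close>, put \<open>d = n - 1\<close>, and suppose
  \<open>F - H = s\<^sup>k A + o(s\<^sup>k)\<close> with \<open>1 \<le> k \<le> d\<close>. The tangential components of \<open>E\<close> differ by
  \<open>(k/2) ((d - k) A + tr\<^sub>h(A) h) s\<^bsup>k-2\<^esup> + o(s\<^bsup>k-2\<^esup>)\<close>, while the APE condition makes each of them
  \<open>O(s\<^bsup>d-1\<^esup>)\<close>. The trace gives \<open>tr\<^sub>h(A) = 0\<close>, and then \<open>A = 0\<close> if \<open>k < d\<close>. By induction
  \<open>F - H = s\<^sup>d A + o(s\<^sup>d)\<close> with \<open>tr\<^sub>h(A) = 0\<close>, so the volume densities agree up to \<open>o(s\<^sup>d)\<close>.\<close>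

section \<open>Partial derivatives and smooth functions\<close>

text \<open>The two metrics have different collars, and these are never related to each other. Since
  the coefficient is a function on the boundary, each metric is read in its own collar chart over
  the same boundary chart; this gives two matrix functions of the same variables, height and
  boundary point. Smoothness at height 0 is one-sided whereas \<open>frechet_derivative\<close> is
  two-sided, so each family is replaced by a local smooth extension across the boundary: Taylor
  coefficients are taken at height 0, curvature is computed at positive height. The defects differ
  from order \<open>s^(k-2)\<close> on, hence \<open>s^2 E\<close> is expanded. Because n = d + 1,
  the APE condition makes \<open>s^2 E\<close> of order \<open>s^(d+1)\<close>, just beyond every
  order k \<le> d. At k = d the factor d - k vanishes, so the trace-free part of A stays free there;
  the trace carries the factor (d - k) + d = 2 d - k, which is positive for all k \<le> d, and to
  first order a determinant sees only the trace.\<close>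

definition dir_deriv :: "'a::real_normed_vector \<Rightarrow> ('a \<Rightarrow> real) \<Rightarrow> 'a \<Rightarrow> real" where
  "dir_deriv v f z = frechet_derivative f (at z) v"

lemma partial_eq_dir_deriv: "partial i f = dir_deriv (axis i 1) f"
  by (simp add: fun_eq_iff partial_def dir_deriv_def)

text \<open>\<open>frechet_derivative\<close> is a choice among all derivatives \<open>D\<close>.
  Locally equal functions have the same ones, so the choices agree even where neither function is
  differentiable.\<close>

lemma frechet_derivative_cong_open:
  assumes "open U" "z \<in> U" "\<And>w. w \<in> U \<Longrightarrow> f w = g w"
  shows "frechet_derivative f (at z) = frechet_derivative g (at z)"
proof -
  have "(f has_derivative D) (at z) \<longleftrightarrow> (g has_derivative D) (at z)" for D
    using assms has_derivative_transform_within_open[of f D z UNIV U g]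
      has_derivative_transform_within_open[of g D z UNIV U f] by auto
  then show ?thesis
    by (simp add: frechet_derivative_def)
qed

lemma dir_deriv_cong_open:
  assumes "open U" "z \<in> U" "\<And>w. w \<in> U \<Longrightarrow> f w = g w"
  shows "dir_deriv v f z = dir_deriv v g z"
  using frechet_derivative_cong_open[OF assms] by (simp add: dir_deriv_def)

lemma partial_cong_open:
  assumes "open U" "z \<in> U" "\<And>w. w \<in> U \<Longrightarrow> f w = g w"
  shows "partial i f z = partial i g z"
  using dir_deriv_cong_open[OF assms] by (simp add: partial_eq_dir_deriv)

lemma dir_deriv_eqI: "(f has_derivative D) (at z) \<Longrightarrow> dir_deriv v f z = D v"
  by (metis dir_deriv_def frechet_derivative_at)

lemma dir_deriv_line:
  assumes "f differentiable at (z + a *\<^sub>R v)"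
  shows "((\<lambda>a. f (z + a *\<^sub>R v)) has_real_derivative dir_deriv v f (z + a *\<^sub>R v)) (at a)"
proof -
  have lin: "linear (frechet_derivative f (at (z + a *\<^sub>R v)))"
    using assms by (rule linear_frechet_derivative)
  have "(f has_derivative frechet_derivative f (at (z + a *\<^sub>R v))) (at (z + a *\<^sub>R v))"
    using assms by (simp add: frechet_derivative_works)
  then have "((\<lambda>a. f (z + a *\<^sub>R v)) has_derivative
      (\<lambda>x. frechet_derivative f (at (z + a *\<^sub>R v)) (x *\<^sub>R v))) (at a)"
    by (rule has_derivative_compose[rotated]) (auto intro!: derivative_eq_intros)
  then show ?thesis
    unfolding has_field_derivative_def
    by (rule has_derivative_eq_rhs) (simp add: dir_deriv_def linear_scale[OF lin] fun_eq_iff)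
qed

text \<open>The mean value theorem twice: along \<open>u\<close> for the difference of
  \<open>f\<close> over the step \<open>h *\<^sub>R v\<close>, then along \<open>v\<close> for the
  derivative in direction \<open>u\<close>.\<close>

lemma second_difference:
  assumes f: "\<And>w. w \<in> U \<Longrightarrow> f differentiable at w"
    and f': "\<And>w. w \<in> U \<Longrightarrow> dir_deriv u f differentiable at w"
    and h: "0 < h" "\<And>a b. a \<in> {0..h} \<Longrightarrow> b \<in> {0..h} \<Longrightarrow> z + a *\<^sub>R u + b *\<^sub>R v \<in> U"
  obtains a b where "a \<in> {0<..<h}" "b \<in> {0<..<h}"
    "f (z + h *\<^sub>R u + h *\<^sub>R v) - f (z + h *\<^sub>R u) - f (z + h *\<^sub>R v) + f z
      = h\<^sup>2 * dir_deriv v (dir_deriv u f) (z + a *\<^sub>R u + b *\<^sub>R v)"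
proof -
  define p where "p a = f (z + a *\<^sub>R u + h *\<^sub>R v) - f (z + a *\<^sub>R u)" for a
  have "(p has_real_derivative dir_deriv u f (z + a *\<^sub>R u + h *\<^sub>R v) - dir_deriv u f (z + a *\<^sub>R u)) (at a)"
    if "0 \<le> a" "a \<le> h" for a
  proof -
    have eq: "z + a *\<^sub>R u + h *\<^sub>R v = (z + h *\<^sub>R v) + a *\<^sub>R u" for a
      by (simp add: algebra_simps)
    have "f differentiable at (z + a *\<^sub>R u + h *\<^sub>R v)" "f differentiable at (z + a *\<^sub>R u)"
      using h(2)[of a h] h(2)[of a 0] that h(1) by (auto intro!: f)
    then show ?thesis
      unfolding p_def eq by (intro DERIV_diff dir_deriv_line)
  qed
  from MVT2[OF h(1) this] obtain a where a: "0 < a" "a < h" 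
    "p h - p 0 = h * (dir_deriv u f (z + a *\<^sub>R u + h *\<^sub>R v) - dir_deriv u f (z + a *\<^sub>R u))"
    by auto
  have "((\<lambda>b. dir_deriv u f (z + a *\<^sub>R u + b *\<^sub>R v)) has_real_derivative
      dir_deriv v (dir_deriv u f) (z + a *\<^sub>R u + b *\<^sub>R v)) (at b)" if "0 \<le> b" "b \<le> h" for b
    using that a by (intro dir_deriv_line f' h(2)) auto
  from MVT2[OF h(1) this] obtain b where b: "0 < b" "b < h"
    "dir_deriv u f (z + a *\<^sub>R u + h *\<^sub>R v) - dir_deriv u f (z + a *\<^sub>R u)
      = h * dir_deriv v (dir_deriv u f) (z + a *\<^sub>R u + b *\<^sub>R v)"
    by auto
  show thesis
    using a b by (intro that[of a b]) (auto simp: p_def power2_eq_square algebra_simps)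
qed

text \<open>Schwarz's theorem. The second difference is symmetric in \<open>u\<close> and
  \<open>v\<close>, so the two mixed derivatives take equal values at points within
  \<open>h * K\<close> of \<open>z\<close>; continuity passes to the limit.\<close>

lemma dir_deriv_commute:
  assumes U: "open U" "z \<in> U"
    and f: "\<And>w. w \<in> U \<Longrightarrow> f differentiable at w"
    and fu: "\<And>w. w \<in> U \<Longrightarrow> dir_deriv u f differentiable at w"
    and fv: "\<And>w. w \<in> U \<Longrightarrow> dir_deriv v f differentiable at w"
    and cont: "continuous_on U (dir_deriv v (dir_deriv u f))" "continuous_on U (dir_deriv u (dir_deriv v f))"
  shows "dir_deriv v (dir_deriv u f) z = dir_deriv u (dir_deriv v f) z"
proof -
  define A where "A h = (\<lambda>(a, b). z + a *\<^sub>R u + b *\<^sub>R v) ` ({0..h} \<times> {0..h})" for h :: real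
  obtain r where r: "0 < r" "ball z r \<subseteq> U"
    using U by (auto simp: open_contains_ball)
  \<comment> \<open>The summand 1 keeps \<open>K\<close> positive if \<open>u\<close> and
    \<open>v\<close> both vanish and makes the bound \<open>h * K\<close> strict.\<close>
  define K where "K = norm u + norm v + 1"
  have K: "K > 0" "norm u + norm v < K" by (auto simp: K_def add_nonneg_pos)
  have near: "norm (a *\<^sub>R u + b *\<^sub>R v) < h * K" if "a \<in> {0..h}" "b \<in> {0..h}" "h > 0" for a b h :: real
  proof -
    have "norm (a *\<^sub>R u + b *\<^sub>R v) \<le> h * norm u + h * norm v"
      using that by (intro order_trans[OF norm_triangle_ineq] add_mono) (auto intro!: mult_right_mono)
    also have "\<dots> < h * K" using K that by (simp flip: distrib_left)
    finally show ?thesis .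
  qed
  have ev: "\<exists>w w'. dist w z < h * K \<and> dist w' z < h * K \<and> 
      dir_deriv v (dir_deriv u f) w = dir_deriv u (dir_deriv v f) w'" if "0 < h" "h * K < r" for h
  proof -
    have in1: "z + a *\<^sub>R u + b *\<^sub>R v \<in> U" if "a \<in> {0..h}" "b \<in> {0..h}" for a b
    proof -
      have "dist (z + (a *\<^sub>R u + b *\<^sub>R v)) z < r"
        using near[OF that \<open>0 < h\<close>] \<open>h * K < r\<close> by (simp add: dist_norm)
      then show ?thesis
        using r by (auto simp: subset_iff dist_commute add.assoc)
    qed
    have in2: "z + a *\<^sub>R v + b *\<^sub>R u \<in> U" if "a \<in> {0..h}" "b \<in> {0..h}" for a b
      using in1[OF that(2,1)] by (simp add: algebra_simps)
    obtain a b where ab: "a \<in> {0<..<h}" "b \<in> {0<..<h}"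
      "f (z + h *\<^sub>R u + h *\<^sub>R v) - f (z + h *\<^sub>R u) - f (z + h *\<^sub>R v) + f z
      = h\<^sup>2 * dir_deriv v (dir_deriv u f) (z + a *\<^sub>R u + b *\<^sub>R v)"
      using second_difference[OF f fu \<open>0 < h\<close> in1] by blast
    obtain a' b' where ab': "a' \<in> {0<..<h}" "b' \<in> {0<..<h}"
      "f (z + h *\<^sub>R v + h *\<^sub>R u) - f (z + h *\<^sub>R v) - f (z + h *\<^sub>R u) + f z
      = h\<^sup>2 * dir_deriv u (dir_deriv v f) (z + a' *\<^sub>R v + b' *\<^sub>R u)"
      using second_difference[OF f fv \<open>0 < h\<close> in2] by blast
    have eq: "z + h *\<^sub>R v + h *\<^sub>R u = z + h *\<^sub>R u + h *\<^sub>R v" by simp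
    have "h\<^sup>2 * dir_deriv v (dir_deriv u f) (z + a *\<^sub>R u + b *\<^sub>R v)
       = h\<^sup>2 * dir_deriv u (dir_deriv v f) (z + a' *\<^sub>R v + b' *\<^sub>R u)" 
      using ab(3) ab'(3) unfolding eq by linarith
    with \<open>0 < h\<close> have "dir_deriv v (dir_deriv u f) (z + a *\<^sub>R u + b *\<^sub>R v)
       = dir_deriv u (dir_deriv v f) (z + a' *\<^sub>R v + b' *\<^sub>R u)" by simp
    moreover have "dist (z + a *\<^sub>R u + b *\<^sub>R v) z < h * K"
      using near[of a h b] ab \<open>0 < h\<close> by (simp add: dist_norm)
    moreover have "dist (z + a' *\<^sub>R v + b' *\<^sub>R u) z < h * K"
      using near[of b' h a'] ab' \<open>0 < h\<close> by (simp add: dist_norm add.commute)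
    ultimately show ?thesis by blast
  qed
  \<comment> \<open>Here \<open>h n * K = r / (n + 2)\<close>, which is below \<open>r\<close>
    already for \<open>n = 0\<close>.\<close>
  define h where "h n = r / K / (real n + 2)" for n
  have hn: "0 < h n" "h n * K < r" for n
  proof -
    show "0 < h n" using r K by (simp add: h_def)
    have "h n * K = r / (real n + 2)" using K by (simp add: h_def)
    also have "\<dots> < r / 1" using r by (intro divide_strict_left_mono) auto
    finally show "h n * K < r" by simp
  qed
  have h0: "(\<lambda>n. h n * K) \<longlonglongrightarrow> 0"
  proof -
    have "filterlim (\<lambda>n. 2 + real n) at_top sequentially"
      by (rule filterlim_tendsto_add_at_top[OF tendsto_const filterlim_real_sequentially])
    then have "(\<lambda>n. r / (2 + real n)) \<longlonglongrightarrow> 0"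
      by (intro tendsto_divide_0[OF tendsto_const] filterlim_at_top_imp_at_infinity)
    then show ?thesis using K by (simp add: h_def add.commute)
  qed
  have "\<forall>n. \<exists>w w'. dist w z < h n * K \<and> dist w' z < h n * K \<and>
      dir_deriv v (dir_deriv u f) w = dir_deriv u (dir_deriv v f) w'"
    by (intro allI ev hn)
  then obtain w w' where w: "\<And>n. dist (w n) z < h n * K" "\<And>n. dist (w' n) z < h n * K"
    "\<And>n. dir_deriv v (dir_deriv u f) (w n) = dir_deriv u (dir_deriv v f) (w' n)"
    unfolding choice_iff by blast
  have "(\<lambda>n. dist (w n) z) \<longlonglongrightarrow> 0" "(\<lambda>n. dist (w' n) z) \<longlonglongrightarrow> 0"
    by (rule tendsto_sandwich[OF _ _ tendsto_const h0]; simp add: w less_imp_le)+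
  then have lim: "w \<longlonglongrightarrow> z" "w' \<longlonglongrightarrow> z"
    using tendsto_dist_iff by blast+
  have "isCont (dir_deriv v (dir_deriv u f)) z" "isCont (dir_deriv u (dir_deriv v f)) z"
    using cont U by (auto simp: continuous_on_eq_continuous_at)
  then have "(\<lambda>n. dir_deriv v (dir_deriv u f) (w n)) \<longlonglongrightarrow> dir_deriv v (dir_deriv u f) z"
    "(\<lambda>n. dir_deriv u (dir_deriv v f) (w' n)) \<longlonglongrightarrow> dir_deriv u (dir_deriv v f) z"
    using lim isCont_tendsto_compose by blast+
  with w(3) show ?thesis
    using LIMSEQ_unique by auto
qed

section \<open>Stability of smoothness on open sets\<close>

abbreviation Cinf_on :: "'a::real_normed_vector set \<Rightarrow> ('a \<Rightarrow> 'b::real_normed_vector) \<Rightarrow> bool" where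
  "Cinf_on S f \<equiv> \<forall>k. Ck_on k S f"

lemma Ck_on_subset: "Ck_on k T f \<Longrightarrow> S \<subseteq> T \<Longrightarrow> Ck_on k S f"
  by (induction k arbitrary: f) (auto intro: continuous_on_subset)

lemma Ck_on_cong_open:
  assumes "open S" "\<And>z. z \<in> S \<Longrightarrow> f z = g z"
  shows "Ck_on k S f \<longleftrightarrow> Ck_on k S g"
  using assms(2)
proof (induction k arbitrary: f g)
  case 0
  then show ?case by (auto intro: continuous_on_cong)
next
  case (Suc k)
  have "f differentiable at z \<longleftrightarrow> g differentiable at z" if "z \<in> S" for z
    using Suc.prems that assms(1) has_derivative_transform_within_open[of f _ z UNIV S g]
      has_derivative_transform_within_open[of g _ z UNIV S f] unfolding differentiable_def by metis
  moreover have "Ck_on k S (\<lambda>z. frechet_derivative f (at z) v) \<longleftrightarrow> Ck_on k S (\<lambda>z. frechet_derivative g (at z) v)" for v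
    using frechet_derivative_cong_open[OF assms(1) _ Suc.prems] by (intro Suc.IH) simp
  ultimately show ?case by simp
qed

lemma Ck_on_linear_compose:
  assumes L: "bounded_linear L" and "open S" "Ck_on k S f"
  shows "Ck_on k S (\<lambda>z. L (f z))"
  using assms(3)
proof (induction k arbitrary: f)
  case 0
  then show ?case by (auto intro: bounded_linear.continuous_on[OF L])
next
  case (Suc k)
  have D: "((\<lambda>z. L (f z)) has_derivative (\<lambda>v. L (frechet_derivative f (at z) v))) (at z)" if "z \<in> S" for z
    using Suc.prems that by (auto intro!: bounded_linear.has_derivative[OF L] simp: frechet_derivative_works)
  then have "frechet_derivative (\<lambda>z. L (f z)) (at z) = (\<lambda>v. L (frechet_derivative f (at z) v))" if "z \<in> S" for z
    using that frechet_derivative_at by metis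
  then have "Ck_on k S (\<lambda>z. frechet_derivative (\<lambda>z. L (f z)) (at z) v) \<longleftrightarrow>
      Ck_on k S (\<lambda>z. L (frechet_derivative f (at z) v))" for v
    using \<open>open S\<close> by (intro Ck_on_cong_open) auto
  with Suc D show ?case by (auto simp: differentiable_def)
qed

text \<open>Linear inner maps suffice for passing from \<open>z\<close> to the pair of height and
  tangential part. The derivative in direction \<open>v\<close> is then that of \<open>f\<close> in
  the fixed direction \<open>L v\<close>, so the induction on \<open>k\<close> closes without
  product terms.\<close>

lemma Ck_on_compose_linear:
  assumes L: "bounded_linear L" and "open S" "open T" "L ` T \<subseteq> S" "Ck_on k S f"
  shows "Ck_on k T (\<lambda>z. f (L z))"
  using assms(5)
proof (induction k arbitrary: f)
  case 0
  then show ?case using assms by (auto intro!: continuous_on_compose2[of S f] linear_continuous_on[OF L])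
next
  case (Suc k)
  have D: "((\<lambda>z. f (L z)) has_derivative (\<lambda>v. frechet_derivative f (at (L z)) (L v))) (at z)" if "z \<in> T" for z
    using Suc.prems that assms(4)
    by (auto intro!: has_derivative_compose[OF bounded_linear_imp_has_derivative[OF L]] simp: frechet_derivative_works[symmetric])
  then have "frechet_derivative (\<lambda>z. f (L z)) (at z) = (\<lambda>v. frechet_derivative f (at (L z)) (L v))" if "z \<in> T" for z
    using that frechet_derivative_at by metis
  then have "Ck_on k T (\<lambda>z. frechet_derivative (\<lambda>z. f (L z)) (at z) v) \<longleftrightarrow>
      Ck_on k T (\<lambda>z. frechet_derivative f (at (L z)) (L v))" for v
    using \<open>open T\<close> by (intro Ck_on_cong_open) auto
  moreover have "Ck_on k T (\<lambda>z. frechet_derivative f (at (L z)) (L v))" for v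
    using Suc.IH Suc.prems by auto
  ultimately show ?case using D by (auto simp: differentiable_def)
qed

lemma Ck_on_diff:
  assumes "open S" "Ck_on k S f" "Ck_on k S g"
  shows "Ck_on k S (\<lambda>z. f z - g z)"
  using assms(2,3)
proof (induction k arbitrary: f g)
  case 0
  then show ?case by (auto intro: continuous_on_diff)
next
  case (Suc k)
  have D: "((\<lambda>z. f z - g z) has_derivative
      (\<lambda>v. frechet_derivative f (at z) v - frechet_derivative g (at z) v)) (at z)" if "z \<in> S" for z
    using Suc.prems that by (auto intro!: has_derivative_diff simp: frechet_derivative_works)
  then have "frechet_derivative (\<lambda>z. f z - g z) (at z) =
      (\<lambda>v. frechet_derivative f (at z) v - frechet_derivative g (at z) v)" if "z \<in> S" for z
    using that frechet_derivative_at by metis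
  then have "Ck_on k S (\<lambda>z. frechet_derivative (\<lambda>z. f z - g z) (at z) v) \<longleftrightarrow>
      Ck_on k S (\<lambda>z. frechet_derivative f (at z) v - frechet_derivative g (at z) v)" for v
    using \<open>open S\<close> by (intro Ck_on_cong_open) auto
  with Suc D show ?case by (auto simp: differentiable_def)
qed

lemma Cinf_on_partial: "Cinf_on S f \<Longrightarrow> Cinf_on S (partial i f)"
  unfolding partial_def[abs_def] by (metis Ck_on.simps(2))

lemma Cinf_on_differentiable: "Cinf_on S f \<Longrightarrow> z \<in> S \<Longrightarrow> f differentiable at z"
  by (metis Ck_on.simps(2))

lemma Cinf_on_continuous: "Cinf_on S f \<Longrightarrow> continuous_on S f"
  by (metis Ck_on.simps(1))

lemma Cinf_on_partial_funpow: "Cinf_on S f \<Longrightarrow> Cinf_on S ((partial i ^^ j) f)"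
proof (induction j)
  case (Suc j)
  then show ?case
    using Cinf_on_partial[of S "(partial i ^^ j) f" i] by simp
qed simp

lemma partial_commute:
  assumes "open U" "z \<in> U" "Cinf_on U f"
  shows "partial i (partial j f) z = partial j (partial i f) z"
proof -
  have 1: "Cinf_on U (partial i f)" "Cinf_on U (partial j f)"
    using assms(3) by (rule Cinf_on_partial)+
  have 2: "Cinf_on U (partial i (partial j f))" "Cinf_on U (partial j (partial i f))"
    by (rule Cinf_on_partial, rule 1)+
  show ?thesis
    by (rule dir_deriv_commute[OF assms(1,2), of f "axis j 1" "axis i 1", folded partial_eq_dir_deriv])
      (rule Cinf_on_differentiable[OF assms(3)] Cinf_on_differentiable[OF 1(1)]
        Cinf_on_differentiable[OF 1(2)] Cinf_on_continuous[OF 2(1)] Cinf_on_continuous[OF 2(2)]; assumption?)+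
qed

section \<open>Rules for partial derivatives\<close>

lemma partial_diff:
  "f differentiable at z \<Longrightarrow> g differentiable at z \<Longrightarrow>
    partial i (\<lambda>w. f w - g w) z = partial i f z - partial i g z"
  unfolding partial_eq_dir_deriv 
  by (subst dir_deriv_eqI[OF has_derivative_diff[OF frechet_derivative_works[THEN iffD1] frechet_derivative_works[THEN iffD1]]])
     (auto simp: dir_deriv_def)

lemma partial_add:
  "f differentiable at z \<Longrightarrow> g differentiable at z \<Longrightarrow>
    partial i (\<lambda>w. f w + g w) z = partial i f z + partial i g z"
  unfolding partial_eq_dir_deriv 
  by (subst dir_deriv_eqI[OF has_derivative_add[OF frechet_derivative_works[THEN iffD1] frechet_derivative_works[THEN iffD1]]])
     (auto simp: dir_deriv_def)

lemma partial_mult: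
  "f differentiable at z \<Longrightarrow> g differentiable at z \<Longrightarrow>
    partial i (\<lambda>w. f w * g w) z = partial i f z * g z + f z * partial i g z"
  unfolding partial_eq_dir_deriv 
  by (subst dir_deriv_eqI[OF has_derivative_mult[OF frechet_derivative_works[THEN iffD1] frechet_derivative_works[THEN iffD1]]])
     (auto simp: dir_deriv_def)

lemma partial_cmult:
  "f differentiable at z \<Longrightarrow> partial i (\<lambda>w. c * f w) z = c * partial i f z"
  using partial_mult[of "\<lambda>_. c" z f] by (simp add: partial_def)

lemma partial_const [simp]: "partial i (\<lambda>w. c) z = 0"
  by (simp add: partial_def)

lemma partial_sum:
  assumes "\<And>a. a \<in> I \<Longrightarrow> f a differentiable at z"
  shows "partial i (\<lambda>w. \<Sum>a\<in>I. f a w) z = (\<Sum>a\<in>I. partial i (f a) z)"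
  using assms
proof (induction I rule: infinite_finite_induct)
  case (insert x F)
  then show ?case by (simp add: partial_add)
qed simp_all

lemma partial_line:
  assumes "f differentiable at (z + s *\<^sub>R axis i 1)"
  shows "((\<lambda>s. f (z + s *\<^sub>R axis i 1)) has_real_derivative partial i f (z + s *\<^sub>R axis i 1)) (at s)"
  using dir_deriv_line[OF assms] by (simp add: partial_eq_dir_deriv)


section \<open>Matrices\<close>

lemma sum_option:
  "(\<Sum>k\<in>UNIV. f k) = f None + (\<Sum>k\<in>UNIV. f (Some k))" for f :: "'a::finite option \<Rightarrow> 'c::comm_monoid_add"
  by (simp add: UNIV_option_conv sum.reindex)

lemma
  fixes A :: "real^'n^'n"
  assumes "invertible A"
  shows matrix_inv_right: "A ** matrix_inv A = mat 1"
    and matrix_inv_left: "matrix_inv A ** A = mat 1"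
  using someI_ex[OF assms[unfolded invertible_def]] by (simp_all add: matrix_inv_def)

lemma matrix_inv_unique_left:
  fixes A B :: "real^'n^'n"
  assumes "A ** B = mat 1"
  shows "matrix_inv A = B"
proof -
  have "invertible A"
    using assms invertible_right_inverse by blast
  then have "matrix_inv A ** A = mat 1"
    by (rule matrix_inv_left)
  then have "matrix_inv A ** A ** B = B" by simp
  then show ?thesis
    by (simp add: matrix_mul_assoc[symmetric] assms)
qed

text \<open>Cramer's rule. It turns the inverse, which is defined by choice, into a quotient of
  determinants, from which differentiability and limits can be read off.\<close>

lemma matrix_inv_component:
  fixes A :: "real^'n^'n"
  assumes "invertible A"
  shows "matrix_inv A $ k $ l = det (\<chi> i j. if j = k then axis l 1 $ i else A $ i $ j) / det A"
proof -
  have "A *v (matrix_inv A *v axis l 1) = axis l 1"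
    using assms by (simp add: matrix_vector_mul_assoc matrix_inv_right)
  then have "matrix_inv A *v axis l 1 = (\<chi> k. det (\<chi> i j. if j = k then axis l 1 $ i else A $ i $ j) / det A)"
    using assms by (simp add: cramer invertible_det_nz)
  moreover have "(matrix_inv A *v axis l 1) $ k = matrix_inv A $ k $ l"
    by (simp add: matrix_vector_mult_basis column_def)
  ultimately show ?thesis by simp
qed

lemma inverse_right_component:
  "invertible A \<Longrightarrow> (\<Sum>k\<in>UNIV. A $ i $ k * matrix_inv A $ k $ j) = (if i = j then 1 else 0)"
  for A :: "real^'n^'n"
  using matrix_inv_right[of A] by (simp add: vec_eq_iff matrix_matrix_mult_def mat_def)

lemma inverse_left_component:
  "invertible A \<Longrightarrow> (\<Sum>k\<in>UNIV. matrix_inv A $ i $ k * A $ k $ j) = (if i = j then 1 else 0)"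
  for A :: "real^'n^'n"
  using matrix_inv_left[of A] by (simp add: vec_eq_iff matrix_matrix_mult_def mat_def)

lemma symmetric_matrix_inv:
  fixes A :: "real^'n^'n"
  assumes "invertible A" "transpose A = A"
  shows "transpose (matrix_inv A) = matrix_inv A"
proof -
  have "transpose (matrix_inv A ** A) = mat 1"
    using assms by (simp add: matrix_inv_left)
  then have "A ** transpose (matrix_inv A) = mat 1"
    using assms by (simp add: matrix_transpose_mul)
  then show ?thesis
    by (rule matrix_inv_unique_left[symmetric])
qed

lemma differentiable_prod:
  fixes f :: "'i \<Rightarrow> 'a::real_normed_vector \<Rightarrow> real"
  assumes "\<And>i. i \<in> I \<Longrightarrow> f i differentiable at z"
  shows "(\<lambda>w. \<Prod>i\<in>I. f i w) differentiable at z"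
  using assms by (induction I rule: infinite_finite_induct) auto

lemma differentiable_det:
  fixes F :: "'a::real_normed_vector \<Rightarrow> real^'n^'n"
  assumes "\<And>i j. (\<lambda>w. F w $ i $ j) differentiable at z"
  shows "(\<lambda>w. det (F w)) differentiable at z"
  unfolding det_def using assms
  by (intro differentiable_sum differentiable_mult differentiable_prod ballI) auto

lemma differentiable_cong_open:
  assumes "open U" "z \<in> U" "\<And>w. w \<in> U \<Longrightarrow> f w = g w"
  shows "f differentiable at z \<longleftrightarrow> g differentiable at z"
  using assms has_derivative_transform_within_open[of f _ z UNIV U g]
      has_derivative_transform_within_open[of g _ z UNIV U f] unfolding differentiable_def by metis

lemma differentiable_matrix_inv:
  fixes F :: "'a::real_normed_vector \<Rightarrow> real^'n^'n"
  assumes "\<And>i j. (\<lambda>w. F w $ i $ j) differentiable at z"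
    and U: "open U" "z \<in> U" "\<And>w. w \<in> U \<Longrightarrow> invertible (F w)"
  shows "(\<lambda>w. matrix_inv (F w) $ k $ l) differentiable at z"
proof -
  have "(\<lambda>w. (\<chi> i j. if j = k then axis l 1 $ i else F w $ i $ j) $ i $ j) differentiable at z" for i j
    using assms(1) by (cases "j = k") simp_all
  then have "(\<lambda>w. det (\<chi> i j. if j = k then axis l 1 $ i else F w $ i $ j) / det (F w)) differentiable at z"
    using U by (intro differentiable_divide differentiable_det assms(1)) (auto simp: invertible_det_nz)
  then show ?thesis
    by (subst differentiable_cong_open[OF U(1,2)]) (auto simp: matrix_inv_component U)
qed

text \<open>Differentiating \<open>P F = 1\<close> gives \<open>(dP) F = - P dF\<close>;
  multiplication by \<open>P\<close> from the right isolates \<open>dP = - P dF P\<close>.\<close>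

lemma partial_matrix_inv:
  fixes F :: "real^'k \<Rightarrow> real^'n^'n"
  assumes F: "\<And>i j. (\<lambda>w. F w $ i $ j) differentiable at z"
    and U: "open U" "z \<in> U" "\<And>w. w \<in> U \<Longrightarrow> invertible (F w)"
  shows "partial m (\<lambda>w. matrix_inv (F w) $ k $ l) z =
    - (\<Sum>a\<in>UNIV. \<Sum>b\<in>UNIV. matrix_inv (F z) $ k $ a * partial m (\<lambda>w. F w $ a $ b) z * matrix_inv (F z) $ b $ l)"
proof -
  note P = differentiable_matrix_inv[OF F U]
  let ?P = "matrix_inv (F z)"
  have 1: "(\<Sum>a\<in>UNIV. partial m (\<lambda>w. matrix_inv (F w) $ k $ a) z * F z $ a $ b) =
      - (\<Sum>a\<in>UNIV. ?P $ k $ a * partial m (\<lambda>w. F w $ a $ b) z)" for b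
  proof -
    have "partial m (\<lambda>w. \<Sum>a\<in>UNIV. matrix_inv (F w) $ k $ a * F w $ a $ b) z = 
      partial m (\<lambda>w. if k = b then 1 else 0) z"
      by (rule partial_cong_open[OF U(1,2)]) (simp add: inverse_left_component U)
    then show ?thesis
      by (simp add: partial_sum partial_mult F P sum.distrib add_eq_0_iff)
  qed
  have "(\<Sum>b\<in>UNIV. (\<Sum>a\<in>UNIV. partial m (\<lambda>w. matrix_inv (F w) $ k $ a) z * F z $ a $ b) * ?P $ b $ l) = 
      (\<Sum>a\<in>UNIV. partial m (\<lambda>w. matrix_inv (F w) $ k $ a) z * (\<Sum>b\<in>UNIV. F z $ a $ b * ?P $ b $ l))"
    by (simp add: sum_distrib_left sum_distrib_right mult.assoc) (rule sum.swap)
  also have "\<dots> = partial m (\<lambda>w. matrix_inv (F w) $ k $ l) z"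
    using U by (simp add: inverse_right_component if_distrib cong: if_cong)
  finally have "partial m (\<lambda>w. matrix_inv (F w) $ k $ l) z = 
     - (\<Sum>b\<in>UNIV. (\<Sum>a\<in>UNIV. ?P $ k $ a * partial m (\<lambda>w. F w $ a $ b) z) * ?P $ b $ l)"
    unfolding 1 by (simp add: sum_negf)
  also have "(\<Sum>b\<in>UNIV. (\<Sum>a\<in>UNIV. ?P $ k $ a * partial m (\<lambda>w. F w $ a $ b) z) * ?P $ b $ l) =
    (\<Sum>a\<in>UNIV. \<Sum>b\<in>UNIV. ?P $ k $ a * partial m (\<lambda>w. F w $ a $ b) z * ?P $ b $ l)"
    by (simp add: sum_distrib_right) (rule sum.swap)
  finally show ?thesis .
qed

section \<open>Block matrices in collar coordinates\<close>

lemma collar_matrix_component [simp]: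
  "collar_matrix s B $ None $ None = 1 / s\<^sup>2"
  "collar_matrix s B $ None $ Some j = 0"
  "collar_matrix s B $ Some i $ None = 0"
  "collar_matrix s B $ Some i $ Some j = B $ i $ j / s\<^sup>2"
  by (simp_all add: collar_matrix_def)

text \<open>The inverse of \<open>s\<^sup>-\<^sup>2 (1 \<oplus> B)\<close> is \<open>s\<^sup>2 (1 \<oplus> B\<^sup>-\<^sup>1)\<close>, hence the factor \<open>s\<^sup>4\<close>.\<close>

lemma matrix_inv_collar:
  fixes B :: "real^'b^'b"
  assumes "invertible B" "s \<noteq> 0"
  shows "matrix_inv (collar_matrix s B) = s^4 *\<^sub>R collar_matrix s (matrix_inv B)"
proof (rule matrix_inv_unique_left)
  have *: "B $ i $ k / s\<^sup>2 * (s^4 * (c / s\<^sup>2)) = B $ i $ k * c" for i k and c :: real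
    using assms by (simp add: field_simps)
  have **: "1 / s\<^sup>2 * (s^4 * (1 / s\<^sup>2)) = 1"
    using assms by (simp add: field_simps)
  have "(collar_matrix s B ** (s^4 *\<^sub>R collar_matrix s (matrix_inv B))) $ i $ j = (mat 1 :: real^'b option^'b option) $ i $ j" for i j
    using assms
    by (cases i; cases j)
      (simp_all add: matrix_matrix_mult_def mat_def sum_option * ** inverse_right_component del: times_divide_eq_right times_divide_eq_left)
  then show "collar_matrix s B ** (s^4 *\<^sub>R collar_matrix s (matrix_inv B)) = mat 1"
    by (simp add: vec_eq_iff)
qed

lemma matrix_inv_collar_component:
  fixes B :: "real^'b^'b"
  assumes "invertible B" "s \<noteq> 0"
  shows "matrix_inv (collar_matrix s B) $ None $ None = s\<^sup>2"
    "matrix_inv (collar_matrix s B) $ None $ Some j = 0"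
    "matrix_inv (collar_matrix s B) $ Some i $ None = 0"
    "matrix_inv (collar_matrix s B) $ Some i $ Some j = s\<^sup>2 * matrix_inv B $ i $ j"
  using assms by (simp_all add: matrix_inv_collar eval_nat_numeral)


section \<open>The Ricci tensor of a metric in normal form\<close>

text \<open>\<open>F\<close> is a smooth extension of a family of metrics to both signs of the height \<open>z $ None\<close>; at
  negative heights it need not be symmetric or invertible.\<close>

locale collar_metric =
  fixes U :: "(real^('b::finite option)) set" and F :: "real^('b option) \<Rightarrow> real^'b^'b"
  assumes open_U: "open U"
    and smooth: "\<And>a b. Cinf_on U (\<lambda>z. F z $ a $ b)"
    and inv: "\<And>z. z \<in> U \<Longrightarrow> 0 \<le> z $ None \<Longrightarrow> invertible (F z)"
    and sym: "\<And>z a b. z \<in> U \<Longrightarrow> 0 \<le> z $ None \<Longrightarrow> F z $ b $ a = F z $ a $ b"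
begin

text \<open>Identities can be differentiated only on an open set. At positive height
  \<open>F\<close> is symmetric and invertible and the factor \<open>s^-2\<close> is smooth.\<close>

definition "Up = {z \<in> U. 0 < z $ None}"

abbreviation "M \<equiv> \<lambda>z. collar_matrix (z $ None) (F z)"
abbreviation "P \<equiv> \<lambda>z. matrix_inv (F z)"
abbreviation "D \<equiv> \<lambda>i a b. partial i (\<lambda>z. F z $ a $ b)"

text \<open>The Christoffel symbols of the metric on the slice of fixed height: only tangential
  derivatives of \<open>F\<close> enter.\<close>

definition "Gam k i j z = 1/2 * (\<Sum>l\<in>UNIV. P z $ k $ l *
  (D (Some i) j l z + D (Some j) i l z - D (Some l) i j z))"

lemma open_Up: "open Up"
proof -
  have "Up = U \<inter> {z. 0 < z $ None}" by (auto simp: Up_def)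
  moreover have "open {z :: real^'b option. 0 < z $ None}"
    by (intro open_Collect_less continuous_intros)
  ultimately show ?thesis using open_U by auto
qed

lemma Up_D: "z \<in> Up \<Longrightarrow> z \<in> U" "z \<in> Up \<Longrightarrow> 0 < z $ None" "z \<in> Up \<Longrightarrow> z $ None \<noteq> 0"
   "z \<in> Up \<Longrightarrow> invertible (F z)" "z \<in> Up \<Longrightarrow> F z $ b $ a = F z $ a $ b"
  using inv sym by (auto simp: Up_def)

lemma diffble: "z \<in> Up \<Longrightarrow> (\<lambda>w. F w $ a $ b) differentiable at z"
  "z \<in> Up \<Longrightarrow> D i a b differentiable at z"
  by (auto intro: Cinf_on_differentiable[OF smooth Up_D(1)] Cinf_on_differentiable[OF Cinf_on_partial[OF smooth] Up_D(1)])

lemma diffble_P: "z \<in> Up \<Longrightarrow> (\<lambda>w. P w $ a $ b) differentiable at z"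
  by (intro differentiable_matrix_inv[OF _ open_Up]) (auto simp: diffble Up_D)

lemma P_sym: "z \<in> Up \<Longrightarrow> P z $ b $ a = P z $ a $ b"
  using symmetric_matrix_inv[of "F z"] Up_D(4,5)[of z] by (simp add: vec_eq_iff transpose_def)

lemma D_sym: "z \<in> Up \<Longrightarrow> D i b a z = D i a b z"
  by (rule partial_cong_open[OF open_Up _ Up_D(5)])

lemma has_derivative_coordinate: "((\<lambda>w. w $ i) has_derivative (\<lambda>v. v $ i)) (at z)"
  by (intro bounded_linear_imp_has_derivative bounded_linear_vec_nth)

lemma partial_divide_square:
  fixes z :: "real^'k"
  assumes "z $ k \<noteq> 0" "f differentiable at z"
  shows "partial i (\<lambda>w. f w / (w $ k)\<^sup>2) z =
    (if i = k then - 2 * f z / (z $ k)^3 else 0) + partial i f z / (z $ k)\<^sup>2"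
proof -
  have "((\<lambda>w. f w / (w $ k)\<^sup>2) has_derivative
      (\<lambda>v. - 2 * f z / (z $ k)^3 * v $ k + frechet_derivative f (at z) v / (z $ k)\<^sup>2)) (at z)"
    using assms by (auto intro!: derivative_eq_intros has_derivative_coordinate frechet_derivative_works[THEN iffD1]
      simp: field_simps eval_nat_numeral)
  from dir_deriv_eqI[OF this, of "axis i 1"] show ?thesis
    by (simp add: partial_def dir_deriv_def axis_def)
qed

lemma partial_M:
  assumes "z \<in> Up"
  shows "partial i (\<lambda>w. 1 / (w $ None)\<^sup>2) z = (if i = None then - 2 / (z $ None)^3 else 0)"
    "partial i (\<lambda>w. F w $ a $ b / (w $ None)\<^sup>2) z = 
     (if i = None then - 2 * F z $ a $ b / (z $ None)^3 else 0) + D i a b z / (z $ None)\<^sup>2"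
  using partial_divide_square[of z None "\<lambda>_. 1"] partial_divide_square[of z None "\<lambda>w. F w $ a $ b"] assms
  by (simp_all add: Up_D diffble)

text \<open>The factor \<open>s^-2\<close> is constant on slices, so it cancels against the
  \<open>s^2\<close> of the inverse in the purely tangential symbols. Elsewhere its height
  derivative \<open>-2 s^-3\<close> produces the poles \<open>1 / s\<close>.\<close>

lemma christoffel_M:
  assumes "z \<in> Up"
  shows "christoffel M None None None z = - 1 / z $ None"
    "christoffel M None None (Some i) z = 0"
    "christoffel M None (Some i) None z = 0"
    "christoffel M None (Some i) (Some j) z = 1 / z $ None * F z $ i $ j - 1/2 * D None i j z"
    "christoffel M (Some k) None (Some i) z = (if k = i then - 1 / z $ None else 0) + 1/2 * (\<Sum>l\<in>UNIV. P z $ k $ l * D None i l z)"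
    "christoffel M (Some k) (Some i) None z = (if k = i then - 1 / z $ None else 0) + 1/2 * (\<Sum>l\<in>UNIV. P z $ k $ l * D None i l z)"
    "christoffel M (Some k) (Some i) (Some j) z = Gam k i j z"
proof -
  note z = Up_D[OF assms]
  note inv = matrix_inv_collar_component[OF z(4,3)]
  note [simp] = partial_M[OF assms] inv
  show "christoffel M None None None z = - 1 / z $ None"
    using z(3) by (simp add: christoffel_def sum_option, (simp add: field_simps eval_nat_numeral)?)
  show "christoffel M None None (Some i) z = 0" "christoffel M None (Some i) None z = 0"
    by (simp_all add: christoffel_def sum_option)
  show "christoffel M None (Some i) (Some j) z = 1 / z $ None * F z $ i $ j - 1/2 * D None i j z"
    using z(3) by (simp add: christoffel_def sum_option, (simp add: field_simps eval_nat_numeral)?)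
  \<comment> \<open>Contracting \<open>F\<close> with its inverse turns the derivative of the factor
    \<open>s^-2\<close> into the diagonal term \<open>- 1 / s\<close>.\<close>
  have *: "(\<Sum>l\<in>UNIV. (z $ None)\<^sup>2 * P z $ k $ l * (- 2 * F z $ i $ l / (z $ None)^3 + D None i l z / (z $ None)\<^sup>2)) / 2
    = (if k = i then - 1 / z $ None else 0) + 1/2 * (\<Sum>l\<in>UNIV. P z $ k $ l * D None i l z)" for k i
  proof -
    have "(\<Sum>l\<in>UNIV. (z $ None)\<^sup>2 * P z $ k $ l * (- 2 * F z $ i $ l / (z $ None)^3 + D None i l z / (z $ None)\<^sup>2)) =
      (\<Sum>l\<in>UNIV. (- 2 / (z $ None)) * (P z $ k $ l * F z $ l $ i) + P z $ k $ l * D None i l z)"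
      using z(3) by (intro sum.cong) (auto simp: z(5)[of i] field_simps eval_nat_numeral)
    also have "\<dots> = (- 2 / (z $ None)) * (if k = i then 1 else 0) + (\<Sum>l\<in>UNIV. P z $ k $ l * D None i l z)"
      by (simp only: sum.distrib sum_distrib_left[symmetric] inverse_left_component[OF z(4)])
    finally have eq: "(\<Sum>l\<in>UNIV. (z $ None)\<^sup>2 * P z $ k $ l * (- 2 * F z $ i $ l / (z $ None)^3 + D None i l z / (z $ None)\<^sup>2))
      = (- 2 / (z $ None)) * (if k = i then 1 else 0) + (\<Sum>l\<in>UNIV. P z $ k $ l * D None i l z)" .
    show ?thesis unfolding eq by (auto simp: field_simps)
  qed
  show "christoffel M (Some k) None (Some i) z = (if k = i then - 1 / z $ None else 0) + 1/2 * (\<Sum>l\<in>UNIV. P z $ k $ l * D None i l z)"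
    unfolding *[symmetric] by (simp add: christoffel_def sum_option)
  show "christoffel M (Some k) (Some i) None z = (if k = i then - 1 / z $ None else 0) + 1/2 * (\<Sum>l\<in>UNIV. P z $ k $ l * D None i l z)"
    unfolding *[symmetric] by (simp add: christoffel_def sum_option)
  show "christoffel M (Some k) (Some i) (Some j) z = Gam k i j z"
    unfolding Gam_def using z(3)
    by (simp add: christoffel_def sum_option) (intro sum.cong, auto simp: field_simps)
qed

text \<open>The Ricci tensor of the slice metric, with the height as a parameter.\<close>

definition "ric_hat i j z =
   (\<Sum>k\<in>UNIV. partial (Some k) (Gam k i j) z - partial (Some j) (Gam k i k) z) +
   (\<Sum>k\<in>UNIV. \<Sum>l\<in>UNIV. Gam k k l z * Gam l i j z - Gam k j l z * Gam l i k z)"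

text \<open>By Jacobi's formula this is, on \<open>Up\<close>, the logarithmic height derivative of
  \<open>det (F z)\<close>.\<close>

definition "tr_D z = (\<Sum>k\<in>UNIV. \<Sum>l\<in>UNIV. P z $ k $ l * D None k l z)"

lemma partial_christoffel_M:
  assumes "z \<in> Up"
  shows "partial None (christoffel M None (Some i) (Some j)) z = 
      - 1 / (z $ None)\<^sup>2 * F z $ i $ j + 1 / z $ None * D None i j z - 1/2 * partial None (D None i j) z"
    "partial m (christoffel M None (Some i) None) z = 0"
    "partial m (christoffel M (Some k) (Some i) (Some j)) z = partial m (Gam k i j) z"
proof -
  have h: "((\<lambda>w. 1 / w $ None) has_derivative (\<lambda>v. - 1 / (z $ None)\<^sup>2 * v $ None)) (at z)"
    using Up_D[OF assms] by (auto intro!: derivative_eq_intros has_derivative_coordinate simp: field_simps power2_eq_square)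
  then have d: "(\<lambda>w. 1 / w $ None) differentiable at z"
    unfolding differentiable_def by blast
  have 1: "partial None (\<lambda>w. 1 / w $ None) z = - 1 / (z $ None)\<^sup>2"
    using dir_deriv_eqI[OF h, of "axis None 1"] by (simp add: partial_eq_dir_deriv axis_def)
  have "partial None (christoffel M None (Some i) (Some j)) z =
     partial None (\<lambda>z. 1 / z $ None * F z $ i $ j - 1/2 * D None i j z) z"
    by (rule partial_cong_open[OF open_Up assms]) (rule christoffel_M)
  also have "\<dots> = - 1 / (z $ None)\<^sup>2 * F z $ i $ j + 1 / z $ None * D None i j z - 1/2 * partial None (D None i j) z"
    using diffble[OF assms] d
    by (simp only: partial_diff partial_mult partial_const differentiable_mult differentiable_const 1)
  finally show "partial None (christoffel M None (Some i) (Some j)) z = 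
      - 1 / (z $ None)\<^sup>2 * F z $ i $ j + 1 / z $ None * D None i j z - 1/2 * partial None (D None i j) z" .
  have "partial m (christoffel M None (Some i) None) z = partial m (\<lambda>_. 0) z"
    by (rule partial_cong_open[OF open_Up assms]) (rule christoffel_M)
  then show "partial m (christoffel M None (Some i) None) z = 0" by simp
  show "partial m (christoffel M (Some k) (Some i) (Some j)) z = partial m (Gam k i j) z"
    by (rule partial_cong_open[OF open_Up assms]) (rule christoffel_M)
qed

text \<open>The tangential Ricci components contain the double pole
  \<open>- CARD('b) / s^2 * F\<close>. Since \<open>CARD('b option) - 1 = CARD('b)\<close>, the
  multiple of the metric in the defect cancels it exactly, and only simple poles remain, each with a
  height derivative of \<open>F\<close> as a factor.\<close>

lemma einstein_defect_M:
  assumes "z \<in> Up"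
  shows "einstein_defect_coord M z $ Some i $ Some j =
    ric_hat i j z - 1/2 * partial None (D None i j) z + (real CARD('b) - 1) / (2 * z $ None) * D None i j z
     + tr_D z / (2 * z $ None) * F z $ i $ j - tr_D z / 4 * D None i j z
     + 1/2 * (\<Sum>l\<in>UNIV. \<Sum>m\<in>UNIV. D None j l z * P z $ l $ m * D None i m z)"
proof -
  note z = Up_D[OF assms]
  define s where "s = z $ None"
  have s: "s \<noteq> 0" using z by (simp add: s_def)
  \<comment> \<open>\<open>Q\<close> is the endomorphism \<open>F^-1 F'\<close>; the mixed
    Christoffel symbols are \<open>- 1 / s\<close> times the identity plus half of it.\<close>
  define Q where "Q k i = (\<Sum>l\<in>UNIV. P z $ k $ l * D None i l z)" for k i
  define N where "N = (\<Sum>l\<in>UNIV. D None j l z * Q l i)"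
  have tr: "(\<Sum>k\<in>UNIV. Q k k) = tr_D z"
    by (simp add: Q_def tr_D_def)
  have FQ: "(\<Sum>l\<in>UNIV. F z $ j $ l * Q l i) = D None i j z" for i j
  proof -
    have "(\<Sum>l\<in>UNIV. F z $ j $ l * Q l i) = (\<Sum>m\<in>UNIV. (\<Sum>l\<in>UNIV. F z $ j $ l * P z $ l $ m) * D None i m z)"
      unfolding Q_def sum_distrib_left sum_distrib_right by (subst sum.swap) (simp add: mult.assoc)
    also have "\<dots> = D None i j z"
      by (simp add: inverse_right_component[OF z(4)] if_distrib[of "\<lambda>x. x * _"] cong: if_cong)
    finally show ?thesis .
  qed
  have N_sym: "(\<Sum>l\<in>UNIV. Q l j * D None i l z) = N"
  proof -
    have "(\<Sum>l\<in>UNIV. Q l j * D None i l z) = (\<Sum>m\<in>UNIV. \<Sum>l\<in>UNIV. P z $ l $ m * D None j m z * D None i l z)"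
      unfolding Q_def sum_distrib_right by (subst sum.swap) simp
    also have "\<dots> = (\<Sum>m\<in>UNIV. D None j m z * (\<Sum>l\<in>UNIV. P z $ m $ l * D None i l z))"
      unfolding sum_distrib_left by (intro sum.cong refl) (simp add: P_sym[OF assms])
    finally show ?thesis by (simp add: N_def Q_def)
  qed
  have C: "christoffel M None (Some i) (Some j) z = 1 / s * F z $ i $ j - 1/2 * D None i j z"
    "christoffel M (Some k) None (Some i) z = (if k = i then - 1 / s else 0) + 1/2 * Q k i"
    "christoffel M (Some k) (Some i) None z = (if k = i then - 1 / s else 0) + 1/2 * Q k i"
    "christoffel M None None None z = - 1 / s" for k i j
    by (simp_all only: christoffel_M[OF assms] s_def Q_def)
  \<comment> \<open>The condition \<open>k = k\<close> is what the mixed symbols in \<open>C\<close>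
    yield on the diagonal; it is kept so that the sum matches the expansion of the Ricci tensor
    below.\<close>
  have T1: "(\<Sum>k\<in>UNIV. (if k = k then - 1 / s else 0) + 1/2 * Q k k) = - real CARD('b) / s + tr_D z / 2"
    by (simp add: sum.distrib sum_subtractf tr flip: sum_divide_distrib)
  have T2: "(\<Sum>l\<in>UNIV. (1 / s * F z $ j $ l - 1/2 * D None j l z) * ((if l = i then - 1 / s else 0) + 1/2 * Q l i))
     = - 1 / s^2 * F z $ i $ j + 1 / s * D None i j z - 1/4 * N"
  proof -
    have "(\<Sum>l\<in>UNIV. (1 / s * F z $ j $ l - 1/2 * D None j l z) * ((if l = i then - 1 / s else 0) + 1/2 * Q l i)) = 
      (\<Sum>l\<in>UNIV. (if l = i then - 1 / s * (1 / s * F z $ j $ l - 1/2 * D None j l z) else 0)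
        + 1 / (2 * s) * (F z $ j $ l * Q l i) - 1/4 * (D None j l z * Q l i))"
      using s by (intro sum.cong refl) (auto simp: field_simps)
    also have "\<dots> = - 1 / s * (1 / s * F z $ j $ i - 1/2 * D None j i z) + 1 / (2 * s) * D None i j z - 1/4 * N"
      by (simp only: sum.distrib sum_subtractf sum_distrib_left[symmetric] FQ N_def[symmetric]) simp
    also have "\<dots> = - 1 / s^2 * F z $ i $ j + 1 / s * D None i j z - 1/4 * N"
      using s by (simp add: z(5)[of j i] D_sym[OF assms, of None j i] field_simps power2_eq_square)
    finally show ?thesis .
  qed
  have T3: "(\<Sum>l\<in>UNIV. ((if l = j then - 1 / s else 0) + 1/2 * Q l j) * (1 / s * F z $ i $ l - 1/2 * D None i l z))
     = - 1 / s^2 * F z $ i $ j + 1 / s * D None i j z - 1/4 * N"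
  proof -
    have "(\<Sum>l\<in>UNIV. ((if l = j then - 1 / s else 0) + 1/2 * Q l j) * (1 / s * F z $ i $ l - 1/2 * D None i l z)) = 
      (\<Sum>l\<in>UNIV. (if l = j then - 1 / s * (1 / s * F z $ i $ l - 1/2 * D None i l z) else 0)
        + 1 / (2 * s) * (F z $ i $ l * Q l j) - 1/4 * (Q l j * D None i l z))"
      using s by (intro sum.cong refl) (auto simp: field_simps)
    also have "\<dots> = - 1 / s * (1 / s * F z $ i $ j - 1/2 * D None i j z) + 1 / (2 * s) * D None j i z - 1/4 * N"
      by (simp only: sum.distrib sum_subtractf sum_distrib_left[symmetric] FQ N_sym) simp
    also have "\<dots> = - 1 / s^2 * F z $ i $ j + 1 / s * D None i j z - 1/4 * N"
      using s by (simp add: z(5)[of j i] D_sym[OF assms, of None j i] field_simps power2_eq_square)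
    finally show ?thesis .
  qed
  \<comment> \<open>Splitting both summation indices into \<open>None\<close> and
    \<open>Some\<close> leaves the trace of the mixed symbols times the normal one, the two mixed
    products computed in \<open>T2\<close> and \<open>T3\<close>, and the tangential products that
    belong to \<open>ric_hat\<close>.\<close>
  have "ricci M z $ Some i $ Some j = 
    (partial None (christoffel M None (Some i) (Some j)) z - partial (Some j) (christoffel M None (Some i) None) z
     + (\<Sum>k\<in>UNIV. partial (Some k) (Gam k i j) z - partial (Some j) (Gam k i k) z))
    + ((- 1 / s + (\<Sum>k\<in>UNIV. (if k = k then - 1 / s else 0) + 1/2 * Q k k)) * (1 / s * F z $ i $ j - 1/2 * D None i j z)
       - (\<Sum>l\<in>UNIV. (1 / s * F z $ j $ l - 1/2 * D None j l z) * ((if l = i then - 1 / s else 0) + 1/2 * Q l i))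
       - (\<Sum>l\<in>UNIV. ((if l = j then - 1 / s else 0) + 1/2 * Q l j) * (1 / s * F z $ i $ l - 1/2 * D None i l z))
       + (\<Sum>k\<in>UNIV. \<Sum>l\<in>UNIV. Gam k k l z * Gam l i j z - Gam k j l z * Gam l i k z))"
    by (simp only: ricci_def sum_option vec_lambda_beta C christoffel_M(2,3,7)[OF assms] 
         partial_christoffel_M(3)[OF assms] sum.distrib sum_subtractf sum_distrib_right distrib_right)
      (simp add: sum.distrib sum_subtractf)
  also have "\<dots> = ric_hat i j z - 1/2 * partial None (D None i j) z + (real CARD('b) - 1) / (2 * s) * D None i j z
     + tr_D z / (2 * s) * F z $ i $ j - tr_D z / 4 * D None i j z + 1/2 * N - real CARD('b) / s^2 * F z $ i $ j"
    unfolding T1 T2 T3 partial_christoffel_M(1,2)[OF assms] ric_hat_def s_def[symmetric] using s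
    by (simp add: field_simps power2_eq_square)
  finally show ?thesis
    by (simp add: einstein_defect_coord_def s_def N_def Q_def sum_distrib_left mult.assoc)
qed

text \<open>For tangential \<open>m\<close>, everything is expressed by the inverse and the first
  and second tangential derivatives of \<open>F\<close>, so expansions of these quantities carry
  over to the slice curvature.\<close>

lemma partial_Gam:
  assumes "z \<in> Up"
  shows "partial m (Gam k i j) z = 1/2 * (\<Sum>l\<in>UNIV.
    - (\<Sum>a\<in>UNIV. \<Sum>b\<in>UNIV. P z $ k $ a * D m a b z * P z $ b $ l) * (D (Some i) j l z + D (Some j) i l z - D (Some l) i j z)
    + P z $ k $ l * (partial m (D (Some i) j l) z + partial m (D (Some j) i l) z - partial m (D (Some l) i j) z))"
proof -
  note d = diffble[OF assms] diffble_P[OF assms] 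
  have *: "partial m (\<lambda>w. P w $ k $ l) z = - (\<Sum>a\<in>UNIV. \<Sum>b\<in>UNIV. P z $ k $ a * D m a b z * P z $ b $ l)" for k l
    by (rule partial_matrix_inv[OF _ open_Up assms]) (auto intro: d Up_D)
  show ?thesis
    unfolding Gam_def[abs_def]
    by (subst partial_cmult) (simp_all add: partial_sum partial_mult partial_add partial_diff d *)
qed

end


section \<open>First-order expansions of differences\<close>

text \<open>The pairs \<open>(l, a)\<close> multiply like the dual numbers \<open>l + a \<delta>\<close> with \<open>\<delta>\<^sup>2 = 0\<close>, so the leading
  coefficient of the difference of two polynomial expressions is computed by formal differentiation.\<close>

definition jet :: "nat \<Rightarrow> (real \<Rightarrow> real) \<Rightarrow> (real \<Rightarrow> real) \<Rightarrow> real \<Rightarrow> real \<Rightarrow> bool" where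
  "jet k u v l a \<longleftrightarrow> (u \<longlongrightarrow> l) (at_right 0) \<and> (v \<longlongrightarrow> l) (at_right 0) \<and>
     ((\<lambda>s. (u s - v s) / s ^ k) \<longlongrightarrow> a) (at_right 0)"

lemma jet_same: "(u \<longlongrightarrow> l) (at_right 0) \<Longrightarrow> jet k u u l 0"
  by (simp add: jet_def)

lemma jet_const: "jet k (\<lambda>_. c) (\<lambda>_. c) c 0"
  by (simp add: jet_def)

lemma jet_add:
  assumes "jet k u v l a" "jet k u' v' l' a'"
  shows "jet k (\<lambda>s. u s + u' s) (\<lambda>s. v s + v' s) (l + l') (a + a')"
proof -
  have "((\<lambda>s. (u s - v s) / s ^ k + (u' s - v' s) / s ^ k) \<longlongrightarrow> a + a') (at_right 0)"
    using assms unfolding jet_def by (intro tendsto_add) auto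
  then show ?thesis
    using assms by (auto simp: jet_def intro!: tendsto_add) (simp add: add_divide_distrib diff_divide_distrib algebra_simps)
qed

lemma jet_mult:
  assumes "jet k u v l a" "jet k u' v' l' a'"
  shows "jet k (\<lambda>s. u s * u' s) (\<lambda>s. v s * v' s) (l * l') (a * l' + l * a')"
proof -
  have "((\<lambda>s. (u s - v s) / s ^ k * u' s + v s * ((u' s - v' s) / s ^ k)) \<longlongrightarrow> a * l' + l * a') (at_right 0)"
    using assms unfolding jet_def by (intro tendsto_add tendsto_mult) auto
  moreover have "(u s - v s) / s ^ k * u' s + v s * ((u' s - v' s) / s ^ k) = (u s * u' s - v s * v' s) / s ^ k" for s
    by (simp add: add_divide_distrib[symmetric] algebra_simps)
  ultimately show ?thesis
    using assms by (auto simp: jet_def intro!: tendsto_mult)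
qed

lemma jet_cmult: "jet k u v l a \<Longrightarrow> jet k (\<lambda>s. c * u s) (\<lambda>s. c * v s) (c * l) (c * a)"
  using jet_mult[OF jet_const] by force

lemma jet_diff:
  assumes "jet k u v l a" "jet k u' v' l' a'"
  shows "jet k (\<lambda>s. u s - u' s) (\<lambda>s. v s - v' s) (l - l') (a - a')"
  using jet_add[OF assms(1) jet_cmult[OF assms(2), of "-1"]] by simp

lemma jet_sum:
  assumes "\<And>i. i \<in> I \<Longrightarrow> jet k (u i) (v i) (l i) (a i)"
  shows "jet k (\<lambda>s. \<Sum>i\<in>I. u i s) (\<lambda>s. \<Sum>i\<in>I. v i s) (\<Sum>i\<in>I. l i) (\<Sum>i\<in>I. a i)"
  using assms by (induction I rule: infinite_finite_induct) (auto intro: jet_add jet_const)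

lemma jet_prod:
  assumes "finite I" "\<And>i. i \<in> I \<Longrightarrow> jet k (u i) (v i) (l i) (a i)"
  shows "jet k (\<lambda>s. \<Prod>i\<in>I. u i s) (\<lambda>s. \<Prod>i\<in>I. v i s) (\<Prod>i\<in>I. l i) (\<Sum>i\<in>I. a i * (\<Prod>j\<in>I - {i}. l j))"
  using assms
proof (induction I rule: finite_induct)
  case empty
  then show ?case by (simp add: jet_const)
next
  case (insert x I)
  have "(\<Sum>i\<in>I. a i * (\<Prod>j\<in>insert x I - {i}. l j)) = (\<Sum>i\<in>I. l x * (a i * (\<Prod>j\<in>I - {i}. l j)))"
  proof (intro sum.cong refl)
    fix i assume "i \<in> I"
    then have "insert x I - {i} = insert x (I - {i})" using insert.hyps by auto
    then show "a i * (\<Prod>j\<in>insert x I - {i}. l j) = l x * (a i * (\<Prod>j\<in>I - {i}. l j))"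
      using insert.hyps by simp
  qed
  moreover have "insert x I - {x} = I" using insert.hyps by auto
  ultimately show ?case
    using jet_mult[OF insert.prems[of x] insert.IH] insert by (simp add: sum_distrib_left)
qed

lemma jet_cong:
  assumes "jet k u v l a" "eventually (\<lambda>s. u s = u' s) (at_right 0)" "eventually (\<lambda>s. v s = v' s) (at_right 0)"
  shows "jet k u' v' l a"
proof -
  have *: "eventually (\<lambda>s. (u s - v s) / s ^ k = (u' s - v' s) / s ^ k) (at_right 0)"
    using assms(2,3) by eventually_elim simp
  show ?thesis
    using assms(1) tendsto_cong[OF assms(2)] tendsto_cong[OF assms(3)] tendsto_cong[OF *]
    by (simp add: jet_def)
qed

lemma jet_unique: "jet k u v l a \<Longrightarrow> ((\<lambda>s. (u s - v s) / s ^ k) \<longlongrightarrow> b) (at_right 0) \<Longrightarrow> a = b"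
  unfolding jet_def using tendsto_unique[OF trivial_limit_at_right_real] by blast

section \<open>Limits and expansions of determinants and inverses\<close>

lemma tendsto_det:
  fixes X :: "'a \<Rightarrow> real^'n^'n"
  assumes "\<And>i j. ((\<lambda>s. X s $ i $ j) \<longlongrightarrow> L $ i $ j) G"
  shows "((\<lambda>s. det (X s)) \<longlongrightarrow> det L) G"
  unfolding det_def by (intro tendsto_sum tendsto_mult tendsto_prod tendsto_const assms)

lemma tendsto_matrix_inv:
  fixes X :: "'a \<Rightarrow> real^'n^'n"
  assumes X: "\<And>i j. ((\<lambda>s. X s $ i $ j) \<longlongrightarrow> L $ i $ j) G" and L: "invertible L"
  shows "((\<lambda>s. matrix_inv (X s) $ i $ j) \<longlongrightarrow> matrix_inv L $ i $ j) G"
proof -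
  have d: "((\<lambda>s. det (X s)) \<longlongrightarrow> det L) G" "det L \<noteq> 0"
    using tendsto_det[OF X] L by (auto simp: invertible_det_nz)
  have "((\<lambda>s. (\<chi> a b. if b = i then axis j 1 $ a else X s $ a $ b) $ a $ b) \<longlongrightarrow>
      (\<chi> a b. if b = i then axis j 1 $ a else L $ a $ b) $ a $ b) G" for a b
    using X by (cases "b = i") simp_all
  note lim = this
  have "((\<lambda>s. det (\<chi> a b. if b = i then axis j 1 $ a else X s $ a $ b) / det (X s)) \<longlongrightarrow>
     det (\<chi> a b. if b = i then axis j 1 $ a else L $ a $ b) / det L) G"
    by (intro tendsto_divide tendsto_det lim d)
  moreover have "eventually (\<lambda>s. det (X s) \<noteq> 0) G"
    using d by (rule tendsto_imp_eventually_ne)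
  then have "eventually (\<lambda>s. det (\<chi> a b. if b = i then axis j 1 $ a else X s $ a $ b) / det (X s) =
      matrix_inv (X s) $ i $ j) G"
    by eventually_elim (simp add: matrix_inv_component invertible_det_nz)
  ultimately show ?thesis
    using L by (simp add: tendsto_cong matrix_inv_component)
qed

text \<open>The resolvent identity \<open>X^-1 - Y^-1 = X^-1 (Y - X) Y^-1\<close>.\<close>

lemma matrix_inv_diff_component:
  fixes X Y :: "real^'n^'n"
  assumes "invertible X" "invertible Y"
  shows "matrix_inv X $ i $ j - matrix_inv Y $ i $ j =
    - (\<Sum>a\<in>UNIV. \<Sum>b\<in>UNIV. matrix_inv X $ i $ a * (X $ a $ b - Y $ a $ b) * matrix_inv Y $ b $ j)"
proof -
  have "A ** (B - C) = A ** B - A ** C" "(B - C) ** A = B ** A - C ** A" for A B C :: "real^'n^'n"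
    by (simp_all add: vec_eq_iff matrix_matrix_mult_def sum_subtractf algebra_simps)
  then have "matrix_inv X ** (Y - X) ** matrix_inv Y = matrix_inv X ** (Y ** matrix_inv Y) - matrix_inv X ** X ** matrix_inv Y"
    by (simp add: matrix_mul_assoc)
  then have "matrix_inv X ** (Y - X) ** matrix_inv Y = matrix_inv X - matrix_inv Y"
    using assms by (simp add: matrix_inv_left matrix_inv_right)
  then have "matrix_inv X $ i $ j - matrix_inv Y $ i $ j = (matrix_inv X ** (Y - X) ** matrix_inv Y) $ i $ j"
    by simp
  also have "\<dots> = (\<Sum>b\<in>UNIV. \<Sum>a\<in>UNIV. matrix_inv X $ i $ a * (Y $ a $ b - X $ a $ b) * matrix_inv Y $ b $ j)"
    by (simp add: matrix_matrix_mult_def sum_distrib_right)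
  also have "\<dots> = (\<Sum>a\<in>UNIV. \<Sum>b\<in>UNIV. matrix_inv X $ i $ a * (Y $ a $ b - X $ a $ b) * matrix_inv Y $ b $ j)"
    by (rule sum.swap)
  also have "\<dots> = - (\<Sum>a\<in>UNIV. \<Sum>b\<in>UNIV. matrix_inv X $ i $ a * (X $ a $ b - Y $ a $ b) * matrix_inv Y $ b $ j)"
    by (simp add: sum_negf[symmetric] algebra_simps)
  finally show ?thesis .
qed

text \<open>The coefficient may stay anonymous: in the rescaled defect the inverse always meets a
  factor of limit 0, and the product rule then removes its coefficient.\<close>

lemma jet_matrix_inv:
  fixes X Y :: "real \<Rightarrow> real^'n^'n"
  assumes jet: "\<And>i j. jet k (\<lambda>s. X s $ i $ j) (\<lambda>s. Y s $ i $ j) (L $ i $ j) (A i j)"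
    and L: "invertible L"
  shows "\<exists>B. jet k (\<lambda>s. matrix_inv (X s) $ i $ j) (\<lambda>s. matrix_inv (Y s) $ i $ j) (matrix_inv L $ i $ j) B"
proof -
  have X: "((\<lambda>s. X s $ i $ j) \<longlongrightarrow> L $ i $ j) (at_right 0)" and Y: "((\<lambda>s. Y s $ i $ j) \<longlongrightarrow> L $ i $ j) (at_right 0)"
    and A: "((\<lambda>s. (X s $ i $ j - Y s $ i $ j) / s ^ k) \<longlongrightarrow> A i j) (at_right 0)" for i j
    using jet by (auto simp: jet_def)
  note X' = tendsto_matrix_inv[OF X L] and Y' = tendsto_matrix_inv[OF Y L]
  have "((\<lambda>s. - (\<Sum>a\<in>UNIV. \<Sum>b\<in>UNIV. matrix_inv (X s) $ i $ a * ((X s $ a $ b - Y s $ a $ b) / s ^ k) * matrix_inv (Y s) $ b $ j))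
     \<longlongrightarrow> - (\<Sum>a\<in>UNIV. \<Sum>b\<in>UNIV. matrix_inv L $ i $ a * A a b * matrix_inv L $ b $ j)) (at_right 0)"
    by (intro tendsto_intros X' Y' A)
  moreover have "eventually (\<lambda>s. det (X s) \<noteq> 0) (at_right 0)" "eventually (\<lambda>s. det (Y s) \<noteq> 0) (at_right 0)"
    using L tendsto_imp_eventually_ne[OF tendsto_det[OF X]] tendsto_imp_eventually_ne[OF tendsto_det[OF Y]]
    by (auto simp: invertible_det_nz)
  then have "eventually (\<lambda>s. - (\<Sum>a\<in>UNIV. \<Sum>b\<in>UNIV. matrix_inv (X s) $ i $ a * ((X s $ a $ b - Y s $ a $ b) / s ^ k) * matrix_inv (Y s) $ b $ j)
     = (matrix_inv (X s) $ i $ j - matrix_inv (Y s) $ i $ j) / s ^ k) (at_right 0)"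
  proof eventually_elim
    case (elim s)
    then show ?case
      by (simp add: matrix_inv_diff_component invertible_det_nz sum_divide_distrib)
  qed
  ultimately show ?thesis
    using X' Y' by (auto simp: jet_def tendsto_cong)
qed


section \<open>Functions vanishing to finite order on the boundary\<close>

text \<open>Divisibility by the \<open>k\<close>-th power of the height, expressed by normal
  derivatives. Demanding it at all boundary points of \<open>U\<close> rather than at one makes it
  stable under tangential differentiation.\<close>

definition vanishes :: "(real^('b::finite option)) set \<Rightarrow> nat \<Rightarrow> (real^('b option) \<Rightarrow> real) \<Rightarrow> bool" where
  "vanishes U k f \<longleftrightarrow> Cinf_on U f \<and> (\<forall>j<k. \<forall>z\<in>U. z $ None = 0 \<longrightarrow> (partial None ^^ j) f z = 0)"

lemma partial_funpow_cong_open: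
  assumes "open U" "\<And>w. w \<in> U \<Longrightarrow> f w = g w" "z \<in> U"
  shows "(partial i ^^ j) f z = (partial i ^^ j) g z"
  using assms(3)
proof (induction j arbitrary: z)
  case 0
  then show ?case using assms by simp
next
  case (Suc j)
  then show ?case by (auto intro: partial_cong_open[OF assms(1)])
qed

lemma partial_funpow_commute:
  assumes "open U" "Cinf_on U f" "z \<in> U"
  shows "(partial i ^^ j) (partial m f) z = partial m ((partial i ^^ j) f) z"
  using assms(3)
proof (induction j arbitrary: z)
  case (Suc j)
  have "(partial i ^^ Suc j) (partial m f) z = partial i (partial m ((partial i ^^ j) f)) z"
    using partial_cong_open[OF assms(1) Suc.prems Suc.IH] by simp
  also have "\<dots> = partial m (partial i ((partial i ^^ j) f)) z"
    by (rule partial_commute[OF assms(1) Suc.prems Cinf_on_partial_funpow[OF assms(2)]])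
  finally show ?case by simp
qed simp

lemma vanishes_cong:
  assumes "open U" "vanishes U k f" "\<And>w. w \<in> U \<Longrightarrow> f w = g w"
  shows "vanishes U k g"
  using assms Ck_on_cong_open[of U f g] partial_funpow_cong_open[of U f g]
  unfolding vanishes_def by metis

lemma line_in_open:
  fixes z :: "'a::real_normed_vector"
  assumes "open U" "z \<in> U"
  shows "eventually (\<lambda>s. z + s *\<^sub>R v \<in> U) (nhds 0)"
proof -
  have "((\<lambda>s. z + s *\<^sub>R v) \<longlongrightarrow> z) (nhds 0)"
    by (rule tendsto_eq_intros filterlim_ident refl | simp)+
  then show ?thesis
    using assms by (rule topological_tendstoD)
qed

text \<open>Each lower normal derivative is identically zero along the boundary, so its tangential
  derivative is zero as well; the two kinds of derivative commute.\<close>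

lemma vanishes_partial:
  fixes U :: "(real^('b::finite option)) set"
  assumes "open U" "vanishes U k f"
  shows "vanishes U k (partial (Some m) f)"
  unfolding vanishes_def
proof (intro conjI allI impI ballI)
  show "Ck_on n U (partial (Some m) f)" for n
    using Cinf_on_partial[of U f] assms(2) by (simp add: vanishes_def)
next
  fix j z assume j: "j < k" and z: "z \<in> U" "z $ None = 0"
  define g where "g = (partial None ^^ j) f"
  have g: "Cinf_on U g"
    unfolding g_def using assms(2) by (intro Cinf_on_partial_funpow) (simp add: vanishes_def)
  have "((\<lambda>s. g (z + s *\<^sub>R axis (Some m) 1)) has_real_derivative partial (Some m) g z) (at 0)"
    using partial_line[of g z 0 "Some m"] Cinf_on_differentiable[OF g z(1)] by simp
  moreover have "eventually (\<lambda>s. g (z + s *\<^sub>R axis (Some m) 1) = 0) (nhds 0)"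
    using line_in_open[OF assms(1) z(1), of "axis (Some m) 1"]
  proof eventually_elim
    case (elim s)
    then show ?case using assms(2) j z(2) by (simp add: vanishes_def g_def axis_def)
  qed
  then have "((\<lambda>s. g (z + s *\<^sub>R axis (Some m) 1)) has_real_derivative 0) (at 0)"
    using DERIV_cong_ev[of 0 0 "\<lambda>s. g (z + s *\<^sub>R axis (Some m) 1)" "\<lambda>_. 0" 0 0] by auto
  ultimately have "partial (Some m) g z = 0"
    by (rule DERIV_unique)
  then show "(partial None ^^ j) (partial (Some m) f) z = 0"
    using partial_funpow_commute[OF assms(1) _ z(1), of f] assms(2) by (simp add: g_def vanishes_def)
qed

lemma vanishes_partial_None: "vanishes U (Suc k) f \<Longrightarrow> vanishes U k (partial None f)"
  unfolding vanishes_def using Cinf_on_partial[of U f None]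
  by (metis Suc_mono funpow_swap1 funpow.simps(2) o_apply)

abbreviation line :: "real^('b::finite option) \<Rightarrow> real \<Rightarrow> real^('b option)" where
  "line z s \<equiv> z + s *\<^sub>R axis None 1"

lemma tendsto_line:
  assumes "open U" "Cinf_on U f" "z \<in> U"
  shows "((\<lambda>s. f (line z s)) \<longlongrightarrow> f z) (at_right 0)"
proof -
  have "isCont f z"
    using assms Cinf_on_continuous[of U f] by (auto simp: continuous_on_eq_continuous_at)
  moreover have "((\<lambda>s. line z s) \<longlongrightarrow> z) (at_right 0)"
    by (rule tendsto_eq_intros refl | simp)+
  ultimately show ?thesis
    by (rule isCont_tendsto_compose)
qed

lemma eventually_line:
  assumes "open U" "z \<in> U"
  shows "eventually (\<lambda>s. line z s \<in> U) (at_right 0)"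
  using line_in_open[OF assms, of "axis None 1"] by (auto simp: eventually_at_filter elim: eventually_mono)

text \<open>Taylor's theorem at leading order, by induction: l'Hopital's rule trades
  \<open>f\<close> at order \<open>k + 1\<close> for its height derivative at order
  \<open>k\<close>.\<close>

lemma vanishes_tendsto:
  assumes "open U" "z \<in> U" "z $ None = 0" "vanishes U k f"
  shows "((\<lambda>s. f (line z s) / s ^ k) \<longlongrightarrow> (partial None ^^ k) f z / fact k) (at_right 0)"
  using assms(4)
proof (induction k arbitrary: f)
  case 0
  then show ?case using tendsto_line[OF assms(1) _ assms(2)] by (simp add: vanishes_def)
next
  case (Suc k)
  note sm = Suc.prems[unfolded vanishes_def, THEN conjunct1]
  have "((\<lambda>s. partial None f (line z s) / s ^ k / real (Suc k)) \<longlongrightarrow>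
     (partial None ^^ k) (partial None f) z / fact k / real (Suc k)) (at_right 0)"
    by (intro tendsto_divide Suc.IH vanishes_partial_None[OF Suc.prems] tendsto_const) simp
  then have lim: "((\<lambda>s. partial None f (line z s) / (real (Suc k) * s ^ k)) \<longlongrightarrow>
     (partial None ^^ Suc k) f z / fact (Suc k)) (at_right 0)"
    by (simp add: funpow_swap1 mult.commute del: of_nat_Suc)
  show ?case
  proof (rule lhopital_right_0[OF _ _ _ _ _ _ lim])
    show "((\<lambda>s. f (line z s)) \<longlongrightarrow> 0) (at_right 0)"
      using tendsto_line[OF assms(1) sm assms(2)] Suc.prems assms(2,3) by (force simp: vanishes_def)
    show "((\<lambda>s. s ^ Suc k) \<longlongrightarrow> 0) (at_right (0::real))"
      by (rule tendsto_eq_intros refl | simp)+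
    show "\<forall>\<^sub>F s in at_right (0::real). s ^ Suc k \<noteq> 0"
      by (auto simp: eventually_at_filter)
    show "\<forall>\<^sub>F s in at_right (0::real). real (Suc k) * s ^ k \<noteq> 0"
      using eventually_at_right_less[of 0] by eventually_elim (simp del: of_nat_Suc)
    show "\<forall>\<^sub>F s in at_right 0. ((\<lambda>s. f (line z s)) has_real_derivative partial None f (line z s)) (at s)"
      using eventually_line[OF assms(1,2)]
      by eventually_elim (rule partial_line, rule Cinf_on_differentiable[OF sm])
    show "\<forall>\<^sub>F s in at_right 0. ((\<lambda>s. s ^ Suc k) has_real_derivative real (Suc k) * s ^ k) (at s)"
      using DERIV_pow[of "Suc k"] by (simp del: of_nat_Suc)
  qed
qed

text \<open>A normal derivative lowers the order by one and the factor \<open>s\<close> restores it.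
  The Euler operator \<open>s d/ds\<close> multiplies the coefficient of \<open>s^k\<close> by
  \<open>k\<close>.\<close>

lemma vanishes_tendsto_partial:
  assumes "open U" "z \<in> U" "z $ None = 0" "vanishes U k f"
  shows "((\<lambda>s. s * partial None f (line z s) / s ^ k) \<longlongrightarrow> real k * ((partial None ^^ k) f z / fact k)) (at_right 0)"
proof (cases k)
  case 0
  have "((\<lambda>s. partial None f (line z s)) \<longlongrightarrow> partial None f z) (at_right 0)"
    using assms Cinf_on_partial[of U f] by (intro tendsto_line[of U]) (auto simp: vanishes_def)
  then have "((\<lambda>s. s * partial None f (line z s)) \<longlongrightarrow> 0 * partial None f z) (at_right 0)"
    by (intro tendsto_mult tendsto_ident_at)
  with 0 show ?thesis by simp
next
  case (Suc n)
  have "((\<lambda>s. partial None f (line z s) / s ^ n) \<longlongrightarrow> (partial None ^^ n) (partial None f) z / fact n) (at_right 0)"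
    using assms Suc by (intro vanishes_tendsto vanishes_partial_None) auto
  moreover have "eventually (\<lambda>s::real. partial None f (line z s) / s ^ n = s * partial None f (line z s) / s ^ k) (at_right 0)"
    by (auto simp: eventually_at_filter Suc)
  moreover have "(partial None ^^ n) (partial None f) z / fact n = real k * ((partial None ^^ k) f z / fact k)"
    by (simp add: Suc funpow_swap1 field_simps del: of_nat_Suc)
  ultimately show ?thesis
    using tendsto_cong by force
qed

text \<open>The preceding statement for \<open>partial None f\<close>, which vanishes to order
  \<open>k - 1\<close>, with one more factor \<open>s\<close>.\<close>

lemma vanishes_tendsto_partial2:
  assumes "open U" "z \<in> U" "z $ None = 0" "vanishes U k f"
  shows "((\<lambda>s. s\<^sup>2 * partial None (partial None f) (line z s) / s ^ k)
    \<longlongrightarrow> real k * (real k - 1) * ((partial None ^^ k) f z / fact k)) (at_right 0)"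
proof (cases k)
  case 0
  have "((\<lambda>s. partial None (partial None f) (line z s)) \<longlongrightarrow> partial None (partial None f) z) (at_right 0)"
    using assms Cinf_on_partial[OF Cinf_on_partial[of U f]] by (intro tendsto_line[of U]) (auto simp: vanishes_def)
  then have "((\<lambda>s. s\<^sup>2 * partial None (partial None f) (line z s)) \<longlongrightarrow> 0\<^sup>2 * partial None (partial None f) z) (at_right 0)"
    by (intro tendsto_mult tendsto_power tendsto_ident_at)
  with 0 show ?thesis by simp
next
  case (Suc n)
  have "((\<lambda>s. s * partial None (partial None f) (line z s) / s ^ n) \<longlongrightarrow>
      real n * ((partial None ^^ n) (partial None f) z / fact n)) (at_right 0)"
    using assms Suc by (intro vanishes_tendsto_partial vanishes_partial_None) auto
  moreover have "eventually (\<lambda>s::real. s * partial None (partial None f) (line z s) / s ^ n =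
      s\<^sup>2 * partial None (partial None f) (line z s) / s ^ k) (at_right 0)"
    by (auto simp: eventually_at_filter Suc power2_eq_square)
  moreover have "real n * ((partial None ^^ n) (partial None f) z / fact n) =
      real k * (real k - 1) * ((partial None ^^ k) f z / fact k)"
  proof -
    have h: "real k - 1 = real n" "fact k = real k * fact n" "real k \<noteq> 0" "(partial None ^^ k) f z = (partial None ^^ n) (partial None f) z"
      by (simp_all add: Suc funpow_swap1)
    show ?thesis
      unfolding h(1,2,4) using h(3) by simp
  qed
  ultimately show ?thesis
    using tendsto_cong by force
qed


section \<open>Uniqueness of the expansion of the metric\<close>

text \<open>For the slice Ricci tensor the existence of an expansion is enough: it enters the
  rescaled defect with the factor \<open>s^2\<close>, which removes its coefficient.\<close>

definition jetx :: "nat \<Rightarrow> (real \<Rightarrow> real) \<Rightarrow> (real \<Rightarrow> real) \<Rightarrow> bool" where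
  "jetx k u v \<longleftrightarrow> (\<exists>l a. jet k u v l a)"

lemma jetxI: "jet k u v l a \<Longrightarrow> jetx k u v"
  by (auto simp: jetx_def)

lemma jetx_const: "jetx k (\<lambda>_. c) (\<lambda>_. c)"
  by (rule jetxI jet_const)+

lemma jetx_add: "jetx k u v \<Longrightarrow> jetx k u' v' \<Longrightarrow> jetx k (\<lambda>s. u s + u' s) (\<lambda>s. v s + v' s)"
  unfolding jetx_def by (blast intro: jet_add)

lemma jetx_diff: "jetx k u v \<Longrightarrow> jetx k u' v' \<Longrightarrow> jetx k (\<lambda>s. u s - u' s) (\<lambda>s. v s - v' s)"
  unfolding jetx_def by (blast intro: jet_diff)

lemma jetx_mult: "jetx k u v \<Longrightarrow> jetx k u' v' \<Longrightarrow> jetx k (\<lambda>s. u s * u' s) (\<lambda>s. v s * v' s)"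
  unfolding jetx_def by (blast intro: jet_mult)

lemma jetx_uminus: "jetx k u v \<Longrightarrow> jetx k (\<lambda>s. - u s) (\<lambda>s. - v s)"
  using jetx_mult[OF jetx_const[of k "-1"]] by force

lemma jetx_sum:
  assumes "\<And>i. i \<in> I \<Longrightarrow> jetx k (u i) (v i)"
  shows "jetx k (\<lambda>s. \<Sum>i\<in>I. u i s) (\<lambda>s. \<Sum>i\<in>I. v i s)"
  using assms by (induction I rule: infinite_finite_induct) (auto intro: jetx_add jetx_const)

lemma jetx_cong:
  assumes "jetx k u v" "eventually (\<lambda>s. u s = u' s) (at_right 0)" "eventually (\<lambda>s. v s = v' s) (at_right 0)"
  shows "jetx k u' v'"
  using assms jet_cong[OF _ assms(2,3)] unfolding jetx_def by blast

lemmas jetx_intros = jetx_const jetx_add jetx_diff jetx_mult jetx_uminus jetx_sum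

lemma vanishes_partial_diff:
  assumes U: "open U" and f: "Cinf_on U f" "Cinf_on U h" and van: "vanishes U k (\<lambda>w. f w - h w)"
  shows "vanishes U k (\<lambda>w. partial (Some m) f w - partial (Some m) h w)"
proof (rule vanishes_cong[OF U vanishes_partial[OF U van]])
  show "partial (Some m) (\<lambda>w. f w - h w) w = partial (Some m) f w - partial (Some m) h w" if "w \<in> U" for w
    by (rule partial_diff) (rule Cinf_on_differentiable[OF f(1) that] Cinf_on_differentiable[OF f(2) that])+
qed

text \<open>\<open>0 < k\<close> forces the two functions to agree at \<open>z\<close>, so they have
  the common limit that \<open>jet\<close> demands.\<close>

lemma jet_vanishes:
  assumes "open U" "z \<in> U" "z $ None = 0" "0 < k" "Cinf_on U f" "Cinf_on U h" "vanishes U k (\<lambda>w. f w - h w)"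
  shows "jet k (\<lambda>s. f (line z s)) (\<lambda>s. h (line z s)) (f z) ((partial None ^^ k) (\<lambda>w. f w - h w) z / fact k)"
proof -
  have "f z = h z"
    using assms(2-4,7) by (force simp: vanishes_def)
  then show ?thesis
    using tendsto_line[OF assms(1,5,2)] tendsto_line[OF assms(1,6,2)] vanishes_tendsto[OF assms(1-3,7)]
    by (simp add: jet_def)
qed

locale collar_pair = F: collar_metric U F + H: collar_metric U H
  for U :: "(real^('b::finite option)) set" and F H :: "real^('b option) \<Rightarrow> real^'b^'b" +
  assumes agree: "\<And>z. z \<in> U \<Longrightarrow> z $ None = 0 \<Longrightarrow> F z = H z"
begin

definition "van k \<longleftrightarrow> (\<forall>a b. vanishes U k (\<lambda>z. F z $ a $ b - H z $ a $ b))"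

text \<open>The Taylor coefficient of \<open>s^k\<close> in \<open>F - H\<close>; it is the leading
  one once \<open>van k\<close> holds.\<close>

definition "lead k a b z = (partial None ^^ k) (\<lambda>z. F z $ a $ b - H z $ a $ b) z / fact k"

lemma van_Suc:
  assumes "van k" "\<And>a b z. z \<in> U \<Longrightarrow> z $ None = 0 \<Longrightarrow> lead k a b z = 0"
  shows "van (Suc k)"
  using assms unfolding van_def vanishes_def lead_def by (force simp: less_Suc_eq)

lemma van_1: "van 1"
  unfolding van_def vanishes_def using agree Ck_on_diff[OF F.open_U F.smooth[rule_format] H.smooth[rule_format]] by auto

lemma eventually_Up:
  assumes "z \<in> U" "z $ None = 0"
  shows "eventually (\<lambda>s. line z s \<in> F.Up) (at_right 0)"
  using eventually_line[OF F.open_U assms(1)] eventually_at_right_less[of 0]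
  by eventually_elim (use assms in \<open>auto simp: F.Up_def axis_def\<close>)

section \<open>Expansion of the difference of the Einstein defects\<close>

context
  fixes k :: nat and z
  assumes k: "0 < k" and van: "van k" and z: "z \<in> U" "z $ None = 0"
begin

abbreviation "A \<equiv> \<lambda>a b. lead k a b z"

lemma van': "vanishes U k (\<lambda>z. F z $ a $ b - H z $ a $ b)"
  using van by (simp add: van_def)

lemma smooth_D: "Cinf_on U (F.D i a b)" "Cinf_on U (H.D i a b)"
  by (rule Cinf_on_partial, rule F.smooth H.smooth)+

lemma jet_F: "jet k (\<lambda>s. F (line z s) $ a $ b) (\<lambda>s. H (line z s) $ a $ b) (F z $ a $ b) (A a b)"
  unfolding lead_def by (rule jet_vanishes[OF F.open_U z k F.smooth H.smooth van'])

lemma jetx_D: "jetx k (\<lambda>s. F.D (Some m) a b (line z s)) (\<lambda>s. H.D (Some m) a b (line z s))"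
  by (rule jetxI, rule jet_vanishes[OF F.open_U z k smooth_D],
      rule vanishes_partial_diff[OF F.open_U F.smooth H.smooth van'])

lemma jetx_DD: "jetx k (\<lambda>s. partial (Some n) (F.D (Some m) a b) (line z s)) (\<lambda>s. partial (Some n) (H.D (Some m) a b) (line z s))"
  by (rule jetxI, rule jet_vanishes[OF F.open_U z k Cinf_on_partial[OF smooth_D(1)] Cinf_on_partial[OF smooth_D(2)]],
      rule vanishes_partial_diff[OF F.open_U smooth_D], rule vanishes_partial_diff[OF F.open_U F.smooth H.smooth van'])

lemma inv_z: "invertible (F z)"
  using F.inv[OF z(1)] z(2) by simp

lemma jet_P: "\<exists>B. jet k (\<lambda>s. F.P (line z s) $ a $ b) (\<lambda>s. H.P (line z s) $ a $ b) (F.P z $ a $ b) B"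
  by (rule jet_matrix_inv[OF jet_F inv_z])

lemma jetx_P: "jetx k (\<lambda>s. F.P (line z s) $ a $ b) (\<lambda>s. H.P (line z s) $ a $ b)"
  using jet_P unfolding jetx_def by blast

lemma jet_D_None: "jet k (\<lambda>s. s * F.D None a b (line z s)) (\<lambda>s. s * H.D None a b (line z s)) 0 (real k * A a b)"
proof -
  have lim: "((\<lambda>s. s * f (line z s)) \<longlongrightarrow> 0) (at_right 0)" if "Cinf_on U f" for f
    using tendsto_mult[OF tendsto_ident_at[of 0 "{0<..}"] tendsto_line[OF F.open_U that z(1)]] by simp
  have "((\<lambda>s. s * partial None (\<lambda>z. F z $ a $ b - H z $ a $ b) (line z s) / s ^ k) \<longlongrightarrow> real k * A a b) (at_right 0)"
    unfolding lead_def by (rule vanishes_tendsto_partial[OF F.open_U z van'])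
  moreover have "eventually (\<lambda>s. s * partial None (\<lambda>z. F z $ a $ b - H z $ a $ b) (line z s) / s ^ k =
      (s * F.D None a b (line z s) - s * H.D None a b (line z s)) / s ^ k) (at_right 0)"
    using eventually_Up[OF z]
    by eventually_elim (simp add: partial_diff F.diffble H.diffble right_diff_distrib)
  ultimately show ?thesis
    using lim[OF smooth_D(1)] lim[OF smooth_D(2)] by (simp add: jet_def tendsto_cong)
qed

lemma jet_DD_None: "jet k (\<lambda>s. s\<^sup>2 * partial None (F.D None a b) (line z s)) (\<lambda>s. s\<^sup>2 * partial None (H.D None a b) (line z s))
   0 (real k * (real k - 1) * A a b)"
proof -
  have lim: "((\<lambda>s. s\<^sup>2 * f (line z s)) \<longlongrightarrow> 0) (at_right 0)" if "Cinf_on U f" for f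
    using tendsto_mult[OF tendsto_power[OF tendsto_ident_at[of 0 "{0<..}"], of 2] tendsto_line[OF F.open_U that z(1)]] by simp
  have "((\<lambda>s. s\<^sup>2 * partial None (partial None (\<lambda>z. F z $ a $ b - H z $ a $ b)) (line z s) / s ^ k)
      \<longlongrightarrow> real k * (real k - 1) * A a b) (at_right 0)"
    unfolding lead_def by (rule vanishes_tendsto_partial2[OF F.open_U z van'])
  moreover have "partial None (partial None (\<lambda>z. F z $ a $ b - H z $ a $ b)) w =
      partial None (F.D None a b) w - partial None (H.D None a b) w" if "w \<in> F.Up" for w
  proof -
    have "partial None (partial None (\<lambda>z. F z $ a $ b - H z $ a $ b)) w =
        partial None (\<lambda>w. F.D None a b w - H.D None a b w) w"
      by (rule partial_cong_open[OF F.open_Up that]) (simp add: partial_diff F.diffble H.diffble)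
    then show ?thesis
      using that by (simp add: partial_diff F.diffble H.diffble)
  qed
  then have "eventually (\<lambda>s. s\<^sup>2 * partial None (partial None (\<lambda>z. F z $ a $ b - H z $ a $ b)) (line z s) / s ^ k =
      (s\<^sup>2 * partial None (F.D None a b) (line z s) - s\<^sup>2 * partial None (H.D None a b) (line z s)) / s ^ k) (at_right 0)"
    using eventually_Up[OF z]
    by (auto elim!: eventually_mono simp: right_diff_distrib)
  ultimately show ?thesis
    using lim[OF Cinf_on_partial[OF smooth_D(1)]] lim[OF Cinf_on_partial[OF smooth_D(2)]]
    by (simp add: jet_def tendsto_cong)
qed

lemma jetx_Gam: "jetx k (\<lambda>s. F.Gam a i j (line z s)) (\<lambda>s. H.Gam a i j (line z s))"
  unfolding F.Gam_def H.Gam_def by (intro jetx_intros jetx_P jetx_D)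

lemma jetx_partial_Gam: "jetx k (\<lambda>s. partial (Some m) (F.Gam a i j) (line z s)) (\<lambda>s. partial (Some m) (H.Gam a i j) (line z s))"
proof (rule jetx_cong)
  show "\<forall>\<^sub>F s in at_right 0. 1/2 * (\<Sum>l\<in>UNIV.
    - (\<Sum>c\<in>UNIV. \<Sum>d\<in>UNIV. F.P (line z s) $ a $ c * F.D (Some m) c d (line z s) * F.P (line z s) $ d $ l) *
      (F.D (Some i) j l (line z s) + F.D (Some j) i l (line z s) - F.D (Some l) i j (line z s))
    + F.P (line z s) $ a $ l * (partial (Some m) (F.D (Some i) j l) (line z s)
       + partial (Some m) (F.D (Some j) i l) (line z s) - partial (Some m) (F.D (Some l) i j) (line z s)))
      = partial (Some m) (F.Gam a i j) (line z s)"
    using eventually_Up[OF z] by eventually_elim (rule F.partial_Gam[symmetric])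
  show "\<forall>\<^sub>F s in at_right 0. 1/2 * (\<Sum>l\<in>UNIV.
    - (\<Sum>c\<in>UNIV. \<Sum>d\<in>UNIV. H.P (line z s) $ a $ c * H.D (Some m) c d (line z s) * H.P (line z s) $ d $ l) *
      (H.D (Some i) j l (line z s) + H.D (Some j) i l (line z s) - H.D (Some l) i j (line z s))
    + H.P (line z s) $ a $ l * (partial (Some m) (H.D (Some i) j l) (line z s)
       + partial (Some m) (H.D (Some j) i l) (line z s) - partial (Some m) (H.D (Some l) i j) (line z s)))
      = partial (Some m) (H.Gam a i j) (line z s)"
    using eventually_Up[OF z] by eventually_elim (rule H.partial_Gam[symmetric])
qed (intro jetx_intros jetx_P jetx_D jetx_DD)

lemma jetx_ric_hat: "jetx k (\<lambda>s. F.ric_hat i j (line z s)) (\<lambda>s. H.ric_hat i j (line z s))"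
  unfolding F.ric_hat_def H.ric_hat_def by (intro jetx_intros jetx_Gam jetx_partial_Gam)

abbreviation "trA \<equiv> \<Sum>a\<in>UNIV. \<Sum>b\<in>UNIV. F.P z $ a $ b * A a b"

lemma jet_tr: "jet k (\<lambda>s. s * F.tr_D (line z s)) (\<lambda>s. s * H.tr_D (line z s)) 0 (real k * trA)"
proof -
  have *: "jet k (\<lambda>s. F.P (line z s) $ a $ b * (s * F.D None a b (line z s)))
     (\<lambda>s. H.P (line z s) $ a $ b * (s * H.D None a b (line z s))) 0 (real k * (F.P z $ a $ b * A a b))" for a b
  proof -
    obtain B where B: "jet k (\<lambda>s. F.P (line z s) $ a $ b) (\<lambda>s. H.P (line z s) $ a $ b) (F.P z $ a $ b) B"
      using jet_P by blast
    \<comment> \<open>The limit 0 of \<open>s * F.D None a b\<close> removes the unknown coefficient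
      \<open>B\<close> of the inverse.\<close>
    show ?thesis
      using jet_mult[OF B jet_D_None[of a b]] by (simp add: mult.left_commute)
  qed
  have "jet k (\<lambda>s. \<Sum>a\<in>UNIV. \<Sum>b\<in>UNIV. F.P (line z s) $ a $ b * (s * F.D None a b (line z s)))
     (\<lambda>s. \<Sum>a\<in>UNIV. \<Sum>b\<in>UNIV. H.P (line z s) $ a $ b * (s * H.D None a b (line z s)))
     (\<Sum>a\<in>(UNIV::'b set). \<Sum>b\<in>(UNIV::'b set). 0) (\<Sum>a\<in>UNIV. \<Sum>b\<in>UNIV. real k * (F.P z $ a $ b * A a b))"
    by (rule jet_sum, rule jet_sum, rule *)
  then show ?thesis
    by (simp add: F.tr_D_def H.tr_D_def sum_distrib_left mult.left_commute)
qed

text \<open>With \<open>d = CARD('b)\<close>, the second height derivative contributes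
  \<open>- k (k - 1) / 2\<close> and the first \<open>k (d - 1) / 2\<close> to the factor of
  \<open>A\<close>, in total \<open>k (d - k) / 2\<close>; the trace term contributes
  \<open>k / 2 * trA * F\<close>. The terms quadratic in height derivatives contain two factors of
  limit 0, and the slice Ricci tensor carries \<open>s^2\<close>, so neither contributes.\<close>

lemma jet_einstein:
  "jet k (\<lambda>s. s\<^sup>2 * einstein_defect_coord F.M (line z s) $ Some i $ Some j)
    (\<lambda>s. s\<^sup>2 * einstein_defect_coord H.M (line z s) $ Some i $ Some j) 0
    (real k / 2 * ((real CARD('b) - real k) * A i j + trA * F z $ i $ j))"
proof -
  obtain l0 a0 where ric: "jet k (\<lambda>s. F.ric_hat i j (line z s)) (\<lambda>s. H.ric_hat i j (line z s)) l0 a0"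
    using jetx_ric_hat unfolding jetx_def by blast
  have "((\<lambda>s::real. s\<^sup>2) \<longlongrightarrow> 0) (at_right 0)"
    by (rule tendsto_eq_intros refl | simp)+
  from jet_mult[OF jet_same[OF this] ric]
  have 1: "jet k (\<lambda>s. s\<^sup>2 * F.ric_hat i j (line z s)) (\<lambda>s. s\<^sup>2 * H.ric_hat i j (line z s)) 0 0"
    by simp
  have 2: "jet k (\<lambda>s. s * F.D None j l (line z s) * F.P (line z s) $ l $ m * (s * F.D None i m (line z s)))
      (\<lambda>s. s * H.D None j l (line z s) * H.P (line z s) $ l $ m * (s * H.D None i m (line z s))) 0 0" for l m
  proof -
    obtain B where B: "jet k (\<lambda>s. F.P (line z s) $ l $ m) (\<lambda>s. H.P (line z s) $ l $ m) (F.P z $ l $ m) B"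
      using jet_P by blast
    show ?thesis
      using jet_mult[OF jet_mult[OF jet_D_None[of j l] B] jet_D_None[of i m]] by simp
  qed
  have "jet k (\<lambda>s. \<Sum>l\<in>UNIV. \<Sum>m\<in>UNIV. s * F.D None j l (line z s) * F.P (line z s) $ l $ m * (s * F.D None i m (line z s)))
      (\<lambda>s. \<Sum>l\<in>UNIV. \<Sum>m\<in>UNIV. s * H.D None j l (line z s) * H.P (line z s) $ l $ m * (s * H.D None i m (line z s)))
      (\<Sum>l\<in>(UNIV :: 'b set). \<Sum>m\<in>(UNIV :: 'b set). 0) (\<Sum>l\<in>(UNIV :: 'b set). \<Sum>m\<in>(UNIV :: 'b set). 0)"
    by (rule jet_sum, rule jet_sum, rule 2)
  note 2 = this[unfolded sum.neutral_const]
  \<comment> \<open>The nesting follows the order of the summands in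
    \<open>einstein_defect_M\<close>. Limit and coefficient are kept in the form that the rules
    produce and are simplified only at the end.\<close>
  note jet = jet_add[OF jet_diff[OF jet_add[OF jet_add[OF jet_diff[OF 1
     jet_cmult[OF jet_DD_None[of i j], of "1/2"]] jet_cmult[OF jet_D_None[of i j], of "(real CARD('b) - 1) / 2"]]
     jet_cmult[OF jet_mult[OF jet_tr jet_F[of i j]], of "1/2"]] jet_cmult[OF jet_mult[OF jet_tr jet_D_None[of i j]], of "1/4"]]
     jet_cmult[OF 2, of "1/2"]]
  have "jet k (\<lambda>s. s\<^sup>2 * einstein_defect_coord F.M (line z s) $ Some i $ Some j)
    (\<lambda>s. s\<^sup>2 * einstein_defect_coord H.M (line z s) $ Some i $ Some j)
    (0 - 1/2 * 0 + (real CARD('b) - 1) / 2 * 0 + 1/2 * (0 * F z $ i $ j) - 1/4 * (0 * 0) + 1/2 * 0)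
    (0 - 1/2 * (real k * (real k - 1) * A i j) + (real CARD('b) - 1) / 2 * (real k * A i j)
     + 1/2 * (real k * trA * F z $ i $ j + 0 * A i j) - 1/4 * (real k * trA * 0 + 0 * (real k * A i j)) + 1/2 * 0)"
  proof (rule jet_cong[OF jet])
    have [simp]: "z $ None = 0" "axis None 1 $ None = (1::real)"
      using z by (simp_all add: axis_def)
    show "\<forall>\<^sub>F s in at_right 0. s\<^sup>2 * F.ric_hat i j (line z s) - 1/2 * (s\<^sup>2 * partial None (F.D None i j) (line z s))
       + (real CARD('b) - 1) / 2 * (s * F.D None i j (line z s)) + 1/2 * (s * F.tr_D (line z s) * F (line z s) $ i $ j)
       - 1/4 * (s * F.tr_D (line z s) * (s * F.D None i j (line z s)))
       + 1/2 * (\<Sum>l\<in>UNIV. \<Sum>m\<in>UNIV. s * F.D None j l (line z s) * F.P (line z s) $ l $ m * (s * F.D None i m (line z s)))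
       = s\<^sup>2 * einstein_defect_coord F.M (line z s) $ Some i $ Some j"
      using eventually_Up[OF z] eventually_at_right_less[of 0]
      by eventually_elim (simp add: F.einstein_defect_M[of "line z _"] distrib_left right_diff_distrib sum_distrib_left
           power2_eq_square mult_ac)
    show "\<forall>\<^sub>F s in at_right 0. s\<^sup>2 * H.ric_hat i j (line z s) - 1/2 * (s\<^sup>2 * partial None (H.D None i j) (line z s))
       + (real CARD('b) - 1) / 2 * (s * H.D None i j (line z s)) + 1/2 * (s * H.tr_D (line z s) * H (line z s) $ i $ j)
       - 1/4 * (s * H.tr_D (line z s) * (s * H.D None i j (line z s)))
       + 1/2 * (\<Sum>l\<in>UNIV. \<Sum>m\<in>UNIV. s * H.D None j l (line z s) * H.P (line z s) $ l $ m * (s * H.D None i m (line z s)))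
       = s\<^sup>2 * einstein_defect_coord H.M (line z s) $ Some i $ Some j"
      using eventually_Up[OF z] eventually_at_right_less[of 0]
      by eventually_elim (simp add: H.einstein_defect_M[of "line z _"] distrib_left right_diff_distrib sum_distrib_left
           power2_eq_square mult_ac)
  qed
  moreover have "0 - 1/2 * 0 + (real CARD('b) - 1) / 2 * 0 + 1/2 * (0 * F z $ i $ j) - 1/4 * (0 * 0) + 1/2 * 0 = 0"
    by simp
  moreover have "0 - 1/2 * (m * (m - 1) * x) + (d - 1) / 2 * (m * x) + 1/2 * (m * t * y + 0 * x)
     - 1/4 * (m * t * 0 + 0 * (m * x)) + 1/2 * 0 = m / 2 * ((d - m) * x + t * y)" for m d x t y :: real
    by (simp add: field_simps)
  ultimately show ?thesis
    by (simp only:)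
qed

section \<open>From the decay of the defect to the leading coefficient\<close>

lemma sum_P_F: "(\<Sum>a\<in>UNIV. \<Sum>b\<in>UNIV. F.P z $ a $ b * F z $ a $ b) = real CARD('b)"
proof -
  have "(\<Sum>a\<in>UNIV. \<Sum>b\<in>UNIV. F.P z $ a $ b * F z $ a $ b) = (\<Sum>a\<in>UNIV. \<Sum>b\<in>UNIV. F.P z $ a $ b * F z $ b $ a)"
    using F.sym[OF z(1)] z(2) by simp
  then show ?thesis
    by (simp add: inverse_left_component[OF inv_z])
qed

text \<open>Decay beyond order \<open>CARD('b)\<close> annihilates the coefficient at every order
  \<open>k \<le> CARD('b)\<close>. Contraction with the inverse metric, in which \<open>F\<close>
  has trace \<open>CARD('b)\<close>, leaves \<open>(2 * CARD('b) - k) * trA = 0\<close> with a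
  positive factor. Without the trace term the remaining equation is
  \<open>(CARD('b) - k) * A = 0\<close>.\<close>

lemma lead_eqs:
  assumes kd: "k \<le> CARD('b)"
    and E: "\<And>i j. ((\<lambda>s. s\<^sup>2 * einstein_defect_coord F.M (line z s) $ Some i $ Some j / s ^ CARD('b)) \<longlongrightarrow> 0) (at_right 0)"
      "\<And>i j. ((\<lambda>s. s\<^sup>2 * einstein_defect_coord H.M (line z s) $ Some i $ Some j / s ^ CARD('b)) \<longlongrightarrow> 0) (at_right 0)"
  shows "trA = 0" "k < CARD('b) \<Longrightarrow> A i j = 0"
proof -
  have lim: "((\<lambda>s. f s / s ^ k) \<longlongrightarrow> 0) (at_right 0)" if "((\<lambda>s. f s / s ^ CARD('b)) \<longlongrightarrow> 0) (at_right 0)" for f :: "real \<Rightarrow> real"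
  proof -
    have "((\<lambda>s. f s / s ^ CARD('b) * s ^ (CARD('b) - k)) \<longlongrightarrow> 0 * 0 ^ (CARD('b) - k)) (at_right 0)"
      by (intro tendsto_mult that tendsto_power tendsto_ident_at)
    moreover have "eventually (\<lambda>s. f s / s ^ CARD('b) * s ^ (CARD('b) - k) = f s / s ^ k) (at_right 0)"
      using kd by (auto simp: eventually_at_filter power_diff)
    ultimately show ?thesis
      using tendsto_cong by force
  qed
  have eq: "(real CARD('b) - real k) * A i j + trA * F z $ i $ j = 0" for i j
  proof -
    have "((\<lambda>s. (s\<^sup>2 * einstein_defect_coord F.M (line z s) $ Some i $ Some j -
        s\<^sup>2 * einstein_defect_coord H.M (line z s) $ Some i $ Some j) / s ^ k) \<longlongrightarrow> 0) (at_right 0)"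
      using tendsto_diff[OF lim[OF E(1)[of i j]] lim[OF E(2)[of i j]]] by (simp add: diff_divide_distrib)
    from jet_unique[OF jet_einstein this] k show ?thesis
      by simp
  qed
  have "0 = (\<Sum>i\<in>UNIV. \<Sum>j\<in>UNIV. F.P z $ i $ j * ((real CARD('b) - real k) * A i j + trA * F z $ i $ j))"
    by (simp only: eq) simp
  also have "\<dots> = (real CARD('b) - real k) * trA + trA * (\<Sum>i\<in>UNIV. \<Sum>j\<in>UNIV. F.P z $ i $ j * F z $ i $ j)"
    by (simp only: distrib_left sum.distrib sum_distrib_left) (simp only: mult_ac)
  also have "\<dots> = (2 * real CARD('b) - real k) * trA"
    unfolding sum_P_F by (simp add: algebra_simps)
  finally have "(2 * real CARD('b) - real k) * trA = 0" by simp
  moreover have "2 * real CARD('b) - real k > 0"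
    using kd zero_less_card_finite[where 'a='b] by linarith
  ultimately show trA: "trA = 0" by simp
  show "A i j = 0" if "k < CARD('b)"
    using eq[of i j] that unfolding trA by simp
qed

end

text \<open>Multiplication by the constant matrix \<open>(F z)\<^sup>-\<^sup>1\<close> reduces this to the derivative of the determinant
  at the identity, which is the trace.\<close>

lemma det_jet:
  assumes z: "z \<in> U" "z $ None = 0" "0 < k" "van k"
    and tr: "(\<Sum>a\<in>UNIV. \<Sum>b\<in>UNIV. F.P z $ a $ b * lead k a b z) = 0"
  shows "jet k (\<lambda>s. det (F (line z s))) (\<lambda>s. det (H (line z s))) (det (F z)) 0"
proof -
  note inv = inv_z[OF z(3,4,1,2)]
  define X where "X = matrix_inv (F z)"
  define C where "C i j = (\<Sum>a\<in>UNIV. lead k i a z * X $ a $ j)" for i j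
  have trC: "(\<Sum>i\<in>UNIV. C i i) = 0"
  proof -
    have "X $ a $ i = X $ i $ a" for a i
      using symmetric_matrix_inv[OF inv] F.sym[OF z(1)] z(2) by (simp add: X_def vec_eq_iff transpose_def)
    then show ?thesis
      using tr by (simp add: C_def X_def mult.commute)
  qed
  have "jet k (\<lambda>s. (F (line z s) ** X) $ i $ j) (\<lambda>s. (H (line z s) ** X) $ i $ j) (mat 1 $ i $ j) (C i j)" for i j
  proof -
    have "jet k (\<lambda>s. \<Sum>a\<in>UNIV. F (line z s) $ i $ a * X $ a $ j) (\<lambda>s. \<Sum>a\<in>UNIV. H (line z s) $ i $ a * X $ a $ j)
      (\<Sum>a\<in>UNIV. F z $ i $ a * X $ a $ j) (\<Sum>a\<in>UNIV. lead k i a z * X $ a $ j + F z $ i $ a * 0)"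
      by (intro jet_sum jet_mult jet_const jet_F[OF z(3,4,1,2)])
    then show ?thesis
      by (simp add: C_def matrix_matrix_mult_def X_def inverse_right_component[OF inv] mat_def)
  qed
  note jetX = this
  have "jet k (\<lambda>s. det (F (line z s) ** X)) (\<lambda>s. det (H (line z s) ** X))
    (\<Sum>p | p permutes UNIV. of_int (sign p) * (\<Prod>i\<in>UNIV. (mat 1 :: real^'b^'b) $ i $ p i))
    (\<Sum>p | p permutes UNIV. 0 * (\<Prod>i\<in>UNIV. (mat 1 :: real^'b^'b) $ i $ p i) +
      of_int (sign p) * (\<Sum>i\<in>UNIV. C i (p i) * (\<Prod>j\<in>UNIV - {i}. (mat 1 :: real^'b^'b) $ j $ p j)))"
    unfolding det_def by (intro jet_sum jet_mult jet_const jet_prod finite jetX)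
  also have "(\<Sum>p | p permutes UNIV. of_int (sign p) * (\<Prod>i\<in>UNIV. (mat 1 :: real^'b^'b) $ i $ p i)) = det (mat 1 :: real^'b^'b)"
    by (simp add: det_def)
  also have "(\<Sum>p | p permutes UNIV. 0 * (\<Prod>i\<in>UNIV. (mat 1 :: real^'b^'b) $ i $ p i) +
      of_int (sign p) * (\<Sum>i\<in>UNIV. C i (p i) * (\<Prod>j\<in>UNIV - {i}. (mat 1 :: real^'b^'b) $ j $ p j))) =
      (\<Sum>p\<in>{id}. of_int (sign p) * (\<Sum>i\<in>UNIV. C i (p i) * (\<Prod>j\<in>UNIV - {i}. (mat 1 :: real^'b^'b) $ j $ p j)))"
  proof (rule sum.mono_neutral_cong_right)
    show "\<forall>p\<in>{p. p permutes UNIV} - {id}. 0 * (\<Prod>i\<in>UNIV. (mat 1 :: real^'b^'b) $ i $ p i) +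
      of_int (sign p) * (\<Sum>i\<in>UNIV. C i (p i) * (\<Prod>j\<in>UNIV - {i}. (mat 1 :: real^'b^'b) $ j $ p j)) = 0"
    proof
      fix p :: "'b \<Rightarrow> 'b" assume p: "p \<in> {p. p permutes UNIV} - {id}"
      obtain a where a: "p a \<noteq> a" using p by (auto simp: fun_eq_iff)
      \<comment> \<open>A permutation other than the identity moves both \<open>a\<close> and
        \<open>p a\<close>. Whichever single factor is left out of the product, an off-diagonal
        entry of the identity matrix, hence 0, remains.\<close>
      have "p (p a) \<noteq> p a" using a p by (auto dest: permutes_inj injD)
      have *: "(\<Prod>j\<in>UNIV - {i}. (mat 1 :: real^'b^'b) $ j $ p j) = 0" for i
      proof -
        obtain j where "j \<noteq> i" "p j \<noteq> j" using a \<open>p (p a) \<noteq> p a\<close> by metis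
        then show ?thesis by (intro prod_zero) (auto simp: mat_def intro!: bexI[of _ j])
      qed
      show "0 * (\<Prod>i\<in>UNIV. (mat 1 :: real^'b^'b) $ i $ p i) +
        of_int (sign p) * (\<Sum>i\<in>UNIV. C i (p i) * (\<Prod>j\<in>UNIV - {i}. (mat 1 :: real^'b^'b) $ j $ p j)) = 0"
        unfolding * by simp
    qed
  qed (simp_all add: permutes_id finite_permutations)
  also have "\<dots> = 0"
    using trC by (simp add: mat_def)
  finally have "jet k (\<lambda>s. det (F (line z s)) * det X) (\<lambda>s. det (H (line z s)) * det X) 1 0"
    by (simp add: det_mul)
  from jet_cmult[OF this, of "det (F z)"] have "jet k (\<lambda>s. det (F (line z s)) * (det (F z) * det X))
     (\<lambda>s. det (H (line z s)) * (det (F z) * det X)) (det (F z)) 0"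
    by (simp add: mult.left_commute)
  moreover have "det (F z) * det X = 1"
    by (simp add: X_def matrix_inv_right[OF inv] flip: det_mul)
  ultimately show ?thesis by simp
qed

text \<open>At the top order the equation no longer determines the leading tensor but still makes it
  trace-free, which is all that the determinant detects.\<close>

proposition det_jet_top:
  assumes E: "\<And>i j z. z \<in> U \<Longrightarrow> z $ None = 0 \<Longrightarrow>
     ((\<lambda>s. s\<^sup>2 * einstein_defect_coord F.M (line z s) $ Some i $ Some j / s ^ CARD('b)) \<longlongrightarrow> 0) (at_right 0)"
      "\<And>i j z. z \<in> U \<Longrightarrow> z $ None = 0 \<Longrightarrow>
     ((\<lambda>s. s\<^sup>2 * einstein_defect_coord H.M (line z s) $ Some i $ Some j / s ^ CARD('b)) \<longlongrightarrow> 0) (at_right 0)"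
    and z: "z \<in> U" "z $ None = 0"
  shows "jet CARD('b) (\<lambda>s. det (F (line z s))) (\<lambda>s. det (H (line z s))) (det (F z)) 0"
proof -
  \<comment> \<open>The induction starts at \<open>van 1\<close>, given by agreement on the
    boundary. Passing beyond \<open>van (Suc k)\<close> needs \<open>Suc k < CARD('b)\<close>, so it
    reaches \<open>van CARD('b)\<close> and stops exactly there.\<close>
  have "Suc k \<le> CARD('b) \<Longrightarrow> van (Suc k)" for k
  proof (induction k)
    case 0
    then show ?case using van_1 by simp
  next
    case (Suc k)
    then have v: "van (Suc k)" by simp
    show ?case
    proof (rule van_Suc[OF v])
      fix a b z assume z: "z \<in> U" "z $ None = 0"
      show "lead (Suc k) a b z = 0"
        by (rule lead_eqs(2)[OF zero_less_Suc v z _ E(1)[OF z] E(2)[OF z]]) (use Suc.prems in auto)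
    qed
  qed
  then have "van CARD('b)"
    using zero_less_card_finite[where 'a='b] by (metis Suc_pred' order_refl)
  then show ?thesis
    using z by (intro det_jet lead_eqs(1)[OF _ _ _ _ _ E]) auto
qed

end


section \<open>Components and the tensor norm\<close>

text \<open>Cholesky factorisation by induction on the index set. Functions on a finite set are used
  in place of matrices because the dimension of a matrix is fixed by its type.\<close>

lemma pos_def_Gram:
  fixes G :: "'k \<Rightarrow> 'k \<Rightarrow> real"
  assumes "finite I"
    and "\<And>i j. i \<in> I \<Longrightarrow> j \<in> I \<Longrightarrow> G i j = G j i"
    and "\<And>v. (\<exists>i\<in>I. v i \<noteq> 0) \<Longrightarrow> (\<Sum>i\<in>I. \<Sum>j\<in>I. G i j * v i * v j) > 0"
  shows "\<exists>q. \<forall>i\<in>I. \<forall>j\<in>I. G i j = (\<Sum>a\<in>I. q a i * q a j)"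
  using assms
proof (induction I arbitrary: G rule: finite_induct)
  case empty
  then show ?case by simp
next
  case (insert x I)
  have split: "(\<Sum>i\<in>insert x I. \<Sum>j\<in>insert x I. G i j * v i * v j) =
      G x x * (v x)\<^sup>2 + 2 * v x * (\<Sum>i\<in>I. G x i * v i) + (\<Sum>i\<in>I. \<Sum>j\<in>I. G i j * v i * v j)" for v
  proof -
    have "(\<Sum>i\<in>I. G i x * v i * v x) = v x * (\<Sum>i\<in>I. G x i * v i)"
      unfolding sum_distrib_left using insert.prems(1) by (intro sum.cong) auto
    moreover have "(\<Sum>i\<in>I. G x i * v x * v i) = v x * (\<Sum>i\<in>I. G x i * v i)"
      unfolding sum_distrib_left by (intro sum.cong) auto
    ultimately show ?thesis
      using insert.hyps by (simp add: sum.distrib power2_eq_square)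
  qed
  have Gxx: "G x x > 0"
    using insert.prems(2)[of "\<lambda>i. if i = x then 1 else 0"] insert.hyps
    unfolding split by (simp add: sum.neutral if_distrib cong: if_cong)
  \<comment> \<open>The Schur complement of the entry at \<open>x\<close>.\<close>
  define G' where "G' i j = G i j - G x i * G x j / G x x" for i j
  have "(\<Sum>i\<in>I. \<Sum>j\<in>I. G' i j * v i * v j) > 0" if v: "\<exists>i\<in>I. v i \<noteq> 0" for v
  proof -
    define s where "s = (\<Sum>i\<in>I. G x i * v i)"
    \<comment> \<open>The value at \<open>x\<close> minimises the quadratic form for given
      \<open>v\<close> on \<open>I\<close>; the minimum is the form of the Schur complement.\<close>
    define w where "w = v(x := - s / G x x)"
    have w: "w i = v i" if "i \<in> I" for i
      using that insert.hyps by (auto simp: w_def)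
    have "0 < (\<Sum>i\<in>insert x I. \<Sum>j\<in>insert x I. G i j * w i * w j)"
      using v w by (intro insert.prems(2)) auto
    also have "\<dots> = G x x * (w x)\<^sup>2 + 2 * w x * s + (\<Sum>i\<in>I. \<Sum>j\<in>I. G i j * v i * v j)"
      unfolding split s_def using w by (simp cong: sum.cong)
    also have "\<dots> = (\<Sum>i\<in>I. \<Sum>j\<in>I. G i j * v i * v j) - s * s / G x x"
      using Gxx by (simp add: w_def field_simps power2_eq_square)
    also have "s * s / G x x = (\<Sum>i\<in>I. \<Sum>j\<in>I. G x i * G x j / G x x * v i * v j)"
      unfolding s_def sum_product sum_divide_distrib by (intro sum.cong refl) simp
    finally show ?thesis
      by (simp add: G'_def left_diff_distrib sum_subtractf)
  qed
  then obtain q where q: "\<And>i j. i \<in> I \<Longrightarrow> j \<in> I \<Longrightarrow> G' i j = (\<Sum>a\<in>I. q a i * q a j)"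
    using insert.IH[of G'] insert.prems(1) by (auto simp: G'_def mult.commute)
  \<comment> \<open>The new row reproduces all entries involving \<open>x\<close>; the old rows
    vanish at \<open>x\<close> and factor the Schur complement.\<close>
  define q' where "q' a i = (if a = x then G x i / sqrt (G x x) else if i = x then 0 else q a i)" for a i
  have "G i j = (\<Sum>a\<in>insert x I. q' a i * q' a j)" if ij: "i \<in> insert x I" "j \<in> insert x I" for i j
  proof -
    have "(\<Sum>a\<in>insert x I. q' a i * q' a j) = G x i * G x j / G x x + (\<Sum>a\<in>I. q' a i * q' a j)"
      using insert.hyps Gxx by (simp add: q'_def)
    also have "(\<Sum>a\<in>I. q' a i * q' a j) = (if i = x \<or> j = x then 0 else G' i j)"
    proof (cases "i = x \<or> j = x")
      case True
      then show ?thesis using insert.hyps by (auto simp: q'_def intro!: sum.neutral)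
    next
      case False
      then have "(\<Sum>a\<in>I. q' a i * q' a j) = (\<Sum>a\<in>I. q a i * q a j)"
        using insert.hyps by (intro sum.cong) (auto simp: q'_def)
      with False ij show ?thesis by (simp add: q)
    qed
    finally show ?thesis
      using Gxx insert.prems(1)[of i j] insert.prems(1)[of i x] ij by (auto simp: G'_def)
  qed
  then show ?case by blast
qed

lemma pos_def_invertible:
  fixes G :: "real^'k^'k"
  assumes "\<And>v. v \<noteq> 0 \<Longrightarrow> v \<bullet> (G *v v) > 0"
  shows "invertible G"
proof -
  have "v = 0" if "G *v v = 0" for v
    using assms[of v] that by (cases "v = 0") auto
  then show ?thesis
    using invertible_left_inverse matrix_left_invertible_ker by blast
qed

lemma pos_def_square_root:
  fixes G :: "real^'k^'k"
  assumes sym: "transpose G = G" and pos: "\<And>v. v \<noteq> 0 \<Longrightarrow> v \<bullet> (G *v v) > 0"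
  obtains Q :: "real^'k^'k" where "invertible Q" "G = transpose Q ** Q"
proof -
  have "\<exists>q. \<forall>i\<in>UNIV. \<forall>j\<in>UNIV. G $ i $ j = (\<Sum>a\<in>(UNIV :: 'k set). q a i * q a j)"
  proof (rule pos_def_Gram[of UNIV "\<lambda>i j. G $ i $ j"])
    show "G $ i $ j = G $ j $ i" for i j
      using sym by (metis transpose_def vec_lambda_beta)
    fix v :: "'k \<Rightarrow> real" assume "\<exists>i\<in>UNIV. v i \<noteq> 0"
    then have "vec_lambda v \<noteq> 0" by (auto simp: vec_eq_iff)
    from pos[OF this] show "(\<Sum>i\<in>UNIV. \<Sum>j\<in>UNIV. G $ i $ j * v i * v j) > 0"
      by (simp add: inner_vec_def matrix_vector_mult_def sum_distrib_left mult_ac)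
  qed simp
  then obtain q where q: "\<And>i j. G $ i $ j = (\<Sum>a\<in>(UNIV :: 'k set). q a i * q a j)" by blast
  define Q where "Q = (\<chi> a i. q a i)"
  have G: "G = transpose Q ** Q"
    by (simp add: vec_eq_iff matrix_matrix_mult_def transpose_def Q_def q)
  moreover have "invertible Q"
    using pos_def_invertible[OF pos] unfolding invertible_det_nz G by (simp add: det_mul)
  ultimately show thesis by (rule that[rotated])
qed

lemma trace_transpose_mult: "trace (transpose A ** B) = (\<Sum>i\<in>UNIV. \<Sum>j\<in>UNIV. A $ i $ j * B $ i $ j)"
  for A B :: "real^'k^'k"
  unfolding trace_def matrix_matrix_mult_def transpose_def vec_lambda_beta by (rule sum.swap)

text \<open>With \<open>G = transpose Q ** Q\<close>, the matrix \<open>X\<close> holds the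
  components of \<open>T\<close> in an orthonormal frame and the tensor norm is its Frobenius norm.
  The claim is Cauchy-Schwarz for \<open>T = transpose Q ** X ** Q\<close>, since the columns of
  \<open>Q\<close> have squared lengths \<open>G $ i $ i\<close>.\<close>

lemma component_le_tensor_norm:
  fixes G T :: "real^'k^'k"
  assumes sym: "transpose G = G" and pos: "\<And>v. v \<noteq> 0 \<Longrightarrow> v \<bullet> (G *v v) > 0"
  shows "\<bar>T $ i $ j\<bar> \<le> sqrt (G $ i $ i * G $ j $ j) * tensor_norm G T"
proof -
  obtain Q :: "real^'k^'k" where Q: "invertible Q" "G = transpose Q ** Q"
    by (rule pos_def_square_root[OF sym pos])
  define S where "S = matrix_inv Q"
  have SQ: "Q ** S = mat 1" "S ** Q = mat 1"
    by (simp_all add: S_def matrix_inv_left matrix_inv_right Q(1))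
  have SQ': "transpose S ** transpose Q = mat 1" "transpose Q ** transpose S = mat 1"
    using arg_cong[OF SQ(1), of transpose] arg_cong[OF SQ(2), of transpose] by (simp_all add: matrix_transpose_mul)
  define X where "X = transpose S ** T ** S"
  define P where "P = S ** transpose S"
  have "G ** P = transpose Q ** (Q ** S) ** transpose S"
    by (simp add: Q P_def matrix_mul_assoc)
  then have P: "matrix_inv G = P"
    by (intro matrix_inv_unique_left) (simp add: SQ SQ')
  have P_sym: "P $ k $ l = P $ l $ k" for k l
    by (simp add: P_def matrix_matrix_mult_def transpose_def mult.commute)
  have "(\<Sum>i\<in>UNIV. \<Sum>j\<in>UNIV. \<Sum>k\<in>UNIV. \<Sum>l\<in>UNIV. P $ i $ k * P $ j $ l * T $ i $ j * T $ k $ l) =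
    (\<Sum>i\<in>UNIV. \<Sum>j\<in>UNIV. T $ i $ j * (P ** T ** P) $ i $ j)"
  proof (intro sum.cong refl)
    fix i j
    have "(P ** T ** P) $ i $ j = (\<Sum>k\<in>UNIV. \<Sum>l\<in>UNIV. P $ i $ k * T $ k $ l * P $ l $ j)"
      unfolding matrix_matrix_mult_def vec_lambda_beta sum_distrib_right by (rule sum.swap)
    then show "(\<Sum>k\<in>UNIV. \<Sum>l\<in>UNIV. P $ i $ k * P $ j $ l * T $ i $ j * T $ k $ l) = T $ i $ j * (P ** T ** P) $ i $ j"
      by (simp add: sum_distrib_left P_sym[of j] mult_ac)
  qed
  also have "\<dots> = trace (transpose T ** (P ** T ** P))"
    by (simp add: trace_transpose_mult)
  also have "\<dots> = trace ((transpose T ** S ** transpose S ** T ** S) ** transpose S)"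
    by (simp add: P_def matrix_mul_assoc)
  also have "\<dots> = trace (transpose S ** (transpose T ** S ** transpose S ** T ** S))"
    by (rule trace_mul_sym)
  also have "\<dots> = trace (transpose X ** X)"
    by (simp add: X_def matrix_transpose_mul matrix_mul_assoc)
  also have "\<dots> = (\<Sum>a\<in>UNIV. \<Sum>b\<in>UNIV. (X $ a $ b)\<^sup>2)"
    by (simp add: trace_transpose_mult power2_eq_square)
  finally have norm: "tensor_norm G T = sqrt (\<Sum>a\<in>UNIV. \<Sum>b\<in>UNIV. (X $ a $ b)\<^sup>2)"
    by (simp add: tensor_norm_def P)
  have "transpose Q ** X ** Q = (transpose Q ** transpose S) ** T ** (S ** Q)"
    by (simp only: X_def matrix_mul_assoc)
  then have T: "T = transpose Q ** X ** Q"
    by (simp add: SQ SQ')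
  have "T $ i $ j = (\<Sum>a\<in>UNIV. \<Sum>b\<in>UNIV. Q $ a $ i * Q $ b $ j * X $ a $ b)"
    unfolding T matrix_matrix_mult_def transpose_def vec_lambda_beta sum_distrib_right
    by (subst sum.swap) (simp add: mult_ac)
  also have "\<dots> = (\<Sum>p\<in>UNIV \<times> UNIV. (Q $ fst p $ i * Q $ snd p $ j) * X $ fst p $ snd p)"
    by (simp add: sum.cartesian_product case_prod_unfold)
  finally have "(T $ i $ j)\<^sup>2 \<le> (\<Sum>p\<in>UNIV \<times> UNIV. (Q $ fst p $ i * Q $ snd p $ j)\<^sup>2) * (\<Sum>p\<in>UNIV \<times> UNIV. (X $ fst p $ snd p)\<^sup>2)"
    using Cauchy_Schwarz_ineq_sum[of "\<lambda>p. Q $ fst p $ i * Q $ snd p $ j" "\<lambda>p. X $ fst p $ snd p" "UNIV \<times> UNIV"] by simp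
  also have "(\<Sum>p\<in>UNIV \<times> UNIV. (Q $ fst p $ i * Q $ snd p $ j)\<^sup>2) = G $ i $ i * G $ j $ j"
    by (simp add: Q(2) matrix_matrix_mult_def transpose_def sum_product sum.cartesian_product case_prod_unfold
        power2_eq_square mult_ac)
  also have "(\<Sum>p\<in>UNIV \<times> UNIV. (X $ fst p $ snd p)\<^sup>2) = (\<Sum>a\<in>UNIV. \<Sum>b\<in>UNIV. (X $ a $ b)\<^sup>2)"
    by (simp add: sum.cartesian_product case_prod_unfold)
  finally have "sqrt ((T $ i $ j)\<^sup>2) \<le> sqrt (G $ i $ i * G $ j $ j * (\<Sum>a\<in>UNIV. \<Sum>b\<in>UNIV. (X $ a $ b)\<^sup>2))"
    by (rule real_sqrt_le_mono)
  then show ?thesis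
    by (simp add: norm real_sqrt_mult)
qed


section \<open>Collar coordinates\<close>

lemma christoffel_cong_open:
  assumes U: "open U" "z \<in> U" "\<And>w. w \<in> U \<Longrightarrow> G w = G' w"
  shows "christoffel G k i j z = christoffel G' k i j z"
proof -
  have "partial m (\<lambda>w. G w $ a $ b) z = partial m (\<lambda>w. G' w $ a $ b) z" for m a b
    by (rule partial_cong_open[OF U(1,2)]) (simp add: U)
  then show ?thesis
    by (simp add: christoffel_def U)
qed

lemma einstein_defect_coord_cong_open:
  assumes U: "open U" "z \<in> U" "\<And>w. w \<in> U \<Longrightarrow> G w = G' w"
  shows "einstein_defect_coord G z = einstein_defect_coord G' z"
proof -
  note ch = christoffel_cong_open[OF U(1) _ U(3)]
  have "partial m (christoffel G k i j) z = partial m (christoffel G' k i j) z" for m k i j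
    by (rule partial_cong_open[OF U(1,2)]) (rule ch)
  then show ?thesis
    by (simp add: einstein_defect_coord_def ricci_def ch[OF U(2)] U)
qed

section \<open>Height and tangential part as coordinates\<close>

definition at_height :: "real \<Rightarrow> real^'b \<Rightarrow> real^('b::finite option)" where
  "at_height s y = (\<chi> k. case k of None \<Rightarrow> s | Some i \<Rightarrow> y $ i)"

lemma at_height_simps [simp]: "at_height s y $ None = s" "tangential (at_height s y) = y"
  by (simp_all add: at_height_def tangential_def vec_eq_iff)

lemma at_height_eq [simp]: "at_height (z $ None) (tangential z) = z"
  by (simp add: at_height_def tangential_def vec_eq_iff split: option.split)

lemma bounded_linear_tangential: "bounded_linear (tangential :: real^('b::finite option) \<Rightarrow> real^'b)"
proof -
  have "linear (tangential :: real^('b option) \<Rightarrow> real^'b)"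
    by (auto simp: linear_iff tangential_def vec_eq_iff)
  then show ?thesis by (simp add: linear_conv_bounded_linear)
qed

lemma continuous_at_height: "continuous_on S (at_height s :: real^'a \<Rightarrow> real^('a::finite option))"
proof -
  have "continuous_on S (\<lambda>y. case i of None \<Rightarrow> s | Some j \<Rightarrow> y $ j)" for i :: "'a option" and S :: "(real^'a) set"
    by (cases i) (auto intro!: continuous_intros)
  then show ?thesis
    unfolding at_height_def by (intro continuous_on_vec_lambda)
qed

lemma line_at_height: "line (at_height s y) t = at_height (s + t) y"
  by (simp add: at_height_def vec_eq_iff axis_def split: option.split)

text \<open>One metric in normal form, seen over one boundary chart. Two instances with the same
  \<open>A\<close>, \<open>h\<close> and \<open>c\<close> are compared later; collar, defining
  function and family may differ.\<close>

locale collar_coordinates =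
  fixes A :: "('m::t2_space, 'b::finite option) chart set"
    and g :: "('m, 'b option) tensor2" and h :: "('m, 'b) tensor2"
    and x :: "'m \<Rightarrow> real" and \<epsilon> :: real and \<pi> :: "'m \<Rightarrow> 'm" and ghat :: "real \<Rightarrow> ('m, 'b) tensor2"
    and c :: "('m, 'b) chart"
  assumes A: "smooth_structure A"
    and APE: "APE A g"
    and x: "boundary_defining A x"
    and nf: "normal_form A g h x \<epsilon> \<pi> ghat"
    and c: "c \<in> bdry_atlas A"
begin

abbreviation "C \<equiv> collar_chart x \<epsilon> \<pi> c"
abbreviation "V \<equiv> snd c ` fst c"

lemma eps: "0 < \<epsilon>" and bij: "bij_betw (\<lambda>p. (x p, \<pi> p)) {p. x p < \<epsilon>} ({0..<\<epsilon>} \<times> bdry A)"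
  and pi_bdry: "q \<in> bdry A \<Longrightarrow> \<pi> q = q" and C: "C \<in> A"
  using nf c by (auto simp: normal_form_def collar_def)

lemma c_bdry: "fst c \<subseteq> bdry A"
  using c by (auto simp: bdry_atlas_def bdry_chart_def)

lemma x_bdry: "p \<in> bdry A \<Longrightarrow> x p = 0" and x_bulk: "p \<in> bulk A \<Longrightarrow> 0 < x p"
  using x by (auto simp: boundary_defining_def)

lemma fst_C: "fst C = {p. x p < \<epsilon> \<and> \<pi> p \<in> fst c}"
  and snd_C: "snd C p = at_height (x p) (snd c (\<pi> p))"
  by (simp_all add: collar_chart_def at_height_def)

lemma chart_C: "open (fst C)" "openin (top_of_set half_space) (snd C ` fst C)"
    "\<exists>\<psi>. homeomorphism (fst C) (snd C ` fst C) (snd C) \<psi>"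
  using A C by (auto simp: smooth_structure_def is_chart_def)

lemma inj_C: "inj_on (snd C) (fst C)"
  using chart_C(3) by (metis homeomorphism_apply1 inj_on_inverseI)

lemma mem_C: "q \<in> fst c \<Longrightarrow> q \<in> fst C" and snd_C_bdry: "q \<in> fst c \<Longrightarrow> snd C q = at_height 0 (snd c q)"
  using c_bdry x_bdry pi_bdry eps by (auto simp: fst_C snd_C)

lemma inj_c: "inj_on (snd c) (fst c)"
proof (rule inj_onI)
  fix p q assume "p \<in> fst c" "q \<in> fst c" "snd c p = snd c q"
  then show "p = q"
    by (intro inj_onD[OF inj_C]) (simp_all add: mem_C snd_C_bdry)
qed

text \<open>Surjectivity of the collar map onto \<open>{0..<\<epsilon>} \<times> bdry A\<close>
  supplies the preimages; heights are nonnegative because \<open>x\<close> is a boundary defining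
  function.\<close>

lemma image_C: "snd C ` fst C = {z. 0 \<le> z $ None \<and> z $ None < \<epsilon> \<and> tangential z \<in> V}"
proof (intro equalityI subsetI)
  fix z assume "z \<in> snd C ` fst C"
  then obtain p where p: "p \<in> fst C" "z = snd C p" by auto
  have "x p \<ge> 0" using x_bdry[of p] x_bulk[of p] by (cases "p \<in> bdry A") auto
  with p show "z \<in> {z. 0 \<le> z $ None \<and> z $ None < \<epsilon> \<and> tangential z \<in> V}"
    by (auto simp: fst_C snd_C)
next
  fix z assume z: "z \<in> {z. 0 \<le> z $ None \<and> z $ None < \<epsilon> \<and> tangential z \<in> V}"
  then obtain q where q: "q \<in> fst c" "tangential z = snd c q" by auto
  have "(z $ None, q) \<in> (\<lambda>p. (x p, \<pi> p)) ` {p. x p < \<epsilon>}"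
    using z q(1) c_bdry bij by (auto simp: bij_betw_def)
  then obtain p where p: "x p < \<epsilon>" "x p = z $ None" "\<pi> p = q" by auto
  then have "snd C p = z" "p \<in> fst C"
    using q by (auto simp: snd_C fst_C simp flip: q(2))
  then show "z \<in> snd C ` fst C" by auto
qed

text \<open>Reading this off from the collar chart avoids proving that chart changes preserve the boundary.\<close>

lemma open_V: "open V"
proof -
  obtain T where T: "open T" "snd C ` fst C = half_space \<inter> T"
    using chart_C(2) by (auto simp: openin_open)
  have "y \<in> V \<longleftrightarrow> at_height 0 y \<in> T" for y
  proof -
    have "y \<in> V \<longleftrightarrow> at_height 0 y \<in> snd C ` fst C"
      unfolding image_C using eps by simp
    also have "\<dots> \<longleftrightarrow> at_height 0 y \<in> T"
      unfolding T(2) by (simp add: half_space_def)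
    finally show ?thesis .
  qed
  then have "V = at_height 0 -` T" by auto
  then show ?thesis
    using open_vimage[OF T(1) continuous_at_height] by simp
qed

lemma chart_inv_C:
  assumes "z \<in> snd C ` fst C"
  shows "chart_inv C z \<in> fst C" "snd C (chart_inv C z) = z" "x (chart_inv C z) = z $ None"
    "\<pi> (chart_inv C z) = chart_inv c (tangential z)"
proof -
  show 1: "chart_inv C z \<in> fst C" and 2: "snd C (chart_inv C z) = z"
    using assms by (auto intro: inv_into_into f_inv_into_f)
  show "x (chart_inv C z) = z $ None"
    using arg_cong[OF 2, of "\<lambda>z. z $ None"] by (simp add: snd_C)
  have "snd c (\<pi> (chart_inv C z)) = tangential z"
    using arg_cong[OF 2, of tangential] by (simp add: snd_C)
  moreover have "\<pi> (chart_inv C z) \<in> fst c"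
    using 1 by (simp add: fst_C)
  ultimately show "\<pi> (chart_inv C z) = chart_inv c (tangential z)"
    by (metis inj_c inv_into_f_f)
qed

lemma bulk_chart_inv_C: "z \<in> snd C ` fst C \<Longrightarrow> 0 < z $ None \<Longrightarrow> chart_inv C z \<in> bulk A"
  using chart_inv_C(3)[of z] x_bdry[of "chart_inv C z"] by auto

definition "gcoord z = ghat (z $ None) c (chart_inv c (tangential z))"

lemma g_C:
  assumes "z \<in> snd C ` fst C" "0 < z $ None"
  shows "g C (chart_inv C z) = collar_matrix (z $ None) (gcoord z)"
  using nf c chart_inv_C[OF assms(1)] bulk_chart_inv_C[OF assms]
  unfolding normal_form_def gcoord_def by auto

lemma gcoord_metric:
  assumes "z \<in> snd C ` fst C"
  shows "transpose (gcoord z) = gcoord z" "v \<noteq> 0 \<Longrightarrow> v \<bullet> (gcoord z *v v) > 0"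
proof -
  have s: "z $ None \<in> {0..<\<epsilon>}" and q: "chart_inv c (tangential z) \<in> fst c \<inter> bdry A"
    using assms c_bdry inv_into_into[of "tangential z" "snd c" "fst c"] unfolding image_C by auto
  then have "riemannian_metric (bdry_atlas A) (bdry A) (ghat (z $ None))"
    using nf by (simp add: normal_form_def)
  then show "transpose (gcoord z) = gcoord z" "v \<noteq> 0 \<Longrightarrow> v \<bullet> (gcoord z *v v) > 0"
    using c q unfolding riemannian_metric_def smooth_sym_tensor_def gcoord_def by blast+
qed

lemma gcoord_bdry:
  assumes "q \<in> fst c"
  shows "gcoord (at_height s (snd c q)) = ghat s c q" "gcoord (at_height 0 (snd c q)) = h c q"
  using assms nf c inj_c by (auto simp: gcoord_def normal_form_def)

text \<open>At positive height the defect depends only on an open neighbourhood inside the collar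
  image, where the extension \<open>F\<close> coincides with the metric coefficients. Thus the
  behaviour of \<open>F\<close> at negative height does not enter.\<close>

lemma einstein_C:
  assumes "z \<in> snd C ` fst C" "0 < z $ None"
    and U: "open U" "z \<in> U" "\<And>w. w \<in> U \<Longrightarrow> w \<in> snd C ` fst C \<Longrightarrow> F w = gcoord w"
  shows "einstein_defect g C (chart_inv C z) = einstein_defect_coord (\<lambda>z. collar_matrix (z $ None) (F z)) z"
proof -
  define U' where "U' = U \<inter> {z. 0 < z $ None} \<inter> {z. z $ None < \<epsilon>} \<inter> tangential -` V"
  have "open U'"
    unfolding U'_def
    by (intro open_Int U open_Collect_less continuous_intros open_vimage open_V
        linear_continuous_on bounded_linear_tangential)
  moreover have "z \<in> U'"
    using assms unfolding image_C U'_def by auto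
  moreover have "g C (chart_inv C w) = collar_matrix (w $ None) (F w)" if "w \<in> U'" for w
  proof -
    have "w \<in> snd C ` fst C" "0 < w $ None" "w \<in> U"
      using that unfolding U'_def image_C by auto
    then show ?thesis by (simp add: g_C U)
  qed
  ultimately show ?thesis
    unfolding einstein_defect_def chart_inv_C(2)[OF assms(1)] by (rule einstein_defect_coord_cong_open)
qed

text \<open>This transports the estimate in \<open>APE\<close>, stated for points of the bulk near
  \<open>q\<close>, to the normal line over \<open>q\<close>. The inverse chart is continuous, and
  points of positive height lie in the bulk and so differ from \<open>q\<close>.\<close>

lemma tendsto_chart_inv_C:
  assumes q: "q \<in> fst c"
  shows "filterlim (\<lambda>s. chart_inv C (at_height s (snd c q))) (at q within bulk A) (at_right 0)"
proof -
  obtain \<psi> where \<psi>: "homeomorphism (fst C) (snd C ` fst C) (snd C) \<psi>"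
    using chart_C(3) by blast
  have psi: "chart_inv C z = \<psi> z" if "z \<in> snd C ` fst C" for z
    using chart_inv_C(1,2)[OF that] homeomorphism_apply1[OF \<psi>] by metis
  have im: "at_height s (snd c q) \<in> snd C ` fst C" if "0 \<le> s" "s < \<epsilon>" for s
    using that q unfolding image_C by auto
  have ev: "eventually (\<lambda>s. s < \<epsilon>) (at_right 0)"
    using eps eventually_at_right_field by blast
  have "((\<lambda>s. line (at_height 0 (snd c q)) s) \<longlongrightarrow> at_height 0 (snd c q)) (at_right 0)"
    by (rule tendsto_eq_intros refl | simp)+
  then have "((\<lambda>s. at_height s (snd c q)) \<longlongrightarrow> at_height 0 (snd c q)) (at_right 0)"
    by (simp add: line_at_height)
  moreover have "eventually (\<lambda>s. at_height s (snd c q) \<in> snd C ` fst C) (at_right 0)"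
    using ev eventually_at_right_less[of 0] by eventually_elim (simp add: im)
  ultimately have "((\<lambda>s. \<psi> (at_height s (snd c q))) \<longlongrightarrow> \<psi> (at_height 0 (snd c q))) (at_right 0)"
    using \<psi> im[of 0] eps by (intro continuous_on_tendsto_compose[of "snd C ` fst C" \<psi>]) (auto simp: homeomorphism_def)
  moreover have "\<psi> (at_height 0 (snd c q)) = q"
    using homeomorphism_apply1[OF \<psi> mem_C[OF q]] snd_C_bdry[OF q] by simp
  moreover have "eventually (\<lambda>s. \<psi> (at_height s (snd c q)) = chart_inv C (at_height s (snd c q))) (at_right 0)"
    using ev eventually_at_right_less[of 0] by eventually_elim (simp add: im psi)
  ultimately have "((\<lambda>s. chart_inv C (at_height s (snd c q))) \<longlongrightarrow> q) (at_right 0)"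
    using tendsto_cong by force
  moreover have "eventually (\<lambda>s. chart_inv C (at_height s (snd c q)) \<in> bulk A \<and> chart_inv C (at_height s (snd c q)) \<noteq> q) (at_right 0)"
    using ev eventually_at_right_less[of 0]
  proof eventually_elim
    case (elim s)
    then have "chart_inv C (at_height s (snd c q)) \<in> bulk A"
      by (intro bulk_chart_inv_C im) auto
    then show ?case using q c_bdry by auto
  qed
  ultimately show ?thesis
    by (simp add: filterlim_at)
qed

text \<open>The function \<open>x0\<close> that \<open>APE\<close> provides may differ from the
  special one. It is smooth and vanishes at height 0, so its quotient by the height tends to its
  normal derivative, and powers of \<open>x0\<close> are bounded by powers of
  \<open>s\<close>.\<close>

lemma defining_function_linear:
  assumes x0: "boundary_defining A x0" and q: "q \<in> fst c"
  obtains D where "((\<lambda>s. x0 (chart_inv C (at_height s (snd c q))) / s) \<longlongrightarrow> D) (at_right 0)"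
proof -
  let ?z = "at_height 0 (snd c q)"
  have line: "at_height s (snd c q) = line ?z s" for s
    by (simp add: line_at_height)
  have z: "?z \<in> snd C ` fst C" 
    using q eps unfolding image_C by auto
  have "smooth_on (snd C ` fst C) (x0 \<circ> chart_inv C)"
    using x0 C by (auto simp: boundary_defining_def smooth_fun_def)
  then obtain W \<Phi> where W: "open W" "?z \<in> W" "Cinf_on W \<Phi>"
    "\<And>w. w \<in> W \<inter> snd C ` fst C \<Longrightarrow> \<Phi> w = x0 (chart_inv C w)"
    using z by (force simp: smooth_on_def)
  have "\<Phi> ?z = 0"
  proof -
    have "chart_inv C ?z = q"
      using inj_C mem_C[OF q] snd_C_bdry[OF q] by (metis inv_into_f_f)
    then show ?thesis
      using W(4)[of ?z] W(2) z x0 q c_bdry by (auto simp: boundary_defining_def)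
  qed
  moreover have "((\<lambda>s. \<Phi> (line ?z s)) has_real_derivative partial None \<Phi> ?z) (at 0)"
    using partial_line[of \<Phi> ?z 0 None] Cinf_on_differentiable[OF W(3,2)] by simp
  ultimately have "((\<lambda>s. \<Phi> (line ?z s) / s) \<longlongrightarrow> partial None \<Phi> ?z) (at 0)"
    by (simp add: has_field_derivative_iff)
  then have "((\<lambda>s. \<Phi> (line ?z s) / s) \<longlongrightarrow> partial None \<Phi> ?z) (at_right 0)"
    by (rule filterlim_mono) (auto simp: at_le)
  moreover have "eventually (\<lambda>s. s < \<epsilon>) (at_right 0)"
    using eps eventually_at_right_field by blast
  then have "eventually (\<lambda>s. \<Phi> (line ?z s) / s = x0 (chart_inv C (at_height s (snd c q))) / s) (at_right 0)"
    using eventually_line[OF W(1,2)] eventually_at_right_less[of 0]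
  proof eventually_elim
    case (elim s)
    then have "line ?z s \<in> W \<inter> snd C ` fst C"
      unfolding line[symmetric] image_C using q by auto
    then show ?case
      using W(4)[of "line ?z s"] by (simp add: line_at_height)
  qed
  ultimately have "((\<lambda>s. x0 (chart_inv C (at_height s (snd c q))) / s) \<longlongrightarrow> partial None \<Phi> ?z) (at_right 0)"
    by (rule Lim_transform_eventually)
  then show thesis by (rule that)
qed

text \<open>Power counting: \<open>g $ Some i $ Some i = F $ i $ i / s^2\<close>, so a tangential
  component of the defect is at most a bounded factor times \<open>s^-2 * s^n\<close>. After
  multiplication by \<open>s^2 / s^d\<close> one factor \<open>s\<close> is left, since n = d +
  1.\<close>

lemma einstein_decay:
  assumes q: "q \<in> fst c" and U: "open U" "at_height 0 (snd c q) \<in> U"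
    and F: "\<And>w. w \<in> U \<Longrightarrow> w \<in> snd C ` fst C \<Longrightarrow> F w = gcoord w"
    and cont: "\<And>a. ((\<lambda>s. F (at_height s (snd c q)) $ a $ a) \<longlongrightarrow> L a) (at_right 0)"
  shows "((\<lambda>s. s\<^sup>2 * einstein_defect_coord (\<lambda>z. collar_matrix (z $ None) (F z)) (at_height s (snd c q)) $ Some i $ Some j
     / s ^ CARD('b)) \<longlongrightarrow> 0) (at_right 0)"
proof -
  let ?z = "\<lambda>s. at_height s (snd c q)" and ?p = "\<lambda>s. chart_inv C (at_height s (snd c q))"
  define E where "E s = einstein_defect_coord (\<lambda>z. collar_matrix (z $ None) (F z)) (?z s)" for s
  have line: "?z s = line (?z 0) s" for s
    by (simp add: line_at_height)
  obtain x0 where x0: "boundary_defining A x0"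
    and O: "(\<lambda>p. tensor_norm (g C p) (einstein_defect g C p)) \<in> O[at q within bulk A](\<lambda>p. x0 p ^ CARD('b option))"
    using APE C mem_C[OF q] q c_bdry unfolding APE_def by blast
  obtain D where D: "((\<lambda>s. x0 (?p s) / s) \<longlongrightarrow> D) (at_right 0)"
    using defining_function_linear[OF x0 q] .
  from O obtain K where K: "eventually (\<lambda>p. norm (tensor_norm (g C p) (einstein_defect g C p)) \<le> K * norm (x0 p ^ CARD('b option))) (at q within bulk A)"
    by (elim landau_o.bigE)
  have "eventually (\<lambda>s. norm (tensor_norm (g C (?p s)) (einstein_defect g C (?p s))) \<le> K * norm (x0 (?p s) ^ CARD('b option))) (at_right 0)"
    using K tendsto_chart_inv_C[OF q] by (rule eventually_compose_filterlim)
  moreover have "eventually (\<lambda>s. s < \<epsilon>) (at_right 0)"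
    using eps eventually_at_right_field by blast
  moreover have "eventually (\<lambda>s. ?z s \<in> U) (at_right 0)"
    using eventually_line[OF U] by (simp add: line[symmetric])
  ultimately have bound: "eventually (\<lambda>s. norm (s\<^sup>2 * E s $ Some i $ Some j / s ^ CARD('b)) \<le>
     sqrt (F (?z s) $ i $ i * F (?z s) $ j $ j) * (K * \<bar>x0 (?p s) / s\<bar> ^ CARD('b option)) * s) (at_right 0)"
    using eventually_at_right_less[of 0]
  proof eventually_elim
    case (elim s)
    have z: "?z s \<in> snd C ` fst C" "0 < ?z s $ None"
      unfolding image_C using elim q by auto
    have E: "einstein_defect g C (?p s) = E s"
      unfolding E_def by (rule einstein_C[OF z U(1) elim(3) F])
    have G: "g C (?p s) = collar_matrix s (F (?z s))"
      using g_C[OF z] F[OF elim(3) z(1)] by simp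
    have "riemannian_metric A (bulk A) g"
      using APE by (simp add: APE_def asymptotically_hyperbolic_def)
    moreover have "?p s \<in> fst C \<inter> bulk A"
      using chart_inv_C(1)[OF z(1)] bulk_chart_inv_C[OF z] by blast
    ultimately have "transpose (g C (?p s)) = g C (?p s)" "\<And>v. v \<noteq> 0 \<Longrightarrow> v \<bullet> (g C (?p s) *v v) > 0"
      using C unfolding riemannian_metric_def smooth_sym_tensor_def by blast+
    then have "\<bar>E s $ Some i $ Some j\<bar> \<le> sqrt (g C (?p s) $ Some i $ Some i * g C (?p s) $ Some j $ Some j)
       * tensor_norm (g C (?p s)) (E s)"
      by (rule component_le_tensor_norm)
    also have "sqrt (g C (?p s) $ Some i $ Some i * g C (?p s) $ Some j $ Some j) =
        sqrt (F (?z s) $ i $ i * F (?z s) $ j $ j) / s\<^sup>2"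
    proof -
      have "a / s\<^sup>2 * (b / s\<^sup>2) = a * b / (s\<^sup>2)\<^sup>2" for a b
        by (simp add: power2_eq_square)
      then have "sqrt (a / s\<^sup>2 * (b / s\<^sup>2)) = sqrt (a * b) / s\<^sup>2" for a b
        by (simp only: real_sqrt_divide real_sqrt_abs abs_power2)
      then show ?thesis
        unfolding G collar_matrix_component .
    qed
    also have "\<dots> * tensor_norm (g C (?p s)) (E s) \<le>
        sqrt (F (?z s) $ i $ i * F (?z s) $ j $ j) / s\<^sup>2 * (K * \<bar>x0 (?p s)\<bar> ^ CARD('b option))"
    proof (rule mult_left_mono)
      show "tensor_norm (g C (?p s)) (E s) \<le> K * \<bar>x0 (?p s)\<bar> ^ CARD('b option)"
        using elim(1) unfolding E real_norm_def power_abs by linarith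
      have "F (?z s) $ a $ a \<ge> 0" for a
        using gcoord_metric(2)[OF z(1), of "axis a 1"] F[OF elim(3) z(1)]
        by (simp add: matrix_vector_mult_basis column_def inner_axis' axis_eq_0_iff)
      then show "0 \<le> sqrt (F (?z s) $ i $ i * F (?z s) $ j $ j) / s\<^sup>2" by simp
    qed
    finally have *: "\<bar>E s $ Some i $ Some j\<bar> \<le>
        sqrt (F (?z s) $ i $ i * F (?z s) $ j $ j) / s\<^sup>2 * (K * \<bar>x0 (?p s)\<bar> ^ CARD('b option))" .
    have "norm (s\<^sup>2 * E s $ Some i $ Some j / s ^ CARD('b)) = s\<^sup>2 / s ^ CARD('b) * \<bar>E s $ Some i $ Some j\<bar>"
      using elim by (simp add: abs_mult power_abs)
    also have "\<dots> \<le> s\<^sup>2 / s ^ CARD('b) * (sqrt (F (?z s) $ i $ i * F (?z s) $ j $ j) / s\<^sup>2 * (K * \<bar>x0 (?p s)\<bar> ^ CARD('b option)))"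
      using elim * by (intro mult_left_mono) auto
    also have "\<dots> = sqrt (F (?z s) $ i $ i * F (?z s) $ j $ j) * (K * \<bar>x0 (?p s) / s\<bar> ^ CARD('b option)) * s"
      using elim by (simp add: power_divide field_simps card_UNIV_option)
    finally show ?case .
  qed
  have "((\<lambda>s. sqrt (F (?z s) $ i $ i * F (?z s) $ j $ j) * (K * \<bar>x0 (?p s) / s\<bar> ^ CARD('b option)) * s)
      \<longlongrightarrow> sqrt (L i * L j) * (K * \<bar>D\<bar> ^ CARD('b option)) * 0) (at_right 0)"
    by (intro tendsto_intros cont D tendsto_rabs)
  then have "((\<lambda>s. sqrt (F (?z s) $ i $ i * F (?z s) $ j $ j) * (K * \<bar>x0 (?p s) / s\<bar> ^ CARD('b option)) * s)
      \<longlongrightarrow> 0) (at_right 0)"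
    by simp
  from Lim_null_comparison[OF bound this] show ?thesis
    unfolding E_def .
qed

text \<open>Smoothness up to height 0 means local extendability, so the extension exists only near a
  given boundary point. The decay is asserted at all boundary points of \<open>U\<close>, as the
  vanishing argument differentiates along the boundary.\<close>

lemma local_collar_metric:
  assumes q0: "q0 \<in> fst c"
  obtains U F where "collar_metric U F" "at_height 0 (snd c q0) \<in> U"
    "\<And>z. z \<in> U \<Longrightarrow> 0 \<le> z $ None \<Longrightarrow> tangential z \<in> V \<and> F z = gcoord z"
    "\<And>i j z. z \<in> U \<Longrightarrow> z $ None = 0 \<Longrightarrow>
       ((\<lambda>s. s\<^sup>2 * einstein_defect_coord (\<lambda>z. collar_matrix (z $ None) (F z)) (line z s) $ Some i $ Some j / s ^ CARD('b))
          \<longlongrightarrow> 0) (at_right 0)"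
proof -
  let ?L = "\<lambda>z :: real^('b option). (z $ None, tangential z)"
  have L: "bounded_linear ?L"
    by (intro bounded_linear_Pair bounded_linear_vec_nth bounded_linear_tangential)
  have "smooth_on ({0..<\<epsilon>} \<times> V) (\<lambda>(s, y). ghat s c (chart_inv c y))"
    using nf c by (simp add: normal_form_def)
  moreover have "(0, snd c q0) \<in> {0..<\<epsilon>} \<times> V"
    using eps q0 by auto
  ultimately obtain W \<Phi> where W: "open W" "(0, snd c q0) \<in> W" "Cinf_on W \<Phi>"
    "\<And>s y. (s, y) \<in> W \<inter> {0..<\<epsilon>} \<times> V \<Longrightarrow> \<Phi> (s, y) = ghat s c (chart_inv c y)"
    unfolding smooth_on_def by (metis (no_types, lifting) case_prod_conv)
  \<comment> \<open>The restriction to heights below \<open>\<epsilon>\<close> and to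
    \<open>V\<close> puts every point of nonnegative height into the collar image, where the
    extension has prescribed values. Negative heights remain, so \<open>U\<close> is open.\<close>
  define U where "U = ?L -` (W \<inter> {..<\<epsilon>} \<times> V)"
  define F where "F z = \<Phi> (?L z)" for z
  have U: "open U"
    unfolding U_def by (intro open_vimage open_Int W open_Times open_V open_lessThan linear_continuous_on L)
  have F: "tangential z \<in> V" "F z = gcoord z" if "z \<in> U" "0 \<le> z $ None" for z
    using that W(4)[of "z $ None" "tangential z"] by (auto simp: U_def F_def gcoord_def)
  have im: "z \<in> snd C ` fst C" if "z \<in> U" "0 \<le> z $ None" for z
    using that unfolding image_C U_def by auto
  have smooth: "Cinf_on U (\<lambda>z. F z $ a $ b)" for a b
  proof
    fix k
    have "Ck_on k U F"
      unfolding F_def by (rule Ck_on_compose_linear[OF L W(1) U _ W(3)[rule_format]]) (auto simp: U_def)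
    then show "Ck_on k U (\<lambda>z. F z $ a $ b)"
      by (intro Ck_on_linear_compose[of "\<lambda>M. M $ a $ b"] U
          bounded_linear_compose[OF bounded_linear_vec_nth bounded_linear_vec_nth])
  qed
  have "collar_metric U F"
  proof
    show "invertible (F z)" if "z \<in> U" "0 \<le> z $ None" for z
      using gcoord_metric(2)[OF im[OF that]] F(2)[OF that] by (simp add: pos_def_invertible)
    show "F z $ b $ a = F z $ a $ b" if "z \<in> U" "0 \<le> z $ None" for z a b
      using gcoord_metric(1)[OF im[OF that]] F(2)[OF that] by (simp add: transpose_def vec_eq_iff)
  qed (use U smooth in auto)
  moreover have "at_height 0 (snd c q0) \<in> U"
    using W(2) eps q0 by (simp add: U_def)
  moreover have "((\<lambda>s. s\<^sup>2 * einstein_defect_coord (\<lambda>z. collar_matrix (z $ None) (F z)) (line z s) $ Some i $ Some j / s ^ CARD('b))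
          \<longlongrightarrow> 0) (at_right 0)" if z: "z \<in> U" "z $ None = 0" for z i j
  proof -
    obtain q where q: "q \<in> fst c" "tangential z = snd c q"
      using F(1)[OF z(1)] z(2) by auto
    have line: "at_height s (snd c q) = line z s" for s
      using z(2) by (simp add: q(2)[symmetric] at_height_def tangential_def vec_eq_iff axis_def split: option.split)
    have z': "at_height 0 (snd c q) \<in> U"
      using z line[of 0] by simp
    show ?thesis
      unfolding line[symmetric]
    proof (rule einstein_decay[OF q(1) U z'])
      show "F w = gcoord w" if "w \<in> U" "w \<in> snd C ` fst C" for w
        using that F(2) unfolding image_C by auto
      show "((\<lambda>s. F (at_height s (snd c q)) $ a $ a) \<longlongrightarrow> F z $ a $ a) (at_right 0)" for a
        unfolding line by (rule tendsto_line[OF U smooth z(1)])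
    qed
  qed
  ultimately show thesis
    using F by (intro that) auto
qed

end

section \<open>Comparison of volume densities and of anomalies\<close>

lemma collar_metric_subset:
  assumes "collar_metric U F" "open U'" "U' \<subseteq> U"
  shows "collar_metric U' F"
proof -
  interpret collar_metric U F by fact
  show ?thesis
    using assms(2,3) smooth inv sym Ck_on_subset[OF _ assms(3)] by unfold_locales blast+
qed

text \<open>The difference of roots is \<open>(u - v) / (sqrt u + sqrt v)\<close>, and the positive
  limit keeps the denominator away from 0.\<close>

lemma jet_sqrt:
  assumes "jet k u v l 0" "0 < l"
  shows "jet k (\<lambda>s. sqrt (u s)) (\<lambda>s. sqrt (v s)) (sqrt l) 0"
proof -
  have u: "(u \<longlongrightarrow> l) (at_right 0)" and v: "(v \<longlongrightarrow> l) (at_right 0)"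
    and d: "((\<lambda>s. (u s - v s) / s ^ k) \<longlongrightarrow> 0) (at_right 0)"
    using assms(1) by (auto simp: jet_def)
  have "((\<lambda>s. (u s - v s) / s ^ k / (sqrt (u s) + sqrt (v s))) \<longlongrightarrow> 0 / (sqrt l + sqrt l)) (at_right 0)"
    using assms(2) by (intro tendsto_intros u v d) auto
  moreover have "eventually (\<lambda>s. 0 < u s) (at_right 0)" "eventually (\<lambda>s. 0 < v s) (at_right 0)"
    using order_tendstoD(1)[OF u assms(2)] order_tendstoD(1)[OF v assms(2)] by auto
  then have "eventually (\<lambda>s. (u s - v s) / s ^ k / (sqrt (u s) + sqrt (v s)) = (sqrt (u s) - sqrt (v s)) / s ^ k) (at_right 0)"
  proof eventually_elim
    case (elim s)
    have "u s - v s = (sqrt (u s) - sqrt (v s)) * (sqrt (u s) + sqrt (v s))"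
      using elim by (simp add: algebra_simps)
    moreover have "sqrt (u s) + sqrt (v s) > 0"
      using elim by (intro add_pos_pos) auto
    ultimately show ?case by simp
  qed
  ultimately show ?thesis
    using u v by (auto simp: jet_def tendsto_cong intro: tendsto_real_sqrt)
qed

text \<open>Both families are matrix functions over the chart \<open>c\<close> with value
  \<open>h\<close> at height 0, so on a common neighbourhood they form a \<open>collar_pair\<close>,
  even though equal coordinates correspond to different points of the manifold.\<close>

lemma volume_density_unique:
  fixes c :: "('m::t2_space, 'b::finite) chart"
  assumes "collar_coordinates A g1 h x1 \<epsilon>1 \<pi>1 ghat1 c" "collar_coordinates A g2 h x2 \<epsilon>2 \<pi>2 ghat2 c"
    and q: "q \<in> fst c"
  shows "(\<lambda>s. sqrt (det (ghat1 s c q) / det (h c q)) - sqrt (det (ghat2 s c q) / det (h c q)))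
    \<in> o[at_right 0](\<lambda>s. s ^ CARD('b))"
proof -
  interpret G1: collar_coordinates A g1 h x1 \<epsilon>1 \<pi>1 ghat1 c by fact
  interpret G2: collar_coordinates A g2 h x2 \<epsilon>2 \<pi>2 ghat2 c by fact
  obtain U1 F1 where 1: "collar_metric U1 F1" "at_height 0 (snd c q) \<in> U1"
    "\<And>z. z \<in> U1 \<Longrightarrow> 0 \<le> z $ None \<Longrightarrow> tangential z \<in> G1.V \<and> F1 z = G1.gcoord z"
    "\<And>i j z. z \<in> U1 \<Longrightarrow> z $ None = 0 \<Longrightarrow>
       ((\<lambda>s. s\<^sup>2 * einstein_defect_coord (\<lambda>z. collar_matrix (z $ None) (F1 z)) (line z s) $ Some i $ Some j / s ^ CARD('b))
          \<longlongrightarrow> 0) (at_right 0)"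
    using G1.local_collar_metric[OF q] by blast
  obtain U2 F2 where 2: "collar_metric U2 F2" "at_height 0 (snd c q) \<in> U2"
    "\<And>z. z \<in> U2 \<Longrightarrow> 0 \<le> z $ None \<Longrightarrow> tangential z \<in> G2.V \<and> F2 z = G2.gcoord z"
    "\<And>i j z. z \<in> U2 \<Longrightarrow> z $ None = 0 \<Longrightarrow>
       ((\<lambda>s. s\<^sup>2 * einstein_defect_coord (\<lambda>z. collar_matrix (z $ None) (F2 z)) (line z s) $ Some i $ Some j / s ^ CARD('b))
          \<longlongrightarrow> 0) (at_right 0)"
    using G2.local_collar_metric[OF q] by blast
  define U where "U = U1 \<inter> U2"
  have U: "open U"
    using collar_metric.open_U[OF 1(1)] collar_metric.open_U[OF 2(1)] by (auto simp: U_def)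
  have agree: "F1 z = F2 z" if z: "z \<in> U" "z $ None = 0" for z
  proof -
    obtain q' where q': "q' \<in> fst c" "tangential z = snd c q'"
      using 1(3)[of z] z by (auto simp: U_def)
    have "z = at_height 0 (snd c q')"
      using at_height_eq[of z] z(2) q'(2) by simp
    then show ?thesis
      using 1(3)[of z] 2(3)[of z] z G1.gcoord_bdry(2)[OF q'(1)] G2.gcoord_bdry(2)[OF q'(1)] by (simp add: U_def)
  qed
  interpret collar_pair U F1 F2
    by (intro collar_pair.intro collar_pair_axioms.intro collar_metric_subset[OF 1(1) U]
        collar_metric_subset[OF 2(1) U] agree) (auto simp: U_def)
  let ?z = "at_height 0 (snd c q)"
  have z: "?z \<in> U" "?z $ None = 0"
    using 1(2) 2(2) by (auto simp: U_def)
  have line: "line ?z s = at_height s (snd c q)" for s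
    by (simp add: line_at_height)
  have F: "F1 (line ?z s) = ghat1 s c q" "F2 (line ?z s) = ghat2 s c q" if "line ?z s \<in> U" "0 < s" for s
    using 1(3)[of "line ?z s"] 2(3)[of "line ?z s"] that G1.gcoord_bdry(1)[OF q] G2.gcoord_bdry(1)[OF q]
    by (auto simp: U_def line)
  have "F1 ?z = h c q"
    using 1(2,3) G1.gcoord_bdry(2)[OF q] by simp
  moreover have "jet CARD('b) (\<lambda>s. det (F1 (line ?z s))) (\<lambda>s. det (F2 (line ?z s))) (det (F1 ?z)) 0"
    using z by (intro det_jet_top 1(4) 2(4)) (auto simp: U_def)
  ultimately have "jet CARD('b) (\<lambda>s. det (F1 (line ?z s))) (\<lambda>s. det (F2 (line ?z s))) (det (h c q)) 0"
    by simp
  then have "jet CARD('b) (\<lambda>s. det (ghat1 s c q)) (\<lambda>s. det (ghat2 s c q)) (det (h c q)) 0"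
  proof (rule jet_cong)
    show "\<forall>\<^sub>F s in at_right 0. det (F1 (line ?z s)) = det (ghat1 s c q)"
      using eventually_line[OF U z(1)] eventually_at_right_less[of 0] by eventually_elim (simp add: F)
    show "\<forall>\<^sub>F s in at_right 0. det (F2 (line ?z s)) = det (ghat2 s c q)"
      using eventually_line[OF U z(1)] eventually_at_right_less[of 0] by eventually_elim (simp add: F)
  qed
  \<comment> \<open>Dividing by \<open>det (h c q)\<close> normalises the limit to 1, which provides
    the positivity that \<open>jet_sqrt\<close> asks for.\<close>
  from jet_cmult[OF this, of "1 / det (h c q)"]
  have "jet CARD('b) (\<lambda>s. det (ghat1 s c q) / det (h c q)) (\<lambda>s. det (ghat2 s c q) / det (h c q)) 1 0"
    using F.inv[OF z(1)] \<open>F1 ?z = h c q\<close> by (simp add: invertible_det_nz)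
  from jet_sqrt[OF this] show ?thesis
    by (intro smalloI_tendsto) (auto simp: jet_def eventually_at_filter)
qed

text \<open>An error of order \<open>o(s^d)\<close> with \<open>d = CARD('b option) - 1\<close> is
  exactly what the remainder of the expansion absorbs, so all coefficients up to index d are
  shared.\<close>

lemma volume_expansion_transfer:
  fixes A :: "('m::t2_space, 'b::finite option) chart set"
  assumes A: "smooth_structure A"
    and 1: "APE A g1" "boundary_defining A x1" "normal_form A g1 h x1 \<epsilon>1 \<pi>1 ghat1"
    and 2: "APE A g2" "boundary_defining A x2" "normal_form A g2 h x2 \<epsilon>2 \<pi>2 ghat2"
    and v: "volume_expansion A h ghat1 v"
  shows "volume_expansion A h ghat2 v"
  unfolding volume_expansion_def
proof (intro ballI)
  fix c q assume c: "c \<in> bdry_atlas A" and q: "q \<in> fst c"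
  have card: "CARD('b option) - 1 = CARD('b)"
    by (simp add: card_UNIV_option)
  have "(\<lambda>s. sqrt (det (ghat2 s c q) / det (h c q)) - sqrt (det (ghat1 s c q) / det (h c q)))
    \<in> o[at_right 0](\<lambda>s. s ^ CARD('b))"
    using A 1 2 c q by (intro volume_density_unique) (auto simp: collar_coordinates_def)
  moreover have "(\<lambda>s. sqrt (det (ghat1 s c q) / det (h c q)) - (\<Sum>j\<le>CARD('b). v j q * s ^ j))
    \<in> o[at_right 0](\<lambda>s. s ^ CARD('b))"
    using v c q by (simp add: volume_expansion_def card)
  ultimately have "(\<lambda>s. (sqrt (det (ghat2 s c q) / det (h c q)) - sqrt (det (ghat1 s c q) / det (h c q)))
     + (sqrt (det (ghat1 s c q) / det (h c q)) - (\<Sum>j\<le>CARD('b). v j q * s ^ j))) \<in> o[at_right 0](\<lambda>s. s ^ CARD('b))"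
    by (rule sum_in_smallo)
  then show "(\<lambda>s. sqrt (det (ghat2 s c q) / det (h c q)) - (\<Sum>j\<le>CARD('b option) - 1. v j q * s ^ j))
    \<in> o[at_right 0](\<lambda>s. s ^ (CARD('b option) - 1))"
    unfolding card by simp
qed

text \<open>The same functions \<open>v\<close> serve for the second metric, whose collar and family
  come from \<open>special_boundary_defining\<close>; the two anomalies are then the same
  integral.\<close>

lemma has_conformal_anomaly_transfer:
  fixes A :: "('m::t2_space, 'b::finite option) chart set"
  assumes "smooth_structure A" "APE A g1" "APE A g2"
    and "special_boundary_defining A g1 h x1" "special_boundary_defining A g2 h x2"
    and "has_conformal_anomaly A g1 h x1 a"
  shows "has_conformal_anomaly A g2 h x2 a"
  using assms volume_expansion_transfer unfolding has_conformal_anomaly_def special_boundary_defining_def by metis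

theorem proposition3p3:
  fixes A :: "('m::t2_space, 'b::finite option) chart set"
    and g0 :: "('m, 'b option) tensor2"
    and g :: "real \<Rightarrow> ('m, 'b option) tensor2"
    and h :: "('m, 'b) tensor2"
    and x :: "real \<Rightarrow> 'm \<Rightarrow> real"
    and T0 :: real
  assumes "odd CARD('b option)"
    and "compact_manifold_with_boundary A"
    and "APE A g0" and "unobstructed A g0"
    and "0 < T0"
    and "normalized_ricci_flow A T0 g" and "g 0 = g0"
    and "\<forall>t\<in>{0..<T0}. APE A (g t)"
    and "\<forall>t\<in>{0..<T0}. conformal_infinity A (g t) = conformal_infinity A g0"
    and "h \<in> conformal_infinity A g0"
    and "\<forall>t\<in>{0..<T0}. special_boundary_defining A (g t) h (x t)"
  shows "(\<lambda>t. conformal_anomaly A (g t) h (x t)) constant_on {0..<T0}"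
proof -
  have A: "smooth_structure A"
    using assms(2) by (simp add: compact_manifold_with_boundary_def)
  \<comment> \<open>The transfer is used in both directions between time \<open>t\<close> and time
    0, which makes the predicates equal.\<close>
  have eq: "has_conformal_anomaly A (g t) h (x t) = has_conformal_anomaly A (g 0) h (x 0)" if "t \<in> {0..<T0}" for t
  proof -
    have "0 \<in> {0..<T0}" using assms(5) by simp
    with that show ?thesis
      using has_conformal_anomaly_transfer[OF A] assms(8,11) by blast
  qed
  \<comment> \<open>Equal predicates have equal definite descriptions, so the values agree.\<close>
  have "conformal_anomaly A (g t) h (x t) = conformal_anomaly A (g 0) h (x 0)" if "t \<in> {0..<T0}" for t
    by (simp only: conformal_anomaly_def eq[OF that])
  then show ?thesis
    unfolding constant_on_def by blast
qed

end
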